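(* Let $(\mathcal X,d,\mu)$ be a separable, upper doubling, geometrically doubling metric measure space with $\mu(\{x\})=0$ for all $x\in\mathcal X$. Let $T$ be a Calderón–Zygmund operator with standard kernel $K$ which is bounded on $L^2(\mu)$, and let $T^\sharp$ be the maximal operator associated with $T$. Then: (i) Let $p\in(1,\infty)$. There exists a positive constant $c$ such that $\|T^\sharp f\|_{L^p(\mu)}\le c\|f\|_{L^p(\mu)}$ for all $f\in L^p(\mu)$. (ii) There exists a positive constant $\tilde c$ such that $\|T^\sharp\nu\|_{L^{1,\infty}(\mu)}\le\tilde c\,\|\nu\|$ for all $\nu\in\mathscr M(\mathcal X)$. Moreover, $\|T^\sharp f\|_{L^{1,\infty}(\mu)}\le\tilde c\,\|f\|_{L^1(\mu)}$ for all $f\in L^1(\mu)$.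
   Context: Setting. $(\mathcal X,d)$ is a separable metric space, $B(x,r)=\{y\in\mathcal X: d(x,y)<r\}$, and $\mu$ is a nonnegative Borel measure on $\mathcal X$ such that: - (upper doubling) there are a dominating function $\lambda:\mathcal X\times(0,\infty)\to(0,\infty)$ and a constant $C_\lambda>0$ such that for each $x$ the map $r\mapsto\lambda(x,r)$ is non-decreasing, and $\mu(B(x,r))\le\lambda(x,r)\le C_\lambda\lambda(x,r/2)$ for all $x\in\mathcal X$, $r\in(0,\infty)$; moreover $\lambda$ is always assumed to satisfy, for some constant $\widetilde C_\lambda>0$, $\lambda(x,r)\le\widetilde C_\lambda\lambda(y,r)$ whenever $d(x,y)\le r$; - (geometrically doubling) there is $N_0\in\{1,2,\dots\}$ such that every ball $B(x,r)$ can be covered by at most $N_0$ balls of radius $r/2$; - (non-atomic condition) $\mu(\{x\})=0$ for all $x\in\mathcal X$. Standard kernel: a map $K:(\mathcal X\times\mathcal X)\setminus\{(x,x):x\in\mathcal X\}\to\mathbb C$ for which there are constants $\tau\in(0,1]$ and $C>0$ with $|K(x,y)|\le C/\lambda(x,d(x,y))$ for all $x\ne y$, and $|K(x,y)-K(\tilde x,y)|+|K(y,x)-K(y,\tilde x)|\le C\,\dfrac{d(x,\tilde x)^\tau}{d(x,y)^\tau\lambda(x,d(x,y))}$ for all $x,\tilde x,y$ with $x\neq y$ and $d(x,y)\ge2d(x,\tilde x)$. Calderón–Zygmund operator with kernel $K$: a linear operator $T$ such that for all $f\in L^\infty_b(\mu)$ (bounded functions with bounded support) and all $x\notin\operatorname{supp}f$,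 $Tf(x)=\int_{\mathcal X}K(x,y)f(y)\,d\mu(y)$. Here $\operatorname{supp}f$ is the smallest closed set $F$ such that $f$ vanishes $\mu$-a.e. on $\mathcal X\setminus F$. Convention: $T$ is defined initially on $L^\infty_b(\mu)$ with values in (classes of) $\mu$-measurable functions, and whenever it is bounded in some $L^p$ or weak-type sense, $T$ also denotes its unique continuous extension to the corresponding $L^p(\mu)$. $\mathscr M(\mathcal X)$ is the space of all complex-valued Borel measures on $\mathcal X$, and $\|\nu\|$ is the total variation of $\nu$. Maximal operator: for functions $f$ and for $\nu\in\mathscr M(\mathcal X)$, $T^\sharp f(x)=\sup_{r>0}|T_rf(x)|$ and $T^\sharp\nu(x)=\sup_{r>0}|T_r\nu(x)|$, where $T_rf(x)=\int_{d(x,y)>r}K(x,y)f(y)\,d\mu(y)$ and $T_r\nu(x)=\int_{d(x,y)>r}K(x,y)\,d\nu(y)$ for $x\in\mathcal X$, $r>0$. The same formulas are used for $f\in L^p(\mu)$, $p\in[1,\infty)$. $\|g\|_{L^{1,\infty}(\mu)}=\sup_{t>0}t\,\mu(\{x:|g(x)|>t\})$. *)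

theory Defs
  imports "HOL-Analysis.Analysis"
begin

(* The ambient separable metric space is a type of sort {metric_space, second_countable_topology}:
   a metric space is separable iff it is second countable. *)

subsection \<open>The metric measure space\<close>

definition dominating_function :: "'a::metric_space measure \<Rightarrow> ('a \<Rightarrow> real \<Rightarrow> real) \<Rightarrow> bool" where
  "dominating_function \<mu> lam \<longleftrightarrow>
     (\<forall>x. \<forall>r>0. 0 < lam x r) \<and>
     (\<forall>x. mono_on {0<..} (lam x)) \<and>
     (\<exists>C>0. \<forall>x. \<forall>r>0. emeasure \<mu> (ball x r) \<le> ennreal (lam x r) \<and> lam x r \<le> C * lam x (r / 2)) \<and>
     (\<exists>C>0. \<forall>x y. \<forall>r>0. dist x y \<le> r \<longrightarrow> lam x r \<le> C * lam y r)"

definition geometrically_doubling :: "'a::metric_space itself \<Rightarrow> bool" where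
  "geometrically_doubling _ \<longleftrightarrow>
     (\<exists>N\<ge>1::nat. \<forall>x::'a. \<forall>r>0. \<exists>S. finite S \<and> card S \<le> N \<and> ball x r \<subseteq> (\<Union>y\<in>S. ball y (r / 2)))"

subsection \<open>Function spaces and norms\<close>

(* Real powers of extended nonnegative reals; only used for positive exponents. *)
definition ennreal_rpow :: "ennreal \<Rightarrow> real \<Rightarrow> ennreal" where
  "ennreal_rpow x p = (if x = top then top else ennreal (enn2real x powr p))"

definition Lp_norm :: "'a measure \<Rightarrow> real \<Rightarrow> ('a \<Rightarrow> ennreal) \<Rightarrow> ennreal" where
  "Lp_norm \<mu> p g = ennreal_rpow (\<integral>\<^sup>+ x. ennreal_rpow (g x) p \<partial>\<mu>) (1 / p)"

definition weak_L1_norm :: "'a measure \<Rightarrow> ('a \<Rightarrow> ennreal) \<Rightarrow> ennreal" where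
  "weak_L1_norm \<mu> g = (SUP t\<in>{0::real<..}. ennreal t * emeasure \<mu> {x \<in> space \<mu>. ennreal t < g x})"

definition Lp_space :: "'a measure \<Rightarrow> real \<Rightarrow> ('a \<Rightarrow> complex) set" where
  "Lp_space \<mu> p = {f \<in> borel_measurable \<mu>. Lp_norm \<mu> p (\<lambda>x. ennreal (norm (f x))) < top}"

definition ess_supp :: "'a::topological_space measure \<Rightarrow> ('a \<Rightarrow> complex) \<Rightarrow> 'a set" where
  "ess_supp \<mu> f = \<Inter> {F. closed F \<and> (AE x in \<mu>. x \<notin> F \<longrightarrow> f x = 0)}"

definition Linf_b :: "'a::metric_space measure \<Rightarrow> ('a \<Rightarrow> complex) set" where
  "Linf_b \<mu> = {f \<in> borel_measurable \<mu>.
     (\<exists>B. AE x in \<mu>. norm (f x) \<le> B) \<and> bounded (ess_supp \<mu> f)}"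

subsection \<open>Kernels and operators\<close>

(* K is a total function; its values on the diagonal are unconstrained. *)
definition standard_kernel ::
    "('a::metric_space \<Rightarrow> real \<Rightarrow> real) \<Rightarrow> ('a \<Rightarrow> 'a \<Rightarrow> complex) \<Rightarrow> bool" where
  "standard_kernel lam K \<longleftrightarrow>
     (\<exists>\<tau> C. 0 < \<tau> \<and> \<tau> \<le> 1 \<and> 0 < C \<and>
       (\<forall>x y. x \<noteq> y \<longrightarrow> norm (K x y) \<le> C / lam x (dist x y)) \<and>
       (\<forall>x x' y. x \<noteq> y \<and> 2 * dist x x' \<le> dist x y \<longrightarrow>
          norm (K x y - K x' y) + norm (K y x - K y x')
            \<le> C * (dist x x' powr \<tau> / (dist x y powr \<tau> * lam x (dist x y)))))"

(* An operator from classes of functions in Linf_b to classes of measurable functions is given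
   by its action on representatives, so each identity between values holds almost everywhere. *)
definition CZ_operator ::
    "'a::metric_space measure \<Rightarrow> ('a \<Rightarrow> 'a \<Rightarrow> complex) \<Rightarrow>
     (('a \<Rightarrow> complex) \<Rightarrow> 'a \<Rightarrow> complex) \<Rightarrow> bool" where
  "CZ_operator \<mu> K T \<longleftrightarrow>
     (\<forall>f\<in>Linf_b \<mu>. T f \<in> borel_measurable \<mu>) \<and>
     (\<forall>f\<in>Linf_b \<mu>. \<forall>g\<in>Linf_b \<mu>. (AE x in \<mu>. f x = g x) \<longrightarrow> (AE x in \<mu>. T f x = T g x)) \<and>
     (\<forall>f\<in>Linf_b \<mu>. \<forall>g\<in>Linf_b \<mu>. AE x in \<mu>. T (\<lambda>y. f y + g y) x = T f x + T g x) \<and>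
     (\<forall>f\<in>Linf_b \<mu>. \<forall>c. AE x in \<mu>. T (\<lambda>y. c * f y) x = c * T f x) \<and>
     (\<forall>f\<in>Linf_b \<mu>. AE x in \<mu>. x \<notin> ess_supp \<mu> f \<longrightarrow> T f x = (\<integral>y. K x y * f y \<partial>\<mu>))"

(* Linf_b is dense in L^p for finite p >= 1, so this estimate says that T has a (unique)
   bounded extension to L^p. *)
definition bounded_on_Lp ::
    "'a::metric_space measure \<Rightarrow> real \<Rightarrow> (('a \<Rightarrow> complex) \<Rightarrow> 'a \<Rightarrow> complex) \<Rightarrow> bool" where
  "bounded_on_Lp \<mu> p T \<longleftrightarrow>
     (\<exists>C>0. \<forall>f\<in>Linf_b \<mu>.
        Lp_norm \<mu> p (\<lambda>x. ennreal (norm (T f x))) \<le> ennreal C * Lp_norm \<mu> p (\<lambda>x. ennreal (norm (f x))))"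

subsection \<open>Complex measures\<close>

(* A complex Borel measure is a countably additive set function; its values on non-Borel sets
   are junk. *)
definition complex_measure :: "('a::topological_space set \<Rightarrow> complex) \<Rightarrow> bool" where
  "complex_measure \<nu> \<longleftrightarrow>
     (\<forall>A::nat \<Rightarrow> 'a set. range A \<subseteq> sets borel \<longrightarrow> disjoint_family A \<longrightarrow> (\<lambda>n. \<nu> (A n)) sums \<nu> (\<Union>n. A n))"

definition total_variation :: "('a::topological_space set \<Rightarrow> complex) \<Rightarrow> ennreal" where
  "total_variation \<nu> =
     (SUP A\<in>{A::nat \<Rightarrow> 'a set. range A \<subseteq> sets borel \<and> disjoint_family A \<and> (\<Union>n. A n) = UNIV}.
        \<Sum>n. ennreal (norm (\<nu> (A n))))"

(* Positive variation of a real-valued countably additive set function s, i.e. the measure s+ of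
   its Jordan decomposition; the negative variation is the positive variation of -s. Restricted to
   Borel sets the supremum is countably additive whenever s is, so measure_of does not collapse. *)
definition pos_variation :: "('a::topological_space set \<Rightarrow> real) \<Rightarrow> 'a measure" where
  "pos_variation s =
     measure_of UNIV (sets borel) (\<lambda>A. SUP B\<in>{B \<in> sets borel. B \<subseteq> A}. ennreal (s B))"

definition cm_integral :: "('a::topological_space set \<Rightarrow> complex) \<Rightarrow> ('a \<Rightarrow> complex) \<Rightarrow> complex" where
  "cm_integral \<nu> g =
     (\<integral>x. g x \<partial>pos_variation (\<lambda>A. Re (\<nu> A))) - (\<integral>x. g x \<partial>pos_variation (\<lambda>A. - Re (\<nu> A))) +
     \<i> * ((\<integral>x. g x \<partial>pos_variation (\<lambda>A. Im (\<nu> A))) - (\<integral>x. g x \<partial>pos_variation (\<lambda>A. - Im (\<nu> A))))"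

subsection \<open>Truncated and maximal operators\<close>

definition truncated_fun ::
    "'a::metric_space measure \<Rightarrow> ('a \<Rightarrow> 'a \<Rightarrow> complex) \<Rightarrow> real \<Rightarrow> ('a \<Rightarrow> complex) \<Rightarrow> 'a \<Rightarrow> complex" where
  "truncated_fun \<mu> K r f x = (LINT y:{y. r < dist x y}|\<mu>. K x y * f y)"

definition truncated_meas ::
    "('a::metric_space \<Rightarrow> 'a \<Rightarrow> complex) \<Rightarrow> real \<Rightarrow> ('a set \<Rightarrow> complex) \<Rightarrow> 'a \<Rightarrow> complex" where
  "truncated_meas K r \<nu> x = cm_integral \<nu> (\<lambda>y. indicator {y. r < dist x y} y * K x y)"

definition maximal_fun ::
    "'a::metric_space measure \<Rightarrow> ('a \<Rightarrow> 'a \<Rightarrow> complex) \<Rightarrow> ('a \<Rightarrow> complex) \<Rightarrow> 'a \<Rightarrow> ennreal" where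
  "maximal_fun \<mu> K f x = (SUP r\<in>{0<..}. ennreal (norm (truncated_fun \<mu> K r f x)))"

definition maximal_meas ::
    "('a::metric_space \<Rightarrow> 'a \<Rightarrow> complex) \<Rightarrow> ('a set \<Rightarrow> complex) \<Rightarrow> 'a \<Rightarrow> ennreal" where
  "maximal_meas K \<nu> x = (SUP r\<in>{0<..}. ennreal (norm (truncated_meas K r \<nu> x)))"

end

theory Submission
  imports Defs
begin

text \<open>Everything is reduced to finite positive measures \<open>\<nu>\<close>. For bounded \<open>f \<ge> 0\<close> with bounded support, the
  truncation at \<open>r\<close> of the operator applied to \<open>f \<mu>\<close> is compared with the mean of \<open>T f\<close> over the first
  doubling ball of radius at least \<open>r\<close> (non-doubling scales contribute a geometric series); this
  gives the weak type (2,2) of the maximal operator, using only the bound of \<open>T\<close> on \<open>L\<^sup>2\<close>. For a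
  finite sum of atoms, a Calderon-Zygmund decomposition in the manner of Tolsa spreads each atom over
  a doubling ball, with almost disjoint densities: the spread-out part is controlled by weak type
  (2,2), each difference by cancellation far from the ball and by Kolmogorov's inequality near it.
  This is weak type (1,1) for atomic measures, and for all finite measures by pointwise approximation.
  For \<open>1 < p < \<infinity>\<close> one integrates a good-\<open>\<lambda>\<close> inequality. It is localised on doubling balls centred at
  the points of the level set; those exist below almost every scale because the space is
  geometrically doubling.\<close>

subsection \<open>Covering and the maximal function\<close>

text \<open>As \<mu> need not be doubling, balls are compared with the \<mu>-measure of their
  triples, which is what the covering lemma yields, and arguments that need true doubling are moved
  to balls with \<mu>(16 B) \<le> A \<mu>(B). Two lower bounds on \<open>A\<close> supply them: by 2
  Cl^4 \<le> A an endless upward chain of non-doubling scales would outgrow \<open>lam\<close>; by 2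
  N^4 \<le> A the points with an endless downward chain are too few to carry mass. Across
  non-doubling scales the size bound of the kernel is summable, so skipping them costs a constant.

  Finite sums of atoms are treated first because their stopping balls form a finite family, centred
  at the atoms, which can be ordered by radius. These balls overlap, so a disjoint decomposition is
  not at hand.

  Interpolation between weak types (1,1) and (2,2) would stop at p = 2. The good-\<lambda>
  inequality rests on weak type (1,1) and the maximal function alone and gives all p > 1 at once.
  Absorbing its last term needs an integral known to be finite; this is why the maximal operator is
  cut at a height \<open>L\<close>.\<close>

lemma finite_Vitali_3r:
  fixes c :: "'i \<Rightarrow> 'a::metric_space" and r :: "'i \<Rightarrow> real"
  assumes "finite I"
  shows "\<exists>J\<subseteq>I. disjoint_family_on (\<lambda>i. ball (c i) (r i)) J \<and>
           (\<Union>i\<in>I. ball (c i) (r i)) \<subseteq> (\<Union>j\<in>J. ball (c j) (3 * r j))"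
  using assms
proof (induction I rule: finite_ranking_induct[where f = "\<lambda>i. - r i"])
  case empty
  then show ?case by (auto simp: disjoint_family_on_def)
next
  case (insert x S)
  then obtain J where J: "J \<subseteq> S" "disjoint_family_on (\<lambda>i. ball (c i) (r i)) J"
    "(\<Union>i\<in>S. ball (c i) (r i)) \<subseteq> (\<Union>j\<in>J. ball (c j) (3 * r j))" by auto
  show ?case
  proof (cases "\<exists>j\<in>J. ball (c x) (r x) \<inter> ball (c j) (r j) \<noteq> {}")
    case True
    then obtain j z where j: "j \<in> J" and z: "dist (c x) z < r x" "dist (c j) z < r j" by auto
    \<comment> \<open>The induction ranks by \<open>- r i\<close>, so the ball added last has the
      smallest radius and disappears in the triple of any selected ball that it meets.\<close>
    have le: "r x \<le> r j" using insert.hyps(2)[of j] j J(1) by auto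
    have "ball (c x) (r x) \<subseteq> ball (c j) (3 * r j)"
    proof
      fix y assume "y \<in> ball (c x) (r x)"
      then have "dist (c x) y < r x" by simp
      moreover have "dist (c j) y \<le> dist (c j) z + dist (c x) z + dist (c x) y"
        by (metis dist_commute dist_triangle add_right_mono dist_triangle_le)
      ultimately show "y \<in> ball (c j) (3 * r j)" using z le by auto
    qed
    then have "(\<Union>i\<in>insert x S. ball (c i) (r i)) \<subseteq> (\<Union>j\<in>J. ball (c j) (3 * r j))"
      using J(3) j by auto
    then show ?thesis using J by blast
  next
    case False
    have "disjoint_family_on (\<lambda>i. ball (c i) (r i)) (insert x J)"
      using J(2) False unfolding disjoint_family_on_def by blast
    moreover have "ball (c x) (r x) \<subseteq> ball (c x) (3 * r x)"
      using zero_le_dist[of "c x"] by (auto, smt (verit) zero_le_dist)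
    ultimately show ?thesis using J by (intro exI[of _ "insert x J"]) blast
  qed
qed

text \<open>Lindelof's theorem and continuity from below reduce the union to finite families, from
  which disjoint balls with covering triples are selected. The bound is asked only of disjoint
  families: in this form the covering argument serves the maximal theorem, the heavy balls of the
  decomposition and the good-\<lambda> inequality.\<close>

lemma emeasure_Union_balls_le:
  fixes c :: "'i \<Rightarrow> 'a::{metric_space, second_countable_topology}" and r :: "'i \<Rightarrow> real"
  assumes M: "sets M = sets borel"
    and S: "\<And>J. J \<subseteq> I \<Longrightarrow> finite J \<Longrightarrow> disjoint_family_on (\<lambda>i. ball (c i) (r i)) J \<Longrightarrow>
               (\<Sum>j\<in>J. emeasure M (ball (c j) (3 * r j))) \<le> S"
  shows "emeasure M (\<Union>i\<in>I. ball (c i) (r i)) \<le> S"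
proof -
  let ?B = "\<lambda>i. ball (c i) (r i)"
  have Bsets: "?B i \<in> sets M" "ball (c i) (3 * r i) \<in> sets M" for i by (auto simp: M)
  have fin: "emeasure M (\<Union>i\<in>J. ?B i) \<le> S" if J: "finite J" "J \<subseteq> I" for J
  proof -
    obtain J' where J': "J' \<subseteq> J" "disjoint_family_on ?B J'"
       "(\<Union>i\<in>J. ?B i) \<subseteq> (\<Union>j\<in>J'. ball (c j) (3 * r j))"
      using finite_Vitali_3r[OF J(1), of c r] by auto
    have fJ': "finite J'" using J'(1) J(1) finite_subset by blast
    have "emeasure M (\<Union>i\<in>J. ?B i) \<le> emeasure M (\<Union>j\<in>J'. ball (c j) (3 * r j))"
      by (intro emeasure_mono J') (auto intro!: sets.finite_UN fJ' Bsets)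
    also have "\<dots> \<le> (\<Sum>j\<in>J'. emeasure M (ball (c j) (3 * r j)))"
      by (intro emeasure_subadditive_finite fJ') (use Bsets in auto)
    also have "\<dots> \<le> S" using S[OF _ fJ' J'(2)] J' J by auto
    finally show ?thesis .
  qed
  obtain F where F: "F \<subseteq> ?B ` I" "countable F" "\<Union>F = \<Union>(?B ` I)"
    by (rule Lindelof[of "?B ` I"]) auto
  obtain I' where I': "countable I'" "I' \<subseteq> I" "F = ?B ` I'"
    using iffD1[OF countable_subset_image[of F ?B I]] F(1,2) by auto
  show ?thesis
  proof (cases "I' = {}")
    case True
    then show ?thesis using F I' by (metis Union_empty emeasure_empty image_empty zero_le)
  next
    case False
    define e where "e = from_nat_into I'"
    have re: "range e = I'" unfolding e_def using False I'(1) by (simp add: range_from_nat_into)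
    let ?U = "\<lambda>n. \<Union>i\<in>e ` {..n}. ?B i"
    have U: "(\<Union>i\<in>I. ?B i) = (\<Union>n. ?U n)"
    proof -
      have "(\<Union>i\<in>I. ?B i) = (\<Union>i\<in>range e. ?B i)" using F(3) I'(3) re by simp
      then show ?thesis by auto
    qed
    have inc: "incseq ?U" unfolding incseq_def by (intro allI impI UN_mono image_mono) auto
    have "emeasure M (\<Union>n. ?U n) = (SUP n. emeasure M (?U n))"
      by (intro SUP_emeasure_incseq[symmetric] inc) (auto simp: M intro!: borel_open)
    also have "\<dots> \<le> S"
      using re I'(2) by (intro SUP_least fin) auto
    finally show ?thesis using U by simp
  qed
qed

text \<open>A bound \<open>m\<close> for the uncentred maximal function of \<open>\<nu>\<close> at \<open>x\<close>, with the denominator cleared because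
  balls may be \<open>\<mu>\<close>-null. The enlargement factor 3 is the one of the covering lemma.\<close>

definition maximal_le :: "'a::metric_space measure \<Rightarrow> 'a measure \<Rightarrow> real \<Rightarrow> 'a \<Rightarrow> bool" where
  "maximal_le \<mu> \<nu> m x \<longleftrightarrow>
     (\<forall>y r. x \<in> ball y r \<longrightarrow> measure \<nu> (ball y r) \<le> m * measure \<mu> (ball y (3 * r)))"

lemma maximal_leD:
  assumes "maximal_le \<mu> \<nu> m x" "dist y x < r"
  shows "measure \<nu> (ball y r) \<le> m * measure \<mu> (ball y (3 * r))"
  using assms unfolding maximal_le_def by (auto simp: dist_commute)

subsection \<open>Upper doubling spaces\<close>

text \<open>The parameter \<open>A\<close> is the doubling threshold of \<open>dbl\<close> below. By \<open>A_ge\<close> the measures of successive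
  non-doubling balls grow at least twice as fast as the dominating function.\<close>

locale upper_doubling_space =
  fixes \<mu> :: "'a::{metric_space, second_countable_topology} measure"
    and lam :: "'a \<Rightarrow> real \<Rightarrow> real" and Cl Ct A :: real
  assumes sets_mu: "sets \<mu> = sets borel"
    and lam_pos: "0 < r \<Longrightarrow> 0 < lam x r"
    and lam_mono: "0 < r \<Longrightarrow> r \<le> s \<Longrightarrow> lam x r \<le> lam x s"
    and mu_ball: "0 < r \<Longrightarrow> emeasure \<mu> (ball x r) \<le> ennreal (lam x r)"
    and lam_half: "0 < r \<Longrightarrow> lam x r \<le> Cl * lam x (r / 2)"
    and lam_shift: "0 < r \<Longrightarrow> dist x y \<le> r \<Longrightarrow> lam x r \<le> Ct * lam y r"
    and Cl_ge_1: "1 \<le> Cl" and Ct_ge_1: "1 \<le> Ct"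
    and A_ge: "2 * Cl ^ 4 \<le> A"
begin

lemma space_mu [simp]: "space \<mu> = UNIV"
  using sets_eq_imp_space_eq[OF sets_mu] by simp

lemmas [measurable_cong, simp] = sets_mu

lemma A_ge_2: "2 \<le> A"
  using A_ge one_le_power[OF Cl_ge_1, of 4] by linarith

lemma A_pos: "0 < A" using A_ge_2 by simp

lemma emeasure_ball_finite: "emeasure \<mu> (ball x r) < \<infinity>"
proof (cases "0 < r")
  case True
  then show ?thesis using mu_ball[OF True, of x] by (auto intro: le_less_trans)
qed (simp add: not_less ball_empty)

abbreviation vol :: "'a \<Rightarrow> real \<Rightarrow> real" where
  "vol x r \<equiv> measure \<mu> (ball x r)"

lemma emeasure_ball: "emeasure \<mu> (ball x r) = ennreal (vol x r)"
  using emeasure_ball_finite[of x r] by (simp add: emeasure_eq_ennreal_measure)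

lemma emeasure_subset_ball:
  assumes "B \<subseteq> ball x r"
  shows "emeasure \<mu> B = ennreal (measure \<mu> B)"
  using emeasure_mono[OF assms, of \<mu>] emeasure_ball_finite[of x r]
  by (intro emeasure_eq_ennreal_measure) (auto simp: top_unique)

lemma measure_ball_le: "0 < r \<Longrightarrow> vol x r \<le> lam x r"
  using mu_ball[of r x] lam_pos[of r x] by (simp add: emeasure_ball)

lemma measure_ball_mono: "ball x r \<subseteq> ball y s \<Longrightarrow> vol x r \<le> vol y s"
  using emeasure_ball_finite[of y s]
  by (intro measure_mono_fmeasurable) (auto simp: fmeasurable_def)

lemma measure_ball_mono': "r \<le> s \<Longrightarrow> vol x r \<le> vol x s"
  by (intro measure_ball_mono) auto

lemma lam_double: "0 < r \<Longrightarrow> lam x (2 ^ n * r) \<le> Cl ^ n * lam x r"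
proof (induction n)
  case (Suc n)
  have "lam x (2 ^ Suc n * r) \<le> Cl * lam x (2 ^ n * r)"
    using lam_half[of "2 ^ Suc n * r" x] Suc.prems by simp
  also have "\<dots> \<le> Cl * (Cl ^ n * lam x r)"
    using Suc Cl_ge_1 by (intro mult_left_mono) auto
  finally show ?case by simp
qed simp

lemma lam_le:
  assumes "0 < r" "s \<le> 2 ^ n * r" "0 < s"
  shows "lam x s \<le> Cl ^ n * lam x r"
  using lam_mono[of s "2 ^ n * r" x] lam_double[of r x n] assms by linarith

lemma sigma_finite_mu: "sigma_finite_measure \<mu>"
proof
  fix x0 :: 'a
  have "(\<Union>n::nat. ball undefined (real n)) = (UNIV :: 'a set)"
    by (auto simp: reals_Archimedean2)
  then show "\<exists>A. countable A \<and> A \<subseteq> sets \<mu> \<and> \<Union> A = space \<mu> \<and> (\<forall>a\<in>A. emeasure \<mu> a \<noteq> \<infinity>)"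
    using emeasure_ball_finite
    by (intro exI[of _ "range (\<lambda>n::nat. ball undefined (real n))"]) (auto simp: less_top)
qed

text \<open>The points outside the support of \<mu> are covered by null balls, and by Lindelof's
  theorem by countably many of them. Positive volume is what lets the search for a doubling radius
  end.\<close>

lemma AE_ball_pos: "AE x in \<mu>. \<forall>r>0. 0 < vol x r"
proof -
  let ?B = "{ball y r | y r. vol y r = 0}"
  obtain F where F: "F \<subseteq> ?B" "countable F" "\<Union>F = \<Union>?B"
    by (rule Lindelof[of ?B]) auto
  have "S \<in> null_sets \<mu>" if "S \<in> F" for S
    using that F(1) by (fastforce simp: null_sets_def emeasure_ball)
  then have "\<Union>F \<in> null_sets \<mu>" using F(2) by (intro null_sets_UN'[of F "\<lambda>x. x", simplified])
  moreover have "{x \<in> space \<mu>. \<not> (\<forall>r>0. 0 < vol x r)} \<subseteq> \<Union>F"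
  proof
    fix x assume "x \<in> {x \<in> space \<mu>. \<not> (\<forall>r>0. 0 < vol x r)}"
    then obtain r where "r > 0" "vol x r = 0" by (auto simp: not_less measure_le_0_iff)
    then have "x \<in> ball x r" "ball x r \<in> ?B" by auto
    then show "x \<in> \<Union>F" unfolding F(3) by blast
  qed
  ultimately show ?thesis by (rule AE_I')
qed

text \<open>A ball that violates the bound does so for each of its points, because the maximal
  function is uncentred. Measurability of the level sets follows.\<close>

lemma open_not_maximal_le: "open {x. \<not> maximal_le \<mu> \<nu> m x}"
proof -
  have "{x. \<not> maximal_le \<mu> \<nu> m x} =
    (\<Union>(y, r)\<in>{(y, r). \<not> measure \<nu> (ball y r) \<le> m * vol y (3 * r)}. ball y r)"
    unfolding maximal_le_def by blast
  then show ?thesis by auto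
qed

lemma not_maximal_le_sets [measurable]: "{x. \<not> maximal_le \<mu> \<nu> m x} \<in> sets borel"
  using open_not_maximal_le by (rule borel_open)

text \<open>On a disjoint family of violating balls the triples have total \<mu>-measure at most the
  \<nu>-mass of the balls divided by \<open>m\<close>, which is the hypothesis of the covering
  argument with constant 1.\<close>

lemma maximal_weak_type:
  assumes nu: "finite_measure \<nu>" "sets \<nu> = sets borel" and m: "0 < m"
  shows "emeasure \<mu> {x. \<not> maximal_le \<mu> \<nu> m x} \<le> ennreal (measure \<nu> UNIV / m)"
proof -
  interpret nu: finite_measure \<nu> by fact
  let ?I = "{(y, r). \<not> measure \<nu> (ball y r) \<le> m * vol y (3 * r)}"
  have eq: "{x. \<not> maximal_le \<mu> \<nu> m x} = (\<Union>i\<in>?I. ball (fst i) (snd i))"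
    unfolding maximal_le_def by force
  show ?thesis unfolding eq
  proof (rule emeasure_Union_balls_le[OF sets_mu])
    fix J assume J: "J \<subseteq> ?I" "finite J" "disjoint_family_on (\<lambda>i. ball (fst i) (snd i)) J"
    have "(\<Sum>j\<in>J. emeasure \<mu> (ball (fst j) (3 * snd j))) = ennreal (\<Sum>j\<in>J. measure \<mu> (ball (fst j) (3 * snd j)))"
      by (simp add: emeasure_ball sum_ennreal)
    also have "\<dots> \<le> ennreal (\<Sum>j\<in>J. measure \<nu> (ball (fst j) (snd j)) / m)"
      using J(1) m by (intro ennreal_leI sum_mono) (auto simp: field_simps not_le less_imp_le)
    also have "(\<Sum>j\<in>J. measure \<nu> (ball (fst j) (snd j)) / m) = measure \<nu> (\<Union>j\<in>J. ball (fst j) (snd j)) / m"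
      using J nu(2) by (subst nu.finite_measure_finite_Union) (auto simp: sum_divide_distrib)
    also have "ennreal \<dots> \<le> ennreal (measure \<nu> UNIV / m)"
      using m nu(2) nu.bounded_measure sets_eq_imp_space_eq[OF nu(2)]
      by (intro ennreal_leI divide_right_mono) auto
    finally show "(\<Sum>j\<in>J. emeasure \<mu> (ball (fst j) (3 * snd j))) \<le> ennreal (measure \<nu> UNIV / m)" .
  qed
qed

text \<open>The ratio 16 = 2^4 lets \<open>lam\<close> grow by at most Cl^4 per step, and it leaves
  room for the radii 12 r and 15 r that arise when balls of radius 4 r and 5 r are tripled.\<close>

definition dbl :: "'a \<Rightarrow> real \<Rightarrow> bool" where
  "dbl x r \<longleftrightarrow> vol x (16 * r) \<le> A * vol x r"

text \<open>At the top scale the volume is at most \<open>lam\<close>. Each step down divides the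
  volume by at least A \<ge> 2 Cl^4 and \<open>lam\<close> by at most Cl^4, so the ratio of the two
  is halved.\<close>

lemma not_dbl_decay:
  assumes "0 < r" and nd: "\<And>i. i < n \<Longrightarrow> \<not> dbl x (16 ^ i * r)" and "i \<le> n"
  shows "vol x (16 ^ i * r) \<le> (1/2) ^ (n - i) * lam x (16 ^ i * r)"
  using \<open>i \<le> n\<close>
proof (induction rule: inc_induct)
  case base
  then show ?case using measure_ball_le[of "16 ^ n * r" x] assms(1) by simp
next
  case (step j)
  have "A * vol x (16 ^ j * r) \<le> vol x (16 ^ Suc j * r)"
    using nd[OF step.hyps(2)] by (simp add: dbl_def mult.assoc)
  also have "\<dots> \<le> (1/2) ^ (n - Suc j) * lam x (16 ^ Suc j * r)" by (rule step.IH)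
  also have "\<dots> \<le> (1/2) ^ (n - Suc j) * (Cl ^ 4 * lam x (16 ^ j * r))"
    using lam_double[of "16 ^ j * r" x 4] assms(1) by (intro mult_left_mono) (auto simp: mult.assoc)
  also have "\<dots> \<le> (1/2) ^ (n - Suc j) * (A / 2 * lam x (16 ^ j * r))"
    using A_ge lam_pos[of "16 ^ j * r" x] assms(1) by (intro mult_left_mono mult_right_mono) auto
  also have "\<dots> = A * ((1/2) ^ (n - j) * lam x (16 ^ j * r))"
    using step.hyps(2) by (simp add: Suc_diff_Suc[symmetric])
  finally show ?case using A_pos by simp
qed

text \<open>If all scales above \<open>r\<close> were non-doubling, the decay from ever higher top
  scales would force the volume at \<open>r\<close> to be 0.\<close>

lemma ex_dbl:
  assumes "0 < r" "0 < vol x r"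
  shows "\<exists>n. dbl x (16 ^ n * r) \<and> (\<forall>i<n. \<not> dbl x (16 ^ i * r))"
proof -
  have "\<exists>n. dbl x (16 ^ n * r)"
  proof (rule ccontr)
    assume *: "\<not> ?thesis"
    have "vol x r \<le> (1/2) ^ n * lam x r" for n
      using not_dbl_decay[of r n x 0] * assms by auto
    moreover have "(\<lambda>n. (1/2) ^ n * lam x r) \<longlonglongrightarrow> 0 * lam x r"
      by (intro tendsto_mult LIMSEQ_power_zero) auto
    ultimately have "vol x r \<le> 0"
      by (intro LIMSEQ_le_const) auto
    then show False using assms by simp
  qed
  then show ?thesis using exists_least_iff[of "\<lambda>n. dbl x (16 ^ n * r)"] by auto
qed

end

subsection \<open>Shells, tails and truncated operators\<close>

lemma norm_integral_le_of_nn_integral: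
  fixes h :: "'a \<Rightarrow> 'b::{banach, second_countable_topology}"
  assumes "(\<integral>\<^sup>+ y. ennreal (norm (h y)) \<partial>M) \<le> ennreal c" "0 \<le> c"
  shows "norm (\<integral>y. h y \<partial>M) \<le> c"
proof (cases "integrable M h")
  case True
  have "ennreal (norm (\<integral>y. h y \<partial>M)) \<le> ennreal c"
    using integral_norm_bound_ennreal[OF True] assms(1) by (rule order_trans)
  then show ?thesis using assms(2) by simp
qed (simp add: not_integrable_integral_eq assms(2))

section \<open>Integrals of 1/lam over annuli and weighted tails\<close>

context upper_doubling_space
begin

lemma lam_measurable:
  assumes "0 < a"
  shows "(\<lambda>s. indicator {a..} s * (1 / lam x s)) \<in> borel_measurable borel"
proof -
  \<comment> \<open>\<open>lam x\<close> is monotone on positive radii only; extended by 0 it is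
    monotone on the whole line, hence Borel.\<close>
  have "(\<lambda>s. if s > 0 then lam x s else 0) \<in> borel_measurable borel"
    by (intro borel_measurable_mono monoI)
       (auto intro: lam_mono less_imp_le[OF lam_pos])
  then have "(\<lambda>s. indicator {a..} s * (1 / (if s > 0 then lam x s else 0))) \<in> borel_measurable borel"
    by measurable
  also have "(\<lambda>s. indicator {a..} s * (1 / (if s > 0 then lam x s else 0))) = (\<lambda>s. indicator {a..} s * (1 / lam x s))"
    using assms by (auto simp: indicator_def)
  finally show ?thesis .
qed

lemma shell_integrand_measurable:
  assumes "0 < a" and [measurable_cong]: "sets \<nu> = sets borel"
  shows "(\<lambda>y. indicator {y. a \<le> dist x y \<and> dist x y < b} y * ennreal (1 / lam x (dist x y))) \<in> borel_measurable \<nu>"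
proof -
  note [measurable] = lam_measurable[OF assms(1)]
  have "(\<lambda>y. indicator {..<b} (dist x y) * ennreal (indicator {a..} (dist x y) * (1 / lam x (dist x y)))) \<in> borel_measurable \<nu>"
    by measurable
  also have "(\<lambda>y. indicator {..<b} (dist x y) * ennreal (indicator {a..} (dist x y) * (1 / lam x (dist x y)))) =
     (\<lambda>y. indicator {y. a \<le> dist x y \<and> dist x y < b} y * ennreal (1 / lam x (dist x y)))"
    by (auto simp: indicator_def)
  finally show ?thesis .
qed

text \<open>The size bound of the kernel integrated over an annulus, up to the factor
  \<open>CK\<close>. For \<nu> = \<mu> it is, up to an additive constant, Tolsa's coefficient
  comparing two concentric balls.\<close>

definition shell :: "'a measure \<Rightarrow> 'a \<Rightarrow> real \<Rightarrow> real \<Rightarrow> ennreal" where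
  "shell \<nu> x a b =
     (\<integral>\<^sup>+ y. indicator {y. a \<le> dist x y \<and> dist x y < b} y * ennreal (1 / lam x (dist x y)) \<partial>\<nu>)"

lemma shell_le:
  assumes "0 < a" and [measurable_cong]: "sets \<nu> = sets borel"
  shows "shell \<nu> x a b \<le> emeasure \<nu> (ball x b) * ennreal (1 / lam x a)"
proof -
  have "1 / lam x (dist x y) \<le> 1 / lam x a" if "a \<le> dist x y" for y
    using lam_pos[OF assms(1), of x] lam_mono[OF assms(1) that, of x] by (intro divide_left_mono) auto
  then have "shell \<nu> x a b \<le> (\<integral>\<^sup>+ y. ennreal (1 / lam x a) * indicator (ball x b) y \<partial>\<nu>)"
    unfolding shell_def by (intro nn_integral_mono) (auto simp: indicator_def intro!: ennreal_leI)
  also have "\<dots> = ennreal (1 / lam x a) * emeasure \<nu> (ball x b)"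
    by (subst nn_integral_cmult_indicator) (auto simp: assms)
  finally show ?thesis by (simp add: mult.commute)
qed

lemma shell_split:
  assumes "0 < a" "0 < b" "sets \<nu> = sets borel"
  shows "shell \<nu> x a c \<le> shell \<nu> x a b + shell \<nu> x b c"
proof -
  note m1 = shell_integrand_measurable[OF assms(1,3), of x b]
    and m2 = shell_integrand_measurable[OF assms(2,3), of x c]
  show ?thesis
    unfolding shell_def nn_integral_add[OF m1 m2, symmetric]
    by (intro nn_integral_mono) (auto simp: indicator_def)
qed

lemma shell_mono:
  assumes "a' \<le> a" "b \<le> b'"
  shows "shell \<nu> x a b \<le> shell \<nu> x a' b'"
  unfolding shell_def using assms by (intro nn_integral_mono) (auto simp: indicator_def)

text \<open>One annulus of ratio 16 costs a constant. The exponent 6 comes from the tripled outer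
  radius: 48 a \<le> 2^6 a.\<close>

lemma shell_16:
  assumes "0 < a" "sets \<nu> = sets borel" "0 \<le> m"
    and m: "\<And>s. 0 < s \<Longrightarrow> emeasure \<nu> (ball x s) \<le> ennreal (m * vol x (3 * s))"
  shows "shell \<nu> x a (16 * a) \<le> ennreal (m * Cl ^ 6)"
proof -
  have pos: "0 < lam x a" by (rule lam_pos[OF assms(1)])
  have "emeasure \<nu> (ball x (16 * a)) \<le> ennreal (m * vol x (3 * (16 * a)))"
    using m[of "16 * a"] assms(1) by simp
  also have "\<dots> \<le> ennreal (m * (Cl ^ 6 * lam x a))"
    using assms(1,3) measure_ball_le[of "3 * (16 * a)" x] lam_le[of a "3 * (16 * a)" 6 x]
    by (intro ennreal_leI mult_left_mono) auto
  finally have "shell \<nu> x a (16 * a) \<le> ennreal (m * (Cl ^ 6 * lam x a)) * ennreal (1 / lam x a)"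
    by (intro order_trans[OF shell_le[OF assms(1,2)] mult_right_mono]) simp_all
  also have "\<dots> = ennreal (m * Cl ^ 6)"
    using pos assms(3) Cl_ge_1 by (subst ennreal_mult[symmetric]) auto
  finally show ?thesis .
qed

lemma sum_half_powers_le: "(\<Sum>i<n. (1/2::real) ^ (n - i)) \<le> 1"
proof -
  have "(\<Sum>i<n. (1/2::real) ^ (n - i)) = (\<Sum>i<n. (1/2) ^ Suc i)"
    by (rule sum.reindex_bij_witness[of _ "\<lambda>i. n - Suc i" "\<lambda>i. n - Suc i"]) (auto simp: Suc_diff_Suc)
  also have "\<dots> = 1 - (1/2) ^ n"
    by (induction n) (auto simp: field_simps)
  finally show ?thesis by simp
qed

text \<open>Below a non-doubling chain the volume falls short of \<open>lam\<close> by a geometric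
  factor, so the annuli sum to a bound free of \<open>n\<close>. Passing from \<nu> to \<mu> triples
  the ball and so reaches up to scale i + 2; this loses the factor 4 in the decay and gives Cl^8, as
  16^2 = 2^8.\<close>

lemma shell_chain:
  assumes r: "0 < r" and \<nu>: "sets \<nu> = sets borel" and m0: "0 \<le> m"
    and m: "\<And>s. 0 < s \<Longrightarrow> emeasure \<nu> (ball x s) \<le> ennreal (m * vol x (3 * s))"
    and nd: "\<And>i. i < n \<Longrightarrow> \<not> dbl x (16 ^ i * r)"
  shows "shell \<nu> x r (16 ^ n * r) \<le> ennreal (m * (4 * Cl ^ 8))"
proof -
  have split: "shell \<nu> x r (16 ^ k * r) \<le> (\<Sum>i<k. shell \<nu> x (16 ^ i * r) (16 ^ Suc i * r))" for k
  proof (induction k)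
    case 0
    show ?case by (simp add: shell_def)
  next
    case (Suc k)
    have "shell \<nu> x r (16 ^ Suc k * r) \<le> shell \<nu> x r (16 ^ k * r) + shell \<nu> x (16 ^ k * r) (16 ^ Suc k * r)"
      by (intro shell_split \<nu>) (use r in auto)
    also have "\<dots> \<le> (\<Sum>i<k. shell \<nu> x (16 ^ i * r) (16 ^ Suc i * r)) + shell \<nu> x (16 ^ k * r) (16 ^ Suc k * r)"
      by (intro add_right_mono Suc.IH)
    finally show ?case by simp
  qed
  have trm: "shell \<nu> x (16 ^ i * r) (16 ^ Suc i * r) \<le> ennreal (m * (4 * Cl ^ 8) * (1/2) ^ (n - i))" if i: "i < n" for i
  proof -
    let ?a = "16 ^ i * r"
    have a: "0 < ?a" using r by simp
    have p: "0 < lam x ?a" by (rule lam_pos[OF a])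
    have l: "lam x (16 ^ Suc (Suc i) * r) \<le> Cl ^ 8 * lam x ?a"
      using lam_double[OF a, of x 8] by (simp add: mult.assoc)
    have half: "vol x (16 ^ Suc (Suc i) * r) \<le> 4 * (1/2) ^ (n - i) * lam x (16 ^ Suc (Suc i) * r)"
    proof (cases "Suc (Suc i) \<le> n")
      case True
      have "4 * (1/2::real) ^ (n - i) = (1/2) ^ (n - Suc (Suc i))"
        using True i by (simp add: Suc_diff_Suc[symmetric] Suc_le_eq)
      then show ?thesis using not_dbl_decay[OF r nd True] by simp
    next
      case False
      then have "n - i = 1" using i by simp
      moreover have "0 \<le> lam x (16 ^ Suc (Suc i) * r)" using lam_pos[of "16 ^ Suc (Suc i) * r" x] r by simp
      moreover have "vol x (16 ^ Suc (Suc i) * r) \<le> lam x (16 ^ Suc (Suc i) * r)"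
        using r by (intro measure_ball_le) simp
      ultimately show ?thesis by simp
    qed
    have "emeasure \<nu> (ball x (16 ^ Suc i * r)) \<le> ennreal (m * vol x (3 * (16 ^ Suc i * r)))"
      using m[of "16 ^ Suc i * r"] r by simp
    also have "\<dots> \<le> ennreal (m * (4 * (1/2) ^ (n - i) * (Cl ^ 8 * lam x ?a)))"
    proof (intro ennreal_leI mult_left_mono m0)
      have "vol x (3 * (16 ^ Suc i * r)) \<le> vol x (16 ^ Suc (Suc i) * r)"
        using r by (intro measure_ball_mono') simp
      also note half
      also have "4 * (1/2) ^ (n - i) * lam x (16 ^ Suc (Suc i) * r) \<le> 4 * (1/2) ^ (n - i) * (Cl ^ 8 * lam x ?a)"
        by (intro mult_left_mono l) auto
      finally show "vol x (3 * (16 ^ Suc i * r)) \<le> 4 * (1/2) ^ (n - i) * (Cl ^ 8 * lam x ?a)" .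
    qed
    finally have "shell \<nu> x ?a (16 ^ Suc i * r) \<le> ennreal (m * (4 * (1/2) ^ (n - i) * (Cl ^ 8 * lam x ?a))) * ennreal (1 / lam x ?a)"
      by (intro order_trans[OF shell_le[OF a \<nu>] mult_right_mono]) simp_all
    also have "\<dots> = ennreal (m * (4 * Cl ^ 8) * (1/2) ^ (n - i))"
      using p m0 Cl_ge_1 by (subst ennreal_mult[symmetric]) auto
    finally show ?thesis .
  qed
  have "shell \<nu> x r (16 ^ n * r) \<le> (\<Sum>i<n. ennreal (m * (4 * Cl ^ 8) * (1/2) ^ (n - i)))"
    using split[of n] by (rule order_trans) (intro sum_mono trm, auto)
  also have "\<dots> = ennreal (m * (4 * Cl ^ 8) * (\<Sum>i<n. (1/2) ^ (n - i)))"
    using m0 Cl_ge_1 by (subst sum_ennreal) (auto simp: sum_distrib_left)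
  also have "\<dots> \<le> ennreal (m * (4 * Cl ^ 8) * 1)"
    using m0 Cl_ge_1 sum_half_powers_le by (intro ennreal_leI mult_left_mono) auto
  finally show ?thesis by simp
qed

lemma tail_integrand_measurable:
  assumes "0 < r" and [measurable_cong]: "sets \<nu> = sets borel"
  shows "(\<lambda>y. indicator {y. r \<le> dist x y} y * ennreal ((r / dist x y) powr \<tau> / lam x (dist x y))) \<in> borel_measurable \<nu>"
proof -
  note [measurable] = lam_measurable[OF assms(1)]
  have "(\<lambda>y. ennreal ((r / dist x y) powr \<tau> * (indicator {r..} (dist x y) * (1 / lam x (dist x y))))) \<in> borel_measurable \<nu>"
    by measurable
  also have "(\<lambda>y. ennreal ((r / dist x y) powr \<tau> * (indicator {r..} (dist x y) * (1 / lam x (dist x y))))) =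
      (\<lambda>y. indicator {y. r \<le> dist x y} y * ennreal ((r / dist x y) powr \<tau> / lam x (dist x y)))"
    by (auto simp: indicator_def)
  finally show ?thesis .
qed

lemma ex_dyadic:
  fixes d \<rho> :: real
  assumes "0 < \<rho>" "\<rho> \<le> d"
  obtains i :: nat where "2 ^ i * \<rho> \<le> d" "d < 2 ^ Suc i * \<rho>"
proof -
  obtain n where n: "d < 2 ^ n * \<rho>"
    using real_arch_pow[of 2 "d / \<rho>"] assms by (auto simp: field_simps)
  define k where "k = (LEAST n. d < 2 ^ n * \<rho>)"
  have k: "d < 2 ^ k * \<rho>" unfolding k_def using n by (rule LeastI)
  have "k \<noteq> 0" using k assms by (intro notI) simp
  then obtain i where i: "k = Suc i" using not0_implies_Suc by blast
  have "\<not> d < 2 ^ i * \<rho>" using not_less_Least[of i "\<lambda>n. d < 2 ^ n * \<rho>"] i k_def by simp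
  then show ?thesis using that[of i] k i by simp
qed

text \<open>On the i-th dyadic annulus the weight is at most 2^(-i \<tau>), while the mass over
  \<open>lam\<close> is at most \<open>m\<close>; the geometric series gives the constant. This is
  the integral produced by the regularity of the kernel.\<close>

lemma nn_integral_tail_le:
  assumes \<rho>: "0 < \<rho>" and \<nu>: "sets \<nu> = sets borel" and \<tau>: "0 < \<tau>" and m: "0 \<le> m"
    and le: "\<And>s. \<rho> \<le> s \<Longrightarrow> emeasure \<nu> (ball x (2 * s)) \<le> ennreal (m * lam x s)"
  shows "(\<integral>\<^sup>+ y. indicator {y. \<rho> \<le> dist x y} y * ennreal ((\<rho> / dist x y) powr \<tau> / lam x (dist x y)) \<partial>\<nu>)
           \<le> ennreal (m / (1 - (1/2) powr \<tau>))"
proof -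
  define q :: real where "q = (1/2) powr \<tau>"
  have q: "0 < q" "q < 1" using powr_less_mono2[of \<tau> "1/2" 1] \<tau> by (auto simp: q_def)
  let ?g = "\<lambda>i y. ennreal (q ^ i / lam x (2 ^ i * \<rho>)) * indicator (ball x (2 ^ Suc i * \<rho>)) y"
  have pw: "indicator {y. \<rho> \<le> dist x y} y * ennreal ((\<rho> / dist x y) powr \<tau> / lam x (dist x y)) \<le> (\<Sum>i. ?g i y)" for y
  proof (cases "\<rho> \<le> dist x y")
    case True
    obtain i where i: "2 ^ i * \<rho> \<le> dist x y" "dist x y < 2 ^ Suc i * \<rho>"
      using ex_dyadic[OF \<rho> True] by blast
    have pos: "0 < lam x (2 ^ i * \<rho>)" using \<rho> by (intro lam_pos) simp
    have "0 < dist x y" using \<rho> True by linarith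
    then have "\<rho> / dist x y \<le> (1/2) ^ i"
      using i(1) by (simp add: field_simps)
    then have "(\<rho> / dist x y) powr \<tau> \<le> ((1/2) ^ i) powr \<tau>"
      using \<rho> \<tau> by (intro powr_mono2) auto
    also have "\<dots> = q ^ i"
      unfolding q_def by (simp add: powr_powr powr_realpow[symmetric] mult.commute)
    finally have "(\<rho> / dist x y) powr \<tau> / lam x (dist x y) \<le> q ^ i / lam x (2 ^ i * \<rho>)"
      using lam_mono[of "2 ^ i * \<rho>" "dist x y" x] i(1) \<rho> pos q by (intro frac_le) auto
    then have "indicator {y. \<rho> \<le> dist x y} y * ennreal ((\<rho> / dist x y) powr \<tau> / lam x (dist x y)) \<le> ?g i y"
      using True i(2) by (auto intro!: ennreal_leI)
    also have "\<dots> \<le> (\<Sum>i. ?g i y)"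
    proof -
      have "(\<Sum>j\<in>{i}. ?g j y) \<le> (\<Sum>j. ?g j y)" by (rule sum_le_suminf) auto
      then show ?thesis
        by (simp only: sum.insert finite.emptyI empty_iff not_False_eq_True sum.empty add_0_right)
    qed
    finally show ?thesis .
  qed simp
  have "(\<integral>\<^sup>+ y. indicator {y. \<rho> \<le> dist x y} y * ennreal ((\<rho> / dist x y) powr \<tau> / lam x (dist x y)) \<partial>\<nu>)
     \<le> (\<integral>\<^sup>+ y. (\<Sum>i. ?g i y) \<partial>\<nu>)" by (intro nn_integral_mono pw)
  also have "\<dots> = (\<Sum>i. ennreal (q ^ i / lam x (2 ^ i * \<rho>)) * emeasure \<nu> (ball x (2 ^ Suc i * \<rho>)))"
    by (subst nn_integral_suminf) (auto simp: \<nu> nn_integral_cmult_indicator intro!: borel_measurable_times_ennreal borel_measurable_indicator)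
  also have "\<dots> \<le> (\<Sum>i. ennreal (m * q ^ i))"
  proof (intro suminf_le)
    fix i
    have pos: "0 < lam x (2 ^ i * \<rho>)" using \<rho> by (intro lam_pos) simp
    have "\<rho> \<le> 2 ^ i * \<rho>" using \<rho> by simp
    from le[OF this] have "emeasure \<nu> (ball x (2 ^ Suc i * \<rho>)) \<le> ennreal (m * lam x (2 ^ i * \<rho>))"
      by (simp add: mult.assoc)
    then have "ennreal (q ^ i / lam x (2 ^ i * \<rho>)) * emeasure \<nu> (ball x (2 ^ Suc i * \<rho>))
       \<le> ennreal (q ^ i / lam x (2 ^ i * \<rho>)) * ennreal (m * lam x (2 ^ i * \<rho>))"
      by (intro mult_left_mono) auto
    also have "\<dots> = ennreal (m * q ^ i)"
      using pos q m by (subst ennreal_mult[symmetric]) (auto simp: mult.commute)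
    finally show "ennreal (q ^ i / lam x (2 ^ i * \<rho>)) * emeasure \<nu> (ball x (2 ^ Suc i * \<rho>)) \<le> ennreal (m * q ^ i)" .
  qed auto
  also have "\<dots> = ennreal (m / (1 - q))"
  proof -
    have "(\<lambda>i. m * q ^ i) sums (m * (1 / (1 - q)))"
      using q by (intro sums_mult geometric_sums) auto
    then show ?thesis using m q by (intro suminf_ennreal_eq) auto
  qed
  finally show ?thesis unfolding q_def .
qed

end

section \<open>The kernel and its truncations: measurability, change of radius, change of
  centre\<close>

locale cz_kernel = upper_doubling_space \<mu> lam Cl Ct A
  for \<mu> :: "'a::{metric_space, second_countable_topology} measure"
    and lam :: "'a \<Rightarrow> real \<Rightarrow> real" and Cl Ct A :: real +
  fixes K :: "'a \<Rightarrow> 'a \<Rightarrow> complex" and \<tau> CK :: real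
  assumes tau_pos: "0 < \<tau>" and CK_pos: "0 < CK"
    and K_size: "x \<noteq> y \<Longrightarrow> norm (K x y) \<le> CK / lam x (dist x y)"
    and K_reg1: "x \<noteq> y \<Longrightarrow> 2 * dist x x' \<le> dist x y \<Longrightarrow>
       norm (K x y - K x' y) \<le> CK * (dist x x' powr \<tau> / (dist x y powr \<tau> * lam x (dist x y)))"
    and K_reg2: "x \<noteq> y \<Longrightarrow> 2 * dist x x' \<le> dist x y \<Longrightarrow>
       norm (K y x - K y x') \<le> CK * (dist x x' powr \<tau> / (dist x y powr \<tau> * lam x (dist x y)))"
begin

lemma K_size_le:
  assumes "0 < r" "r \<le> dist x y"
  shows "norm (K x y) \<le> CK / lam x r"
proof -
  have "norm (K x y) \<le> CK / lam x (dist x y)" using assms by (intro K_size) auto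
  also have "\<dots> \<le> CK / lam x r"
    using assms lam_pos[of r x] lam_mono[of r "dist x y" x] CK_pos by (intro divide_left_mono mult_pos_pos) auto
  finally show ?thesis .
qed

text \<open>Both regularity bounds are used at the fixed points \<open>x0\<close> and
  \<open>y0\<close>, so only \<open>lam x0\<close> and \<open>lam y0\<close> at radii bounded below
  enter, and the bound tends to 0 with the distances. Joint measurability off the diagonal rests on
  this.\<close>

lemma K_isCont:
  assumes ne: "x0 \<noteq> y0"
  shows "isCont (\<lambda>p. K (fst p) (snd p)) (x0, y0)"
proof -
  define d where "d = dist x0 y0"
  have d: "0 < d" using ne by (simp add: d_def)
  define c1 where "c1 = CK / ((d/2) powr \<tau> * lam x0 (d/2))"
  define c2 where "c2 = CK / (d powr \<tau> * lam y0 d)"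
  have l1: "0 < lam x0 (d/2)" using d by (intro lam_pos) simp
  have est: "norm (K x y - K x0 y0) \<le> c1 * dist x0 x powr \<tau> + c2 * dist y0 y powr \<tau>"
    if near: "dist x0 x < d/4" "dist y0 y < d/4" for x y
  proof -
    have dy: "d / 2 \<le> dist x0 y"
    proof -
      have "d \<le> dist x0 y + dist y0 y" using dist_triangle[of x0 y0 y] by (simp add: dist_commute d_def)
      then show ?thesis using near d by linarith
    qed
    have "norm (K x0 y - K x y) \<le> CK * (dist x0 x powr \<tau> / (dist x0 y powr \<tau> * lam x0 (dist x0 y)))"
      using dy near d by (intro K_reg1) auto
    also have "\<dots> \<le> CK * (dist x0 x powr \<tau> / ((d/2) powr \<tau> * lam x0 (d/2)))"
      using dy d l1 CK_pos tau_pos lam_mono[of "d/2" "dist x0 y" x0]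
      by (intro mult_left_mono divide_left_mono mult_mono powr_mono2 mult_pos_pos) (auto intro!: lam_pos)
    finally have 1: "norm (K x0 y - K x y) \<le> c1 * dist x0 x powr \<tau>" by (simp add: c1_def)
    have "norm (K x0 y0 - K x0 y) \<le> CK * (dist y0 y powr \<tau> / (dist y0 x0 powr \<tau> * lam y0 (dist y0 x0)))"
      using near(2) ne d zero_le_dist[of y0 y] dist_commute[of y0 x0] unfolding d_def
      by (intro K_reg2) (blast, linarith)
    then have 2: "norm (K x0 y0 - K x0 y) \<le> c2 * dist y0 y powr \<tau>"
      by (simp add: c2_def d_def dist_commute)
    have "K x y - K x0 y0 = - (K x0 y - K x y) - (K x0 y0 - K x0 y)" by simp
    then have "norm (K x y - K x0 y0) \<le> norm (K x0 y - K x y) + norm (K x0 y0 - K x0 y)"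
      by (metis norm_minus_cancel norm_triangle_ineq4)
    then show ?thesis using 1 2 by linarith
  qed
  have f: "(fst \<longlongrightarrow> x0) (at (x0, y0))" and s: "(snd \<longlongrightarrow> y0) (at (x0, y0))"
    using tendsto_fst[OF tendsto_ident_at, of "(x0,y0)" UNIV] tendsto_snd[OF tendsto_ident_at, of "(x0,y0)" UNIV]
    by simp_all
  have ev: "\<forall>\<^sub>F p in at (x0, y0). norm (K (fst p) (snd p) - K x0 y0)
       \<le> c1 * dist x0 (fst p) powr \<tau> + c2 * dist y0 (snd p) powr \<tau>"
  proof -
    have "\<forall>\<^sub>F p in at (x0, y0). dist (fst p) x0 < d / 4" "\<forall>\<^sub>F p in at (x0, y0). dist (snd p) y0 < d / 4"
      using tendstoD[OF f, of "d/4"] tendstoD[OF s, of "d/4"] d by auto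
    then show ?thesis
      by eventually_elim (intro est; simp add: dist_commute)
  qed
  have "((\<lambda>p. c1 * dist x0 (fst p) powr \<tau> + c2 * dist y0 (snd p) powr \<tau>) \<longlongrightarrow>
          c1 * dist x0 x0 powr \<tau> + c2 * dist y0 y0 powr \<tau>) (at (x0, y0))"
    using tau_pos by (intro tendsto_intros f s tendsto_powr') auto
  then have "((\<lambda>p. K (fst p) (snd p) - K x0 y0) \<longlongrightarrow> 0) (at (x0, y0))"
    using ev tau_pos by (intro Lim_null_comparison[OF ev]) simp
  then show ?thesis unfolding isCont_def by (simp add: LIM_zero_cancel)
qed

text \<open>The values of \<open>K\<close> on the diagonal are arbitrary and may spoil measurability.\<close>

definition K0 :: "'a \<Rightarrow> 'a \<Rightarrow> complex" where
  "K0 x y = (if x = y then 0 else K x y)"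

lemma K0_measurable_pair: "(\<lambda>p. K0 (fst p) (snd p)) \<in> borel_measurable (borel \<Otimes>\<^sub>M borel)"
proof -
  have op: "open {p :: 'a \<times> 'a. fst p \<noteq> snd p}"
    by (intro open_Collect_neq continuous_intros)
  have "(\<lambda>p. indicator {p. fst p \<noteq> snd p} p *\<^sub>R K (fst p) (snd p)) \<in> borel_measurable borel"
    using op K_isCont
    by (intro borel_measurable_continuous_on_indicator) (auto simp: continuous_on_eq_continuous_at)
  also have "(\<lambda>p. indicator {p. fst p \<noteq> snd p} p *\<^sub>R K (fst p) (snd p)) = (\<lambda>p. K0 (fst p) (snd p))"
    by (auto simp: K0_def)
  finally show ?thesis by (simp add: borel_prod)
qed

lemma K0_measurable [measurable (raw)]:
  assumes [measurable]: "f \<in> borel_measurable M" "g \<in> borel_measurable M"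
  shows "(\<lambda>z. K0 (f z) (g z)) \<in> borel_measurable M"
proof -
  have "(\<lambda>z. (f z, g z)) \<in> M \<rightarrow>\<^sub>M borel \<Otimes>\<^sub>M borel" by measurable
  from measurable_compose[OF this K0_measurable_pair] show ?thesis by simp
qed

abbreviation kern :: "real \<Rightarrow> 'a \<Rightarrow> 'a \<Rightarrow> complex" where
  "kern r x y \<equiv> indicator {y. r < dist x y} y * K x y"

lemma trunc_integrand_eq: "0 < r \<Longrightarrow> kern r x y = indicator {y. r < dist x y} y * K0 x y"
  by (auto simp: K0_def indicator_def)

lemma trunc_integrand_measurable:
  assumes "0 < r" and [measurable_cong]: "sets \<nu> = sets borel"
  shows "(\<lambda>y. kern r x y) \<in> borel_measurable \<nu>"
proof -
  have "(\<lambda>y. indicator {y. r < dist x y} y * K0 x y) \<in> borel_measurable \<nu>"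
    by measurable
  then show ?thesis by (simp add: trunc_integrand_eq[OF assms(1)])
qed

lemma trunc_integrand_bound:
  assumes "0 < r"
  shows "norm (kern r x y) \<le> CK / lam x r"
  using K_size_le[OF assms, of x y] CK_pos lam_pos[OF assms, of x] by (auto simp: indicator_def)

lemma trunc_integrable:
  assumes "0 < r" "finite_measure \<nu>" "sets \<nu> = sets borel"
  shows "integrable \<nu> (\<lambda>y. kern r x y)"
  using trunc_integrand_bound[OF assms(1)] trunc_integrand_measurable[OF assms(1,3)] assms(2)
  by (intro finite_measure.integrable_const_bound[where B = "CK / lam x r"]) auto

definition trunc :: "'a measure \<Rightarrow> real \<Rightarrow> 'a \<Rightarrow> complex" where
  "trunc \<nu> r x = (\<integral>y. kern r x y \<partial>\<nu>)"

definition tsharp :: "'a measure \<Rightarrow> 'a \<Rightarrow> ennreal" where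
  "tsharp \<nu> x = (SUP r\<in>{0<..}. ennreal (norm (trunc \<nu> r x)))"

lemma trunc_le_tsharp: "0 < r \<Longrightarrow> ennreal (norm (trunc \<nu> r x)) \<le> tsharp \<nu> x"
  unfolding tsharp_def by (intro SUP_upper) auto

lemma trunc_measurable:
  assumes r: "0 < r" and \<nu>: "finite_measure \<nu>" "sets \<nu> = sets borel"
  shows "trunc \<nu> r \<in> borel_measurable borel"
proof -
  interpret finite_measure \<nu> by fact
  note [measurable_cong] = \<nu>(2)
  have "(\<lambda>x. \<integral>y. indicator {y. r < dist x y} y * K0 x y \<partial>\<nu>) \<in> borel_measurable borel"
  proof -
    have "(\<lambda>x. \<integral>y. indicator {r<..} (dist x y) * K0 x y \<partial>\<nu>) \<in> borel_measurable borel"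
      by measurable
    then show ?thesis by (simp add: indicator_def)
  qed
  then show ?thesis unfolding trunc_def[abs_def] by (simp add: trunc_integrand_eq[OF r])
qed

text \<open>The truncation removes a closed ball, so as the radii decrease to \<open>r\<close> the
  domains increase to that of \<open>r\<close>. This reduces the supremum over all radii to a
  countable one.\<close>

lemma trunc_tendsto_right:
  assumes r: "0 < r" and \<nu>: "finite_measure \<nu>" "sets \<nu> = sets borel"
    and X: "X \<longlonglongrightarrow> r" "\<And>n. r \<le> X n"
  shows "(\<lambda>n. trunc \<nu> (X n) x) \<longlonglongrightarrow> trunc \<nu> r x"
proof -
  interpret finite_measure \<nu> by fact
  have Xpos: "0 < X n" for n using r X(2)[of n] by linarith
  show ?thesis unfolding trunc_def
  proof (rule integral_dominated_convergence[where w = "\<lambda>_. CK / lam x r"])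
    fix n
    show "AE y in \<nu>. norm (kern (X n) x y) \<le> CK / lam x r"
    proof (rule AE_I2)
      fix y
      have "norm (kern (X n) x y) \<le> norm (kern r x y)"
        using X(2)[of n] by (auto simp: indicator_def)
      then show "norm (kern (X n) x y) \<le> CK / lam x r"
        using trunc_integrand_bound[OF r, of x y] by linarith
    qed
  next
    show "AE y in \<nu>. (\<lambda>n. kern (X n) x y) \<longlonglongrightarrow> kern r x y"
    proof (rule AE_I2)
      fix y
      show "(\<lambda>n. kern (X n) x y) \<longlonglongrightarrow> kern r x y"
      proof (cases "r < dist x y")
        case True
        have "\<forall>\<^sub>F n in sequentially. X n < dist x y" using order_tendstoD(2)[OF X(1) True] .
        then have "\<forall>\<^sub>F n in sequentially. kern (X n) x y = kern r x y"
          by eventually_elim (use True in auto)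
        then show ?thesis by (rule tendsto_eventually)
      next
        case False
        then have "\<not> X n < dist x y" for n using X(2)[of n] by linarith
        then show ?thesis using False by simp
      qed
    qed
  qed (auto intro!: trunc_integrand_measurable r \<nu>(2) Xpos)
qed

lemma tsharp_Rats:
  assumes \<nu>: "finite_measure \<nu>" "sets \<nu> = sets borel"
  shows "tsharp \<nu> x = (SUP r\<in>{0<..} \<inter> \<rat>. ennreal (norm (trunc \<nu> r x)))"
proof (rule antisym)
  show "tsharp \<nu> x \<le> (SUP r\<in>{0<..} \<inter> \<rat>. ennreal (norm (trunc \<nu> r x)))"
    unfolding tsharp_def
  proof (rule SUP_least)
    fix r :: real assume "r \<in> {0<..}"
    then have r: "0 < r" by simp
    have "\<exists>q\<in>\<rat>. r < q \<and> q < r + 1 / Suc n" for n using Rats_dense_in_real[of r "r + 1 / Suc n"] by auto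
    then obtain X where X: "\<And>n. X n \<in> \<rat>" "\<And>n. r < X n" "\<And>n. X n < r + 1 / Suc n" by metis
    have "(\<lambda>n. r + 1 / Suc n) \<longlonglongrightarrow> r + 0"
      by (intro tendsto_add tendsto_const LIMSEQ_Suc[OF lim_1_over_n])
    then have lim: "X \<longlonglongrightarrow> r"
      using X by (intro tendsto_sandwich[OF _ _ tendsto_const, of r X sequentially "\<lambda>n. r + 1 / Suc n"]) (auto intro!: always_eventually less_imp_le)
    have conv: "(\<lambda>n. ennreal (norm (trunc \<nu> (X n) x))) \<longlonglongrightarrow> ennreal (norm (trunc \<nu> r x))"
      by (intro tendsto_ennrealI tendsto_norm trunc_tendsto_right r \<nu> lim less_imp_le[OF X(2)])
    have "ennreal (norm (trunc \<nu> (X n) x)) \<le> (SUP r\<in>{0<..} \<inter> \<rat>. ennreal (norm (trunc \<nu> r x)))" for n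
      using X(1,2)[of n] r by (intro SUP_upper) auto
    then show "ennreal (norm (trunc \<nu> r x)) \<le> (SUP r\<in>{0<..} \<inter> \<rat>. ennreal (norm (trunc \<nu> r x)))"
      by (intro LIMSEQ_le_const2[OF conv]) auto
  qed
qed (auto simp: tsharp_def intro!: SUP_subset_mono)

lemma tsharp_measurable [measurable]:
  assumes \<nu>: "finite_measure \<nu>" "sets \<nu> = sets borel"
  shows "tsharp \<nu> \<in> borel_measurable borel"
proof -
  have "countable ({0<..} \<inter> \<rat> :: real set)" using countable_rat by (rule countable_subset[rotated]) auto
  then have "(\<lambda>x. SUP r\<in>{0<..} \<inter> \<rat>. ennreal (norm (trunc \<nu> r x))) \<in> borel_measurable borel"
    using trunc_measurable[OF _ \<nu>] by (intro borel_measurable_SUP) (auto intro!: measurable_compose[OF _ measurable_ennreal] borel_measurable_norm)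
  then show ?thesis using tsharp_Rats[OF \<nu>] by (simp add: fun_eq_iff[symmetric] cong: measurable_cong)
qed

text \<open>Only the annulus between the radii survives in the difference, and there the size bound
  of the kernel is \<open>CK\<close> times the integrand of \<open>shell\<close>.\<close>

lemma trunc_diff_le:
  assumes r: "0 < r" "r \<le> r'" "r' < b" and \<nu>: "finite_measure \<nu>" "sets \<nu> = sets borel"
    and c: "shell \<nu> x r b \<le> ennreal c" "0 \<le> c"
  shows "norm (trunc \<nu> r x - trunc \<nu> r' x) \<le> CK * c"
proof -
  have "trunc \<nu> r x - trunc \<nu> r' x = (\<integral>y. kern r x y - kern (r') x y \<partial>\<nu>)"
    unfolding trunc_def using r by (intro Bochner_Integration.integral_diff[symmetric] trunc_integrable \<nu>) auto
  moreover have "norm \<dots> \<le> CK * c"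
  proof (rule norm_integral_le_of_nn_integral)
    have "(\<integral>\<^sup>+ y. ennreal (norm (kern r x y - kern (r') x y)) \<partial>\<nu>)
      \<le> (\<integral>\<^sup>+ y. ennreal CK * (indicator {y. r \<le> dist x y \<and> dist x y < b} y * ennreal (1 / lam x (dist x y))) \<partial>\<nu>)"
    proof (intro nn_integral_mono)
      fix y
      show "ennreal (norm (kern r x y - kern (r') x y))
        \<le> ennreal CK * (indicator {y. r \<le> dist x y \<and> dist x y < b} y * ennreal (1 / lam x (dist x y)))"
      proof (cases "r < dist x y \<and> dist x y \<le> r'")
        case True
        then have "0 < dist x y" using r by linarith
        then have "norm (K x y) \<le> CK * (1 / lam x (dist x y))" "0 < lam x (dist x y)"
          using K_size[of x y] by (auto intro: lam_pos)
        then show ?thesis using True r CK_pos by (auto simp: indicator_def ennreal_mult[symmetric] intro!: ennreal_leI)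
      next
        case False
        then show ?thesis using r by (auto simp: indicator_def)
      qed
    qed
    also have "\<dots> = ennreal CK * shell \<nu> x r b"
      unfolding shell_def by (intro nn_integral_cmult shell_integrand_measurable r \<nu>)
    also have "\<dots> \<le> ennreal CK * ennreal c" by (intro mult_left_mono c) auto
    also have "\<dots> = ennreal (CK * c)" using c CK_pos by (simp add: ennreal_mult)
    finally show "(\<integral>\<^sup>+ y. ennreal (norm (kern r x y - kern (r') x y)) \<partial>\<nu>) \<le> ennreal (CK * c)" .
  qed (use CK_pos c in auto)
  ultimately show ?thesis by simp
qed

lemma maximal_le_emeasure_ball:
  assumes "maximal_le \<mu> \<nu> m x" "finite_measure \<nu>" "0 < s"
  shows "emeasure \<nu> (ball x s) \<le> ennreal (m * vol x (3 * s))"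
  using maximal_leD[OF assms(1), of x s] assms(2,3)
  by (simp add: finite_measure.emeasure_eq_measure ennreal_leI)

lemma maximal_le_emeasure_ball_lam:
  assumes "maximal_le \<mu> \<nu> m x" "finite_measure \<nu>" "0 < s" "0 \<le> m"
  shows "emeasure \<nu> (ball x (2 * s)) \<le> ennreal (m * Cl ^ 3 * lam x s)"
proof -
  have "emeasure \<nu> (ball x (2 * s)) \<le> ennreal (m * vol x (3 * (2 * s)))"
    using assms by (intro maximal_le_emeasure_ball) auto
  also have "\<dots> \<le> ennreal (m * (Cl ^ 3 * lam x s))"
    using assms measure_ball_le[of "3 * (2 * s)" x] lam_le[of s "3 * (2 * s)" 3 x]
    by (intro ennreal_leI mult_left_mono) auto
  finally show ?thesis by (simp add: mult.assoc)
qed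

text \<open>The first summand is the regularity tail, the second comes from points near the
  truncation sphere that only one of two centres sees. Both carry Cl^3, since 3 * (2 s) \<le> 2^3
  s.\<close>

definition Cc :: real where
  "Cc = CK * (Cl ^ 3 / (1 - (1/2) powr \<tau>) + Ct * Cl ^ 3)"

lemma half_powr_lt_1: "(1/2) powr \<tau> < (1::real)"
  using powr_less_mono2[of \<tau> "1/2" 1] tau_pos by simp

lemma Cc_nonneg: "0 \<le> Cc"
  unfolding Cc_def using CK_pos Cl_ge_1 Ct_ge_1 half_powr_lt_1
  by (intro mult_nonneg_nonneg add_nonneg_nonneg divide_nonneg_nonneg) auto

text \<open>Where both centres see \<open>y\<close>, regularity applies, as dist x z \<le> r/2. A
  point seen from one centre only lies within 2 r of \<open>x\<close>; there the size bound
  suffices, with \<open>lam_shift\<close> turning \<open>lam z\<close> into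
  \<open>lam x\<close>.\<close>

lemma trunc_diff_center_le:
  assumes r: "0 < r" and z: "dist x z \<le> r / 2" and \<nu>: "finite_measure \<nu>" "sets \<nu> = sets borel"
    and M: "maximal_le \<mu> \<nu> m x" and m: "0 \<le> m"
  shows "norm (trunc \<nu> r x - trunc \<nu> r z) \<le> Cc * m"
proof -
  let ?h = "\<lambda>y. kern r x y - kern r z y"
  let ?T = "\<lambda>y. indicator {y. r \<le> dist x y} y * ennreal ((r / dist x y) powr \<tau> / lam x (dist x y))"
  let ?B = "\<lambda>y. ennreal (Ct / lam x r) * indicator (ball x (2 * r)) y"
  have lx: "0 < lam x r" by (rule lam_pos[OF r])
  have pw: "ennreal (norm (?h y)) \<le> ennreal CK * (?T y + ?B y)" for y
  proof -
    consider "r < dist x y" "r < dist z y" | "r < dist x y" "\<not> r < dist z y"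
      | "\<not> r < dist x y" "r < dist z y" | "\<not> r < dist x y" "\<not> r < dist z y" by blast
    then show ?thesis
    proof cases
      case 1
      have l: "0 < lam x (dist x y)" using 1 r by (intro lam_pos) linarith
      have "norm (K x y - K z y) \<le> CK * (dist x z powr \<tau> / (dist x y powr \<tau> * lam x (dist x y)))"
        using 1 z r by (intro K_reg1) auto
      also have "\<dots> \<le> CK * (r powr \<tau> / (dist x y powr \<tau> * lam x (dist x y)))"
        using z r CK_pos tau_pos l 1 by (intro mult_left_mono divide_right_mono powr_mono2) auto
      also have "\<dots> = CK * ((r / dist x y) powr \<tau> / lam x (dist x y))"
        using r by (simp add: powr_divide)
      finally have "ennreal (norm (?h y)) \<le> ennreal CK * ?T y"
        using 1 CK_pos l by (auto simp: ennreal_mult[symmetric] intro!: ennreal_leI)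
      also have "\<dots> \<le> ennreal CK * (?T y + ?B y)" by (intro mult_left_mono) auto
      finally show ?thesis .
    next
      case 2
      have "dist x y < 2 * r" using 2 z dist_triangle[of x y z] r by linarith
      moreover have "norm (K x y) \<le> CK / lam x r" using 2 r by (intro K_size_le) auto
      moreover have "CK / lam x r \<le> CK * (Ct / lam x r)"
        using CK_pos Ct_ge_1 lx by (simp add: field_simps)
      ultimately have "ennreal (norm (?h y)) \<le> ennreal CK * ?B y"
        using 2 CK_pos Ct_ge_1 lx by (auto simp: ennreal_mult[symmetric] intro!: ennreal_leI)
      also have "\<dots> \<le> ennreal CK * (?T y + ?B y)" by (intro mult_left_mono) auto
      finally show ?thesis .
    next
      case 3
      have lz: "0 < lam z r" by (rule lam_pos[OF r])
      have "norm (K z y) \<le> CK / lam z r" using 3 r by (intro K_size_le) auto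
      also have "\<dots> \<le> CK * (Ct / lam x r)"
      proof -
        have "lam x r \<le> Ct * lam z r" using r z by (intro lam_shift) auto
        then show ?thesis using lx lz CK_pos by (simp add: field_simps)
      qed
      finally have "ennreal (norm (?h y)) \<le> ennreal CK * ?B y"
        using 3 CK_pos Ct_ge_1 lx r by (auto simp: ennreal_mult[symmetric] intro!: ennreal_leI)
      also have "\<dots> \<le> ennreal CK * (?T y + ?B y)" by (intro mult_left_mono) auto
      finally show ?thesis .
    next
      case 4
      then show ?thesis by simp
    qed
  qed
  have Tm: "?T \<in> borel_measurable \<nu>" by (rule tail_integrand_measurable[OF r \<nu>(2)])
  have Bm: "?B \<in> borel_measurable \<nu>"
    by (intro borel_measurable_times_ennreal borel_measurable_const borel_measurable_indicator) (simp add: \<nu>)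
  have "trunc \<nu> r x - trunc \<nu> r z = (\<integral>y. ?h y \<partial>\<nu>)"
    unfolding trunc_def by (intro Bochner_Integration.integral_diff[symmetric] trunc_integrable r \<nu>)
  moreover have "norm \<dots> \<le> CK * (m * Cl ^ 3 / (1 - (1/2) powr \<tau>) + m * Ct * Cl ^ 3)"
  proof (rule norm_integral_le_of_nn_integral)
    have "(\<integral>\<^sup>+ y. ennreal (norm (?h y)) \<partial>\<nu>) \<le> (\<integral>\<^sup>+ y. ennreal CK * (?T y + ?B y) \<partial>\<nu>)"
      by (intro nn_integral_mono pw)
    also have "\<dots> = ennreal CK * ((\<integral>\<^sup>+ y. ?T y \<partial>\<nu>) + (\<integral>\<^sup>+ y. ?B y \<partial>\<nu>))"
      using Tm Bm by (simp add: nn_integral_cmult nn_integral_add)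
    also have "(\<integral>\<^sup>+ y. ?B y \<partial>\<nu>) = ennreal (Ct / lam x r) * emeasure \<nu> (ball x (2 * r))"
      by (intro nn_integral_cmult_indicator) (simp add: \<nu>)
    also have "ennreal CK * ((\<integral>\<^sup>+ y. ?T y \<partial>\<nu>) + ennreal (Ct / lam x r) * emeasure \<nu> (ball x (2 * r)))
      \<le> ennreal CK * (ennreal (m * Cl ^ 3 / (1 - (1/2) powr \<tau>)) + ennreal (Ct / lam x r) * ennreal (m * Cl ^ 3 * lam x r))"
      using m Cl_ge_1 r
      by (intro mult_left_mono add_mono nn_integral_tail_le maximal_le_emeasure_ball_lam M \<nu> tau_pos r) auto
    also have "\<dots> = ennreal (CK * (m * Cl ^ 3 / (1 - (1/2) powr \<tau>) + m * Ct * Cl ^ 3))"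
      using lx m Cl_ge_1 Ct_ge_1 CK_pos half_powr_lt_1
      by (simp add: ennreal_mult[symmetric] ennreal_plus[symmetric] mult_ac del: ennreal_plus)
    finally show "(\<integral>\<^sup>+ y. ennreal (norm (?h y)) \<partial>\<nu>) \<le> ennreal (CK * (m * Cl ^ 3 / (1 - (1/2) powr \<tau>) + m * Ct * Cl ^ 3))" .
  qed (use CK_pos m Cl_ge_1 Ct_ge_1 half_powr_lt_1 in \<open>auto intro!: mult_nonneg_nonneg add_nonneg_nonneg divide_nonneg_nonneg\<close>)
  moreover have "CK * (m * Cl ^ 3 / (1 - (1/2) powr \<tau>) + m * Ct * Cl ^ 3) = Cc * m"
    by (simp add: Cc_def field_simps)
  ultimately show ?thesis by metis
qed

end

subsection \<open>Cotlar's argument and weak type (2,2)\<close>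

text \<open>Cauchy-Schwarz on \<open>B\<close> without square roots: integrate g \<le> g^2 / (2 s) +
  s / 2.\<close>

lemma nn_integral_am_gm:
  fixes g :: "'a \<Rightarrow> real"
  assumes [measurable]: "g \<in> borel_measurable M" "B \<in> sets M" and s: "0 < s" and a: "0 \<le> a"
    and sq: "(\<integral>\<^sup>+ y. ennreal ((g y)\<^sup>2) * indicator B y \<partial>M) \<le> ennreal (s\<^sup>2 * a)" and B: "emeasure M B \<le> ennreal a"
  shows "(\<integral>\<^sup>+ y. ennreal (g y) * indicator B y \<partial>M) \<le> ennreal (s * a)"
proof -
  have pw: "g y \<le> 1 / (2 * s) * (g y)\<^sup>2 + s / 2" for y
  proof -
    have "0 \<le> (g y - s)\<^sup>2 / (2 * s)" using s by simp
    also have "\<dots> = 1 / (2 * s) * (g y)\<^sup>2 + s / 2 - g y"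
      using s by (simp add: field_simps power2_eq_square)
    finally show ?thesis by simp
  qed
  have "(\<integral>\<^sup>+ y. ennreal (g y) * indicator B y \<partial>M)
     \<le> (\<integral>\<^sup>+ y. ennreal (1 / (2 * s)) * (ennreal ((g y)\<^sup>2) * indicator B y) + ennreal (s / 2) * indicator B y \<partial>M)"
    using s pw by (intro nn_integral_mono)
      (auto simp: indicator_def ennreal_mult[symmetric] ennreal_plus[symmetric] simp del: ennreal_plus intro!: ennreal_leI)
  also have "\<dots> = ennreal (1 / (2 * s)) * (\<integral>\<^sup>+ y. ennreal ((g y)\<^sup>2) * indicator B y \<partial>M) + ennreal (s / 2) * emeasure M B"
    by (simp add: nn_integral_add nn_integral_cmult nn_integral_cmult_indicator)
  also have "\<dots> \<le> ennreal (1 / (2 * s)) * ennreal (s\<^sup>2 * a) + ennreal (s / 2) * ennreal a"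
    by (intro add_mono mult_left_mono sq B) auto
  also have "\<dots> = ennreal (1 / (2 * s) * (s\<^sup>2 * a) + s / 2 * a)"
    using s a by (simp add: ennreal_mult[symmetric] ennreal_plus[symmetric] del: ennreal_plus)
  also have "1 / (2 * s) * (s\<^sup>2 * a) + s / 2 * a = s * a"
    using s by (simp add: field_simps power2_eq_square)
  finally show ?thesis .
qed

text \<open>Nonnegativity makes the density a positive measure, to which the truncations of measures
  apply; boundedness and bounded support put the function into the domain of
  \<open>T\<close>.\<close>

definition bdd_supp_fun :: "('a::metric_space \<Rightarrow> real) \<Rightarrow> bool" where
  "bdd_supp_fun f \<longleftrightarrow> f \<in> borel_measurable borel \<and> (\<forall>x. 0 \<le> f x) \<and> (\<exists>b. \<forall>x. f x \<le> b) \<and>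
     (\<exists>x r. \<forall>y. f y \<noteq> 0 \<longrightarrow> y \<in> ball x r)"

lemma bdd_supp_fun_measurable: "bdd_supp_fun f \<Longrightarrow> f \<in> borel_measurable borel"
  and bdd_supp_fun_nonneg: "bdd_supp_fun f \<Longrightarrow> 0 \<le> f x"
  by (auto simp: bdd_supp_fun_def)

lemma bdd_supp_funI:
  assumes "f \<in> borel_measurable borel" "\<And>y. 0 \<le> f y" "\<And>y. f y \<le> b" "\<And>y. f y \<noteq> 0 \<Longrightarrow> y \<in> ball x r"
  shows "bdd_supp_fun f"
  unfolding bdd_supp_fun_def using assms by blast

lemma bdd_supp_fun_mult_indicator:
  assumes "bdd_supp_fun f" "B \<in> sets borel"
  shows "bdd_supp_fun (\<lambda>y. f y * indicator B y)"
proof -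
  obtain b x r where f: "f \<in> borel_measurable borel" "\<And>x. 0 \<le> f x" "\<And>x. f x \<le> b" "\<And>y. f y \<noteq> 0 \<Longrightarrow> y \<in> ball x r"
    using assms(1) unfolding bdd_supp_fun_def by blast
  have "f y * indicator B y \<le> b" for y
    using f(2,3)[of y] by (auto simp: indicator_def)
  then show ?thesis
    using f(1,2,4) assms(2) by (intro bdd_supp_funI[of _ b x r]) (auto simp del: mem_ball)
qed

lemma bdd_supp_fun_power2:
  assumes "bdd_supp_fun f"
  shows "bdd_supp_fun (\<lambda>y. (f y)\<^sup>2)"
proof -
  obtain b x r where f: "f \<in> borel_measurable borel" "\<And>x. 0 \<le> f x" "\<And>x. f x \<le> b" "\<And>y. f y \<noteq> 0 \<Longrightarrow> y \<in> ball x r"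
    using assms(1) unfolding bdd_supp_fun_def by blast
  have "(f y)\<^sup>2 \<le> b\<^sup>2" for y
    using f(2,3)[of y] by (intro power_mono)
  then show ?thesis
    using f(1,2,4) by (intro bdd_supp_funI[of _ "b\<^sup>2" x r]) (auto simp del: mem_ball)
qed

lemma bdd_supp_fun_zero: "bdd_supp_fun (\<lambda>_. 0)"
  unfolding bdd_supp_fun_def by (auto intro!: exI[of _ 0])

lemma bdd_supp_fun_add:
  assumes "bdd_supp_fun f" "bdd_supp_fun g"
  shows "bdd_supp_fun (\<lambda>y. f y + g y)"
proof -
  obtain b x r where f: "f \<in> borel_measurable borel" "\<And>x. 0 \<le> f x" "\<And>x. f x \<le> b" "\<And>y. f y \<noteq> 0 \<Longrightarrow> y \<in> ball x r"
    using assms(1) unfolding bdd_supp_fun_def by blast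
  obtain b' x' r' where g: "g \<in> borel_measurable borel" "\<And>x. 0 \<le> g x" "\<And>x. g x \<le> b'" "\<And>y. g y \<noteq> 0 \<Longrightarrow> y \<in> ball x' r'"
    using assms(2) unfolding bdd_supp_fun_def by blast
  have "bounded (ball x r \<union> ball x' r')" by simp
  then obtain e where e: "0 < e" "ball x r \<union> ball x' r' \<subseteq> ball x e"
    using bounded_subset_ballD by blast
  have "f y + g y \<noteq> 0 \<Longrightarrow> y \<in> ball x e" for y
    using f(4)[of y] g(4)[of y] e(2) by (cases "f y = 0") (auto simp del: mem_ball)
  moreover have "f y + g y \<le> b + b'" for y using f(3)[of y] g(3)[of y] by linarith
  ultimately show ?thesis
    using f(1,2) g(1,2) by (intro bdd_supp_funI[of _ "b + b'" x e]) (auto simp del: mem_ball)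
qed

lemma bdd_supp_fun_sum:
  "finite S \<Longrightarrow> (\<And>k. k \<in> S \<Longrightarrow> bdd_supp_fun (f k)) \<Longrightarrow> bdd_supp_fun (\<lambda>y. \<Sum>k\<in>S. f k y)"
  by (induction S rule: finite_induct) (auto intro: bdd_supp_fun_zero bdd_supp_fun_add)

context upper_doubling_space
begin

abbreviation dens :: "('a \<Rightarrow> real) \<Rightarrow> 'a measure" where
  "dens f \<equiv> density \<mu> (\<lambda>x. ennreal (f x))"

lemma sets_dens: "sets (dens f) = sets borel" by simp

lemma bdd_supp_fun_integral_finite:
  assumes "bdd_supp_fun f"
  shows "(\<integral>\<^sup>+ y. ennreal (f y) \<partial>\<mu>) < \<infinity>"
proof -
  obtain b x r where f: "f \<in> borel_measurable borel" "\<And>x. 0 \<le> f x" "\<And>x. f x \<le> b" "\<And>y. f y \<noteq> 0 \<Longrightarrow> y \<in> ball x r"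
    using assms(1) unfolding bdd_supp_fun_def by blast
  have "(\<integral>\<^sup>+ y. ennreal (f y) \<partial>\<mu>) \<le> (\<integral>\<^sup>+ y. ennreal b * indicator (ball x r) y \<partial>\<mu>)"
  proof (intro nn_integral_mono)
    fix y show "ennreal (f y) \<le> ennreal b * indicator (ball x r) y"
      using f(3)[of y] f(4)[of y] by (cases "f y = 0") (auto intro!: ennreal_leI)
  qed
  also have "\<dots> = ennreal b * emeasure \<mu> (ball x r)"
    by (intro nn_integral_cmult_indicator) simp
  also have "\<dots> < \<infinity>" using emeasure_ball_finite by (simp add: ennreal_mult_less_top)
  finally show ?thesis .
qed

lemma emeasure_dens:
  assumes "f \<in> borel_measurable borel" "B \<in> sets borel"
  shows "emeasure (dens f) B = (\<integral>\<^sup>+ y. ennreal (f y) * indicator B y \<partial>\<mu>)"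
  using assms by (intro emeasure_density) auto

lemma finite_measure_dens:
  assumes "f \<in> borel_measurable borel" "(\<integral>\<^sup>+ y. ennreal (f y) \<partial>\<mu>) < \<infinity>"
  shows "finite_measure (dens f)"
  using assms by (intro finite_measureI) (auto simp: emeasure_dens)

lemma measure_dens_UNIV:
  assumes "f \<in> borel_measurable borel"
  shows "measure (dens f) UNIV = enn2real (\<integral>\<^sup>+ y. ennreal (f y) \<partial>\<mu>)"
  unfolding measure_def using emeasure_dens[OF assms, of UNIV] by simp

lemma bdd_supp_fun_finite_measure: "bdd_supp_fun f \<Longrightarrow> finite_measure (dens f)"
  by (intro finite_measure_dens bdd_supp_fun_measurable bdd_supp_fun_integral_finite)

lemma maximal_le_mono_dens:
  assumes "f \<in> borel_measurable borel" "g \<in> borel_measurable borel" "\<And>y. f y \<le> g y"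
    "finite_measure (dens g)" "maximal_le \<mu> (dens g) m x"
  shows "maximal_le \<mu> (dens f) m x"
  unfolding maximal_le_def
proof (intro allI impI)
  fix y r assume *: "x \<in> ball y r"
  have "emeasure (dens f) (ball y r) \<le> emeasure (dens g) (ball y r)"
    using assms by (auto simp: emeasure_dens intro!: nn_integral_mono mult_right_mono ennreal_leI)
  then have "measure (dens f) (ball y r) \<le> measure (dens g) (ball y r)"
    unfolding measure_def using finite_measure.emeasure_finite[OF assms(4)] by (intro enn2real_mono) (auto simp: less_top)
  also have "\<dots> \<le> m * vol y (3 * r)" using assms(5) * by (auto simp: maximal_le_def)
  finally show "measure (dens f) (ball y r) \<le> m * vol y (3 * r)" .
qed

text \<open>Cauchy-Schwarz on each ball, with \<mu> of the ball enlarged to \<mu> of its triple so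
  that both factors carry the same volume.\<close>

lemma maximal_le_of_power2:
  assumes f: "bdd_supp_fun f" and s: "0 < s" and M: "maximal_le \<mu> (dens (\<lambda>y. (f y)\<^sup>2)) (s\<^sup>2) x"
  shows "maximal_le \<mu> (dens f) s x"
  unfolding maximal_le_def
proof (intro allI impI)
  fix y r assume *: "x \<in> ball y r"
  then have r: "0 < r" using zero_le_dist[of y x] by (simp del: zero_le_dist)
  note f2 = bdd_supp_fun_power2[OF f]
  have "(\<integral>\<^sup>+ z. ennreal (f z) * indicator (ball y r) z \<partial>\<mu>) \<le> ennreal (s * vol y (3 * r))"
  proof (rule nn_integral_am_gm[OF _ _ s])
    have "(\<integral>\<^sup>+ z. ennreal ((f z)\<^sup>2) * indicator (ball y r) z \<partial>\<mu>) = emeasure (dens (\<lambda>y. (f y)\<^sup>2)) (ball y r)"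
      using bdd_supp_fun_measurable[OF f2] by (simp add: emeasure_dens)
    also have "\<dots> = ennreal (measure (dens (\<lambda>y. (f y)\<^sup>2)) (ball y r))"
      by (intro finite_measure.emeasure_eq_measure bdd_supp_fun_finite_measure f2)
    also have "\<dots> \<le> ennreal (s\<^sup>2 * vol y (3 * r))"
      using M * by (intro ennreal_leI) (auto simp: maximal_le_def)
    finally show "(\<integral>\<^sup>+ z. ennreal ((f z)\<^sup>2) * indicator (ball y r) z \<partial>\<mu>) \<le> ennreal (s\<^sup>2 * vol y (3 * r))" .
    show "emeasure \<mu> (ball y r) \<le> ennreal (vol y (3 * r))"
      using r by (auto simp: emeasure_ball intro!: ennreal_leI measure_ball_mono')
  qed (use bdd_supp_fun_measurable[OF f] in auto)
  then have "emeasure (dens f) (ball y r) \<le> ennreal (s * vol y (3 * r))"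
    using bdd_supp_fun_measurable[OF f] by (simp add: emeasure_dens)
  then show "measure (dens f) (ball y r) \<le> s * vol y (3 * r)"
    unfolding measure_def[of "dens f"] using s by (intro enn2real_leI) auto
qed

lemma bdd_supp_fun_Linf_b:
  assumes "bdd_supp_fun f"
  shows "(\<lambda>y. complex_of_real (f y)) \<in> Linf_b \<mu>"
proof -
  obtain b x r where f: "f \<in> borel_measurable borel" "\<And>x. 0 \<le> f x" "\<And>x. f x \<le> b" "\<And>y. f y \<noteq> 0 \<Longrightarrow> y \<in> ball x r"
    using assms(1) unfolding bdd_supp_fun_def by blast
  have "ess_supp \<mu> (\<lambda>y. complex_of_real (f y)) \<subseteq> cball x r"
    unfolding ess_supp_def using f(4) by (intro Inter_lower) fastforce
  then have "bounded (ess_supp \<mu> (\<lambda>y. complex_of_real (f y)))"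
    using bounded_cball bounded_subset by blast
  moreover have "(\<lambda>y. complex_of_real (f y)) \<in> borel_measurable \<mu>" using f(1) by measurable
  moreover have "AE x in \<mu>. norm (complex_of_real (f x)) \<le> b" using f(2,3) by auto
  ultimately show ?thesis unfolding Linf_b_def by blast
qed

end

context cz_kernel
begin

lemma trunc_dens:
  assumes "0 < r" "f \<in> borel_measurable borel" "\<And>y. 0 \<le> f y"
  shows "trunc (dens f) r x = (\<integral>y. kern r x y * complex_of_real (f y) \<partial>\<mu>)"
  unfolding trunc_def using trunc_integrand_measurable[OF assms(1) sets_mu, of x] assms
  by (subst integral_density) (auto simp: scaleR_conv_of_real mult_ac)

end

text \<open>\<open>N_A\<close> is the counterpart of \<open>A_ge\<close> for small scales: passing
  from one scale to the next smaller multiplies the number of covering balls by at most N^4 \<le>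
  A/2, while a non-doubling step divides the volume by at least \<open>A\<close>.\<close>

locale cz_operator = cz_kernel \<mu> lam Cl Ct A K \<tau> CK
  for \<mu> :: "'a::{metric_space, second_countable_topology} measure"
    and lam :: "'a \<Rightarrow> real \<Rightarrow> real" and Cl Ct A :: real and K \<tau> CK +
  fixes T :: "('a \<Rightarrow> complex) \<Rightarrow> 'a \<Rightarrow> complex" and CT :: real and N :: nat
  assumes nonatomic: "emeasure \<mu> {x} = 0"
    and geometric: "0 < r \<Longrightarrow> \<exists>S. finite S \<and> card S \<le> N \<and> ball (x :: 'a) r \<subseteq> (\<Union>y\<in>S. ball y (r / 2))"
    and N_A: "2 * real N ^ 4 \<le> A"
    and CZ: "CZ_operator \<mu> K T" and CT_ge_1: "1 \<le> CT"
    and L2: "f \<in> Linf_b \<mu> \<Longrightarrow>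
       (\<integral>\<^sup>+ x. ennreal ((norm (T f x))\<^sup>2) \<partial>\<mu>) \<le> ennreal CT * (\<integral>\<^sup>+ x. ennreal ((norm (f x))\<^sup>2) \<partial>\<mu>)"
begin

abbreviation T' :: "('a \<Rightarrow> real) \<Rightarrow> 'a \<Rightarrow> complex" where
  "T' f \<equiv> T (\<lambda>y. complex_of_real (f y))"

lemma T_measurable: "bdd_supp_fun f \<Longrightarrow> T' f \<in> borel_measurable borel"
  using CZ bdd_supp_fun_Linf_b unfolding CZ_operator_def by fastforce

lemma T_L2: 
  assumes "bdd_supp_fun f"
  shows "(\<integral>\<^sup>+ x. ennreal ((norm (T' f x))\<^sup>2) \<partial>\<mu>) \<le> ennreal CT * (\<integral>\<^sup>+ x. ennreal ((f x)\<^sup>2) \<partial>\<mu>)"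
  using L2[OF bdd_supp_fun_Linf_b[OF assms]] by simp

lemma T_L2_finite:
  assumes "bdd_supp_fun f"
  shows "(\<integral>\<^sup>+ x. ennreal ((norm (T' f x))\<^sup>2) \<partial>\<mu>) < \<infinity>"
  using bdd_supp_fun_integral_finite[OF bdd_supp_fun_power2[OF assms]]
  by (intro le_less_trans[OF T_L2[OF assms]]) (simp add: ennreal_mult_less_top)

text \<open>In order: the passage from radius \<open>r\<close> to three times the doubling radius,
  the change of centre, the mean of \<open>T f\<close>, and the mean of \<open>T\<close> applied to
  the near part of \<open>f\<close>.\<close>

definition Ck :: real where
  "Ck = CK * (4 * Cl ^ 8 + Cl ^ 6) + Cc + A + CT * A"

lemma Ck_pos: "0 < Ck"
  unfolding Ck_def using CK_pos Cl_ge_1 Cc_nonneg A_pos CT_ge_1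
  by (intro add_nonneg_pos add_nonneg_nonneg mult_nonneg_nonneg mult_pos_pos) auto

text \<open>The point of Cotlar's argument: at the first doubling scale above \<open>r\<close> the truncation is compared
  with the mean of \<open>T f\<close> over the doubling ball.\<close>

lemma Cotlar_pointwise:
  assumes f: "bdd_supp_fun f" and s: "0 < s" and supp: "\<And>r. 0 < r \<Longrightarrow> 0 < vol x r"
    and MT: "maximal_le \<mu> (dens (\<lambda>y. (norm (T' f y))\<^sup>2)) (s\<^sup>2) x"
    and Mf: "maximal_le \<mu> (dens (\<lambda>y. (f y)\<^sup>2)) (s\<^sup>2) x"
    and r: "0 < r"
  shows "norm (trunc (dens f) r x) \<le> Ck * s"
proof -
  note fm = bdd_supp_fun_measurable[OF f] and f0 = bdd_supp_fun_nonneg[OF f]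
  note fin = bdd_supp_fun_finite_measure[OF f]
  have M: "maximal_le \<mu> (dens f) s x" by (rule maximal_le_of_power2[OF f s Mf])
  obtain n where n: "dbl x (16 ^ n * r)" "\<And>i. i < n \<Longrightarrow> \<not> dbl x (16 ^ i * r)"
    using ex_dbl[OF r supp[OF r]] by blast
  define R where "R = 16 ^ n * r"
  have R: "0 < R" "r \<le> R" using r by (auto simp: R_def)
  have m: "emeasure (dens f) (ball x t) \<le> ennreal (s * vol x (3 * t))" if "0 < t" for t
    by (rule maximal_le_emeasure_ball[OF M fin that])
  \<comment> \<open>The chain of non-doubling scales ends at \<open>R\<close>; one further annulus
    makes room for the radius 3 R.\<close>
  have "shell (dens f) x r (16 * R) \<le> shell (dens f) x r R + shell (dens f) x R (16 * R)"
    by (intro shell_split r R sets_dens)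
  also have "\<dots> \<le> ennreal (s * (4 * Cl ^ 8)) + ennreal (s * Cl ^ 6)"
    unfolding R_def using r s n(2) m by (intro add_mono shell_chain shell_16 sets_dens) auto
  also have "\<dots> = ennreal (s * (4 * Cl ^ 8 + Cl ^ 6))"
    using s Cl_ge_1 by (simp add: distrib_left ennreal_plus[symmetric] del: ennreal_plus)
  finally have d1: "norm (trunc (dens f) r x - trunc (dens f) (3 * R) x) \<le> CK * (s * (4 * Cl ^ 8 + Cl ^ 6))"
    using R r s Cl_ge_1 by (intro trunc_diff_le[OF r, where b = "16 * R"] fin sets_dens) auto
  define f1 where "f1 = (\<lambda>y. f y * indicator (cball x (3 * R)) y)"
  define f2 where "f2 = (\<lambda>y. f y * indicator (- cball x (3 * R)) y)"
  have n1: "bdd_supp_fun f1" and n2: "bdd_supp_fun f2"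
    unfolding f1_def f2_def by (intro bdd_supp_fun_mult_indicator f; simp)+
  note f2m = bdd_supp_fun_measurable[OF n2] and f20 = bdd_supp_fun_nonneg[OF n2]
  have M2: "maximal_le \<mu> (dens f2) s x"
    by (rule maximal_le_mono_dens[OF f2m fm _ fin M]) (auto simp: f2_def indicator_def f0)
  \<comment> \<open>\<open>f2\<close> vanishes within 3 R of \<open>x\<close>, so the radius may be
    lowered to 2 R. From a point of \<open>ball x R\<close> this radius still exposes all of
    \<open>f2\<close>, and the displacement is at most half of it, as the change of centre
    demands.\<close>
  have eqx: "trunc (dens f2) (2 * R) x = trunc (dens f) (3 * R) x"
  proof -
    have "trunc (dens f2) (2 * R) x = (\<integral>y. kern (2 * R) x y * complex_of_real (f2 y) \<partial>\<mu>)"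
      using R by (intro trunc_dens f2m f20) auto
    also have "\<dots> = (\<integral>y. kern (3 * R) x y * complex_of_real (f y) \<partial>\<mu>)"
      using R by (intro Bochner_Integration.integral_cong) (auto simp: f2_def indicator_def)
    also have "\<dots> = trunc (dens f) (3 * R) x"
      using R by (intro trunc_dens[symmetric] fm f0) auto
    finally show ?thesis .
  qed
  have AE2: "AE y in \<mu>. y \<in> ball x R \<longrightarrow> T' f2 y = trunc (dens f2) (2 * R) y"
  proof -
    have "ess_supp \<mu> (\<lambda>y. complex_of_real (f2 y)) \<subseteq> {z. 3 * R \<le> dist x z}"
      unfolding ess_supp_def
      by (intro Inter_lower) (auto simp: f2_def indicator_def intro!: closed_Collect_le continuous_intros)
    then have notin: "y \<notin> ess_supp \<mu> (\<lambda>y. complex_of_real (f2 y))" if "y \<in> ball x R" for y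
      using that R by force
    have eq: "(\<integral>z. K y z * complex_of_real (f2 z) \<partial>\<mu>) = trunc (dens f2) (2 * R) y" if y: "y \<in> ball x R" for y
    proof -
      have "2 * R < dist y z" if "f2 z \<noteq> 0" for z
      proof -
        have "3 * R < dist x z" using that by (auto simp: f2_def indicator_def split: if_splits)
        then show ?thesis using y dist_triangle[of x z y] by simp
      qed
      then show ?thesis
        using R by (subst trunc_dens) (auto intro!: Bochner_Integration.integral_cong simp: f2m f20 indicator_def)
    qed
    have "AE y in \<mu>. y \<notin> ess_supp \<mu> (\<lambda>y. complex_of_real (f2 y)) \<longrightarrow> T' f2 y = (\<integral>z. K y z * complex_of_real (f2 z) \<partial>\<mu>)"
      using CZ bdd_supp_fun_Linf_b[OF n2] unfolding CZ_operator_def by blast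
    then show ?thesis by eventually_elim (use notin eq in auto)
  qed
  have AE1: "AE y in \<mu>. T' f y = T' f1 y + T' f2 y"
  proof -
    have "(\<lambda>y. complex_of_real (f y)) = (\<lambda>y. complex_of_real (f1 y) + complex_of_real (f2 y))"
      by (auto simp: f1_def f2_def indicator_def)
    then show ?thesis
      using CZ bdd_supp_fun_Linf_b[OF n1] bdd_supp_fun_Linf_b[OF n2] unfolding CZ_operator_def by metis
  qed
  define a where "a = norm (trunc (dens f) (3 * R) x)"
  define V where "V = vol x R"
  have V: "0 < V" unfolding V_def by (rule supp[OF R(1)])
  have V16: "vol x (16 * R) \<le> A * V" using n(1) by (simp add: dbl_def R_def V_def)
  have VA: "emeasure \<mu> (ball x R) \<le> ennreal (A * V)"
    using A_ge_2 V by (auto simp: emeasure_ball V_def intro!: ennreal_leI)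
  have I1: "(\<integral>\<^sup>+ y. ennreal (norm (T' f y)) * indicator (ball x R) y \<partial>\<mu>) \<le> ennreal (s * (A * V))"
  proof (rule nn_integral_am_gm[OF _ _ s _ _ VA])
    have fT: "finite_measure (dens (\<lambda>y. (norm (T' f y))\<^sup>2))"
      using T_measurable[OF f] by (intro finite_measure_dens T_L2_finite f) measurable
    have "(\<integral>\<^sup>+ y. ennreal ((norm (T' f y))\<^sup>2) * indicator (ball x R) y \<partial>\<mu>) = emeasure (dens (\<lambda>y. (norm (T' f y))\<^sup>2)) (ball x R)"
      using T_measurable[OF f] by (simp add: emeasure_dens)
    also have "\<dots> \<le> ennreal (s\<^sup>2 * vol x (3 * R))"
      by (rule maximal_le_emeasure_ball[OF MT fT R(1)])
    also have "\<dots> \<le> ennreal (s\<^sup>2 * (A * V))"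
      using V16 measure_ball_mono'[of "3 * R" "16 * R" x] R by (intro ennreal_leI mult_left_mono) auto
    finally show "(\<integral>\<^sup>+ y. ennreal ((norm (T' f y))\<^sup>2) * indicator (ball x R) y \<partial>\<mu>) \<le> ennreal (s\<^sup>2 * (A * V))" .
  qed (use T_measurable[OF f] A_pos V in auto)
  have I2: "(\<integral>\<^sup>+ y. ennreal (norm (T' f1 y)) * indicator (ball x R) y \<partial>\<mu>) \<le> ennreal (s * CT * (A * V))"
  proof (rule nn_integral_am_gm[OF _ _ _ _ _ VA])
    have "(\<integral>\<^sup>+ y. ennreal ((norm (T' f1 y))\<^sup>2) * indicator (ball x R) y \<partial>\<mu>) \<le> (\<integral>\<^sup>+ y. ennreal ((norm (T' f1 y))\<^sup>2) \<partial>\<mu>)"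
      by (intro nn_integral_mono) (auto simp: indicator_def)
    also have "\<dots> \<le> ennreal CT * (\<integral>\<^sup>+ y. ennreal ((f1 y)\<^sup>2) \<partial>\<mu>)" by (rule T_L2[OF n1])
    also have "(\<integral>\<^sup>+ y. ennreal ((f1 y)\<^sup>2) \<partial>\<mu>) \<le> (\<integral>\<^sup>+ y. ennreal ((f y)\<^sup>2) * indicator (ball x (4 * R)) y \<partial>\<mu>)"
      using R by (intro nn_integral_mono) (auto simp: f1_def indicator_def)
    also have "\<dots> = emeasure (dens (\<lambda>y. (f y)\<^sup>2)) (ball x (4 * R))"
      using fm by (simp add: emeasure_dens)
    also have "\<dots> \<le> ennreal (s\<^sup>2 * vol x (3 * (4 * R)))"
      using R by (intro maximal_le_emeasure_ball[OF Mf] bdd_supp_fun_finite_measure bdd_supp_fun_power2 f) auto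
    also have "\<dots> \<le> ennreal (s\<^sup>2 * (A * V))"
      using V16 measure_ball_mono'[of "3 * (4 * R)" "16 * R" x] R by (intro ennreal_leI mult_left_mono) auto
    also have "ennreal CT * ennreal (s\<^sup>2 * (A * V)) = ennreal (CT * (s\<^sup>2 * (A * V)))"
      using CT_ge_1 A_pos V by (subst ennreal_mult) auto
    \<comment> \<open>CT \<le> CT^2, so that \<open>s * CT\<close> can serve as the parameter of
      \<open>nn_integral_am_gm\<close>.\<close>
    also have "\<dots> \<le> ennreal ((s * CT)\<^sup>2 * (A * V))"
    proof (intro ennreal_leI)
      have "CT * (s\<^sup>2 * (A * V)) \<le> CT\<^sup>2 * (s\<^sup>2 * (A * V))"
        using CT_ge_1 A_pos V by (intro mult_right_mono) (auto simp: power2_eq_square)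
      then show "CT * (s\<^sup>2 * (A * V)) \<le> (s * CT)\<^sup>2 * (A * V)" by (simp add: power_mult_distrib mult_ac)
    qed
    finally show "(\<integral>\<^sup>+ y. ennreal ((norm (T' f1 y))\<^sup>2) * indicator (ball x R) y \<partial>\<mu>) \<le> ennreal ((s * CT)\<^sup>2 * (A * V))"
      by (simp add: mult_left_mono)
  qed (use T_measurable[OF n1] A_pos V s CT_ge_1 in auto)
  have le: "AE y in \<mu>. y \<in> ball x R \<longrightarrow> a - Cc * s \<le> norm (T' f y) + norm (T' f1 y)"
    using AE1 AE2
  proof eventually_elim
    case (elim y)
    show ?case
    proof
      assume y: "y \<in> ball x R"
      have "norm (trunc (dens f2) (2 * R) x - trunc (dens f2) (2 * R) y) \<le> Cc * s"
        using R y s by (intro trunc_diff_center_le M2 bdd_supp_fun_finite_measure n2 sets_dens) auto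
      moreover have "norm (trunc (dens f2) (2 * R) x) \<le> norm (trunc (dens f2) (2 * R) x - trunc (dens f2) (2 * R) y) + norm (trunc (dens f2) (2 * R) y)"
        by (metis diff_add_cancel norm_triangle_ineq)
      moreover have "trunc (dens f2) (2 * R) y = T' f y - T' f1 y" using elim y by simp
      moreover have "norm (T' f y - T' f1 y) \<le> norm (T' f y) + norm (T' f1 y)" by (rule norm_triangle_ineq4)
      ultimately show "a - Cc * s \<le> norm (T' f y) + norm (T' f1 y)" unfolding a_def eqx[symmetric] by simp
    qed
  qed
  \<comment> \<open>The pointwise inequality is integrated over the doubling ball and divided by its
    volume. Should \<open>a - Cc * s\<close> be negative, \<open>ennreal\<close> sends it to 0 and
    the chain holds trivially.\<close>
  have "ennreal ((a - Cc * s) * V) \<le> ennreal (a - Cc * s) * emeasure \<mu> (ball x R)"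
    using V by (simp add: emeasure_ball V_def[symmetric] ennreal_mult'')
  also have "\<dots> = (\<integral>\<^sup>+ y. ennreal (a - Cc * s) * indicator (ball x R) y \<partial>\<mu>)"
    by (intro nn_integral_cmult_indicator[symmetric]) simp
  also have "\<dots> \<le> (\<integral>\<^sup>+ y. ennreal (norm (T' f y)) * indicator (ball x R) y + ennreal (norm (T' f1 y)) * indicator (ball x R) y \<partial>\<mu>)"
    using le by (intro nn_integral_mono_AE) (auto elim!: eventually_mono simp: indicator_def ennreal_plus[symmetric] simp del: ennreal_plus intro!: ennreal_leI)
  also have "\<dots> = (\<integral>\<^sup>+ y. ennreal (norm (T' f y)) * indicator (ball x R) y \<partial>\<mu>) + (\<integral>\<^sup>+ y. ennreal (norm (T' f1 y)) * indicator (ball x R) y \<partial>\<mu>)"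
    using T_measurable[OF f] T_measurable[OF n1]
    by (intro nn_integral_add borel_measurable_times_ennreal borel_measurable_indicator) auto
  also have "\<dots> \<le> ennreal (s * (A * V)) + ennreal (s * CT * (A * V))" by (intro add_mono I1 I2)
  also have "\<dots> = ennreal ((s * A + s * CT * A) * V)"
    using s A_pos V CT_ge_1 by (subst ennreal_plus[symmetric]) (auto simp: algebra_simps)
  finally have "(a - Cc * s) * V \<le> (s * A + s * CT * A) * V"
    using s A_pos V CT_ge_1 by (subst (asm) ennreal_le_iff) (auto intro!: add_nonneg_nonneg mult_nonneg_nonneg)
  then have "a - Cc * s \<le> s * A + s * CT * A" using V by (rule mult_right_le_imp_le)
  then have "a \<le> (Cc + A + CT * A) * s" by (simp add: algebra_simps)
  moreover have "norm (trunc (dens f) r x) \<le> norm (trunc (dens f) r x - trunc (dens f) (3 * R) x) + a"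
    unfolding a_def by (metis diff_add_cancel norm_triangle_ineq)
  ultimately have "norm (trunc (dens f) r x) \<le> CK * (s * (4 * Cl ^ 8 + Cl ^ 6)) + (Cc + A + CT * A) * s"
    using d1 by linarith
  then show ?thesis by (simp add: Ck_def algebra_simps)
qed

definition C22 :: real where "C22 = (CT + 1) * Ck\<^sup>2"

lemma C22_nonneg: "0 \<le> C22" unfolding C22_def using CT_ge_1 by simp

text \<open>With s = u / Ck almost every point above level \<open>u\<close> violates one of the two
  maximal bounds of Cotlar's argument. The maximal theorem is applied to the densities |T f|^2 and
  f^2, whose masses the L^2 bound controls.\<close>

lemma tsharp_weak_22:
  assumes f: "bdd_supp_fun f" and a: "(\<integral>\<^sup>+ x. ennreal ((f x)\<^sup>2) \<partial>\<mu>) \<le> ennreal a" "0 \<le> a" and u: "0 < u"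
  shows "emeasure \<mu> {x. ennreal u < tsharp (dens f) x} \<le> ennreal (C22 * a / u\<^sup>2)"
proof -
  define s where "s = u / Ck"
  have s: "0 < s" using u Ck_pos by (simp add: s_def)
  let ?G = "dens (\<lambda>y. (norm (T' f y))\<^sup>2)" and ?F = "dens (\<lambda>y. (f y)\<^sup>2)"
  have Tm: "(\<lambda>y. (norm (T' f y))\<^sup>2) \<in> borel_measurable borel"
    using T_measurable[OF f] by measurable
  have fm: "(\<lambda>y. (f y)\<^sup>2) \<in> borel_measurable borel"
    by (intro bdd_supp_fun_measurable bdd_supp_fun_power2 f)
  have fG: "finite_measure ?G" by (intro finite_measure_dens T_L2_finite f Tm)
  have fF: "finite_measure ?F" by (intro bdd_supp_fun_finite_measure bdd_supp_fun_power2 f)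
  let ?U = "{x. \<not> maximal_le \<mu> ?G (s\<^sup>2) x}" and ?W = "{x. \<not> maximal_le \<mu> ?F (s\<^sup>2) x}"
  have "emeasure \<mu> {x. ennreal u < tsharp (dens f) x} \<le> emeasure \<mu> (?U \<union> ?W)"
  proof (rule emeasure_mono_AE)
    show "AE x in \<mu>. x \<in> {x. ennreal u < tsharp (dens f) x} \<longrightarrow> x \<in> ?U \<union> ?W"
      using AE_ball_pos
    proof eventually_elim
      case (elim x)
      have "tsharp (dens f) x \<le> ennreal u" if "maximal_le \<mu> ?G (s\<^sup>2) x" "maximal_le \<mu> ?F (s\<^sup>2) x"
        unfolding tsharp_def
      proof (rule SUP_least)
        fix r :: real assume "r \<in> {0<..}"
        then have "norm (trunc (dens f) r x) \<le> Ck * s"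
          using elim that by (intro Cotlar_pointwise f s) auto
        then show "ennreal (norm (trunc (dens f) r x)) \<le> ennreal u"
          using Ck_pos by (intro ennreal_leI) (simp add: s_def)
      qed
      then show ?case by (auto simp: not_less[symmetric])
    qed
  qed (use not_maximal_le_sets in auto)
  also have "\<dots> \<le> emeasure \<mu> ?U + emeasure \<mu> ?W"
    using not_maximal_le_sets by (intro emeasure_subadditive) auto
  also have "\<dots> \<le> ennreal (measure ?G UNIV / s\<^sup>2) + ennreal (measure ?F UNIV / s\<^sup>2)"
    using s by (intro add_mono maximal_weak_type fG fF sets_dens) auto
  also have "\<dots> \<le> ennreal (CT * a / s\<^sup>2) + ennreal (a / s\<^sup>2)"
  proof (intro add_mono ennreal_leI divide_right_mono)
    have "(\<integral>\<^sup>+ x. ennreal ((norm (T' f x))\<^sup>2) \<partial>\<mu>) \<le> ennreal CT * ennreal a"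
      by (rule order_trans[OF T_L2[OF f] mult_left_mono[OF a(1)]]) simp
    also have "\<dots> = ennreal (CT * a)" using CT_ge_1 a(2) by (simp add: ennreal_mult)
    finally show "measure ?G UNIV \<le> CT * a"
      unfolding measure_dens_UNIV[OF Tm] using CT_ge_1 a(2) by (intro enn2real_leI) auto
    show "measure ?F UNIV \<le> a"
      unfolding measure_dens_UNIV[OF fm] using a by (intro enn2real_leI) auto
  qed auto
  also have "\<dots> = ennreal (C22 * a / u\<^sup>2)"
    using CT_ge_1 a(2) Ck_pos u
    by (subst ennreal_plus[symmetric]) (auto simp: C22_def s_def field_simps)
  finally show ?thesis .
qed

end

subsection \<open>Spreading atoms over doubling balls\<close>

text \<open>Dyadic layers: \<open>F\<close> is at most \<open>w\<close> plus the sum of 2^(j+1) w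
  over all \<open>j\<close> with F > 2^j w. By the weak bound the j-th layer contributes 2^(j+1) w c
  / (2^j w)^2, and these sum to 4 c / w.\<close>

lemma Kolmogorov_weak_22:
  fixes F :: "'a \<Rightarrow> ennreal"
  assumes [measurable]: "F \<in> borel_measurable M" "B \<in> sets M"
    and weak: "\<And>u. 0 < u \<Longrightarrow> emeasure M {y \<in> space M. ennreal u < F y} \<le> ennreal (c / u\<^sup>2)"
    and c: "0 \<le> c" and w: "0 < w"
  shows "(\<integral>\<^sup>+ y. indicator B y * F y \<partial>M) \<le> ennreal w * emeasure M B + ennreal (4 * c / w)"
proof -
  let ?U = "\<lambda>j. {y \<in> space M. ennreal (2 ^ j * w) < F y}"
  have pw: "F y \<le> ennreal w + (\<Sum>j. ennreal (2 ^ Suc j * w) * indicator (?U j) y)" if y: "y \<in> space M" for y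
  proof -
    have le: "ennreal (2 ^ Suc j * w) \<le> (\<Sum>j. ennreal (2 ^ Suc j * w) * indicator (?U j) y)" if "ennreal (2 ^ j * w) < F y" for j
    proof -
      have "(\<Sum>i\<in>{j}. ennreal (2 ^ Suc i * w) * indicator (?U i) y) \<le> (\<Sum>j. ennreal (2 ^ Suc j * w) * indicator (?U j) y)"
        by (rule sum_le_suminf) auto
      moreover have "indicator (?U j) y = (1 :: ennreal)" using that y by (simp add: indicator_def)
      ultimately show ?thesis
        by (simp only: sum.insert finite.emptyI empty_iff not_False_eq_True sum.empty add_0_right mult_1_right)
    qed
    show ?thesis
    proof (cases "F y")
      case (real z)
      show ?thesis
      proof (cases "z \<le> w")
        case True
        then have "F y \<le> ennreal w" using real by (simp add: ennreal_leI)
        then show ?thesis by (rule order_trans) simp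
      next
        case False
        obtain n where "z / w < 2 ^ n" using real_arch_pow[of 2 "z / w"] by auto
        then have n: "z \<le> 2 ^ n * w" using w by (simp add: field_simps)
        define k where "k = (LEAST n. z \<le> 2 ^ n * w)"
        have k: "z \<le> 2 ^ k * w" unfolding k_def using n by (rule LeastI)
        have "k \<noteq> 0" using k False by (intro notI) simp
        then obtain j where j: "k = Suc j" using not0_implies_Suc by blast
        have "\<not> z \<le> 2 ^ j * w" using not_less_Least[of j "\<lambda>n. z \<le> 2 ^ n * w"] j k_def by simp
        then have "ennreal (2 ^ j * w) < F y" using real w by (simp add: ennreal_less_iff)
        from le[OF this] have "ennreal (2 ^ Suc j * w) \<le> (\<Sum>j. ennreal (2 ^ Suc j * w) * indicator (?U j) y)" .
        moreover have "F y \<le> ennreal (2 ^ Suc j * w)" unfolding real using k j by (intro ennreal_leI) simp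
        ultimately have "F y \<le> (\<Sum>j. ennreal (2 ^ Suc j * w) * indicator (?U j) y)" by (rule order_trans[rotated])
        then show ?thesis by (intro add_increasing) auto
      qed
    next
      case top
      have "(\<Sum>j. ennreal (2 ^ Suc j * w) * indicator (?U j) y) = top"
      proof (rule ccontr)
        assume "(\<Sum>j. ennreal (2 ^ Suc j * w) * indicator (?U j) y) \<noteq> top"
        then obtain z where z: "0 \<le> z" "(\<Sum>j. ennreal (2 ^ Suc j * w) * indicator (?U j) y) = ennreal z"
          using ennreal_cases by blast
        have "2 ^ Suc j * w \<le> z" for j
        proof -
          have "ennreal (2 ^ j * w) < F y" using top by simp
          from le[OF this] have "ennreal (2 ^ Suc j * w) \<le> ennreal z" unfolding z(2) .
          then show ?thesis using z(1) by (simp del: power_Suc)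
        qed
        moreover obtain n where "z / w < 2 ^ n" using real_arch_pow[of 2 "z / w"] by auto
        then have "z < 2 ^ n * w" using w by (simp add: field_simps)
        moreover have "2 ^ n * w \<le> 2 ^ Suc n * w" using w by simp
        ultimately show False by (meson not_less order_trans)
      qed
      then show ?thesis by simp
    qed
  qed
  have "(\<integral>\<^sup>+ y. indicator B y * F y \<partial>M)
     \<le> (\<integral>\<^sup>+ y. ennreal w * indicator B y + (\<Sum>j. ennreal (2 ^ Suc j * w) * indicator (?U j) y) \<partial>M)"
    using pw by (intro nn_integral_mono) (auto simp: indicator_def)
  also have "\<dots> = ennreal w * emeasure M B + (\<Sum>j. ennreal (2 ^ Suc j * w) * emeasure M (?U j))"
    by (subst nn_integral_add, measurable) (simp add: nn_integral_cmult_indicator nn_integral_suminf)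
  also have "\<dots> \<le> ennreal w * emeasure M B + (\<Sum>j. ennreal (2 * c / w * (1/2) ^ j))"
  proof (intro add_left_mono suminf_le)
    fix j
    have "ennreal (2 ^ Suc j * w) * emeasure M (?U j) \<le> ennreal (2 ^ Suc j * w) * ennreal (c / (2 ^ j * w)\<^sup>2)"
      using w by (intro mult_left_mono weak) auto
    also have "\<dots> = ennreal (2 ^ Suc j * w * (c / (2 ^ j * w)\<^sup>2))"
      using w c by (intro ennreal_mult[symmetric]) auto
    also have "2 ^ Suc j * w * (c / (2 ^ j * w)\<^sup>2) = 2 * c / w * (1/2) ^ j"
      using w by (simp add: field_simps power2_eq_square)
    finally show "ennreal (2 ^ Suc j * w) * emeasure M (?U j) \<le> ennreal (2 * c / w * (1/2) ^ j)" .
  qed auto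
  also have "(\<Sum>j. ennreal (2 * c / w * (1/2) ^ j)) = ennreal (4 * c / w)"
  proof -
    have "(\<lambda>i. 2 * c / w * (1/2) ^ i) sums (2 * c / w * (1 / (1 - 1/2)))"
      by (intro sums_mult geometric_sums) auto
    then show ?thesis using c w by (intro suminf_ennreal_eq) auto
  qed
  finally show ?thesis .
qed

lemma
  fixes M :: "'a::{metric_space, second_countable_topology} measure"
  assumes M: "finite_measure M" "sets M = sets borel" and S: "finite S" "AE y in M. y \<in> S"
  shows measure_finite_support: "B \<in> sets borel \<Longrightarrow> measure M B = (\<Sum>k\<in>S \<inter> B. measure M {k})"
    and integral_finite_support: "g \<in> borel_measurable borel \<Longrightarrow>
      (\<integral>y. g y \<partial>M) = (\<Sum>k\<in>S. measure M {k} *\<^sub>R (g k :: complex))"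
proof -
  interpret finite_measure M by fact
  have meas: "B \<in> sets M" if "B \<in> sets borel" for B using that M(2) by simp
  show "measure M B = (\<Sum>k\<in>S \<inter> B. measure M {k})" if B: "B \<in> sets borel"
  proof -
    have "measure M B = measure M (S \<inter> B)"
      using S B by (intro measure_eq_AE) (auto intro!: meas borel_closed finite_imp_closed)
    also have "S \<inter> B = (\<Union>k\<in>S \<inter> B. {k})" by auto
    also have "measure M \<dots> = (\<Sum>k\<in>S \<inter> B. measure M {k})"
      using S(1) by (intro finite_measure_finite_Union) (auto simp: disjoint_family_on_def intro!: meas)
    finally show ?thesis .
  qed
  show "(\<integral>y. g y \<partial>M) = (\<Sum>k\<in>S. measure M {k} *\<^sub>R g k)" if g: "g \<in> borel_measurable borel"
  proof -
    have gM: "g \<in> borel_measurable M" using g M(2) by (simp cong: measurable_cong_sets)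
    have "(\<integral>y. g y \<partial>M) = (\<integral>y. (\<Sum>k\<in>S. indicator {k} y *\<^sub>R g k) \<partial>M)"
    proof (rule integral_cong_AE)
      show "AE y in M. g y = (\<Sum>k\<in>S. indicator {k} y *\<^sub>R g k)"
        using S(2)
      proof eventually_elim
        case (elim y)
        have "(\<Sum>k\<in>S. indicator {k} y *\<^sub>R g k) = (\<Sum>k\<in>S. if k = y then g k else 0)"
          by (intro sum.cong) (auto simp: indicator_def)
        then show ?case using elim S(1) by simp
      qed
    qed (auto intro!: gM borel_measurable_sum borel_measurable_scaleR borel_measurable_indicator meas)
    also have "\<dots> = (\<Sum>k\<in>S. (\<integral>y. indicator {k} y *\<^sub>R g k \<partial>M))"
      by (intro Bochner_Integration.integral_sum) (auto intro!: meas simp: emeasure_eq_measure)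
    also have "\<dots> = (\<Sum>k\<in>S. measure M {k} *\<^sub>R g k)"
    proof (intro sum.cong refl)
      fix k
      have "integrable M (indicator {k} :: 'a \<Rightarrow> real)"
        by (intro integrable_real_indicator) (auto intro!: meas simp: emeasure_eq_measure)
      then show "(\<integral>y. indicator {k} y *\<^sub>R g k \<partial>M) = measure M {k} *\<^sub>R g k"
        using meas[of "{k}"] by (subst integral_scaleR_left) auto
    qed
    finally show ?thesis .
  qed
qed

context upper_doubling_space
begin

text \<open>The sets are chosen in the order of increasing radii: where the functions already chosen exceed
  \<open>2 A t\<close>, the new one is put to zero, and this costs at most half of the ball.\<close>

lemma greedy_almost_disjoint:
  assumes S: "finite S" and t: "0 < t"
    and r: "\<And>k. k \<in> S \<Longrightarrow> 0 < r k" and \<alpha>: "\<And>k. k \<in> S \<Longrightarrow> 0 \<le> \<alpha> k"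
    and pos: "\<And>k. k \<in> S \<Longrightarrow> 0 < vol k (r k)"
    and le: "\<And>k. k \<in> S \<Longrightarrow> (\<Sum>j\<in>S \<inter> ball k (4 * r k). \<alpha> j) \<le> t * A * vol k (r k)"
  shows "\<exists>E. (\<forall>k\<in>S. E k \<in> sets borel \<and> E k \<subseteq> ball k (r k) \<and> vol k (r k) \<le> 2 * measure \<mu> (E k)) \<and>
           (\<forall>y. (\<Sum>k\<in>S. \<alpha> k / measure \<mu> (E k) * indicator (E k) y) \<le> 4 * A * t)"
proof -
  define P where "P S' E \<longleftrightarrow> (\<forall>k\<in>S'. E k \<in> sets borel \<and> E k \<subseteq> ball k (r k) \<and> vol k (r k) \<le> 2 * measure \<mu> (E k)) \<and>
           (\<forall>y. (\<Sum>k\<in>S'. \<alpha> k / measure \<mu> (E k) * indicator (E k) y) \<le> 4 * A * t)" for S' and E :: "'a \<Rightarrow> 'a set"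
  have "\<exists>E. P S' E" if "S' \<subseteq> S" for S'
    using finite_subset[OF that S] that
  proof (induction S' rule: finite_ranking_induct[where f = r])
    case empty
    then show ?case using A_pos t by (auto simp: P_def)
  next
    case (insert x S')
    then obtain E where E: "P S' E" by auto
    show ?case
    proof (cases "x \<in> S'")
      case True
      then show ?thesis using E by (auto simp: insert_absorb)
    next
      case x: False
      have xS: "x \<in> S" and S'S: "S' \<subseteq> S" using insert.prems by auto
      have fS': "finite S'" using insert.hyps by simp
      have Em: "E k \<in> sets borel" "E k \<subseteq> ball k (r k)" "vol k (r k) \<le> 2 * measure \<mu> (E k)" "0 < measure \<mu> (E k)"
        if "k \<in> S'" for k using E that pos[of k] S'S by (force simp: P_def)+
      let ?V = "vol x (r x)"
      define h where "h = (\<lambda>y. \<Sum>k\<in>S'. \<alpha> k / measure \<mu> (E k) * indicator (E k) y :: real)"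
      have hm: "h \<in> borel_measurable borel" unfolding h_def
        by (intro borel_measurable_sum borel_measurable_times borel_measurable_const borel_measurable_indicator Em)
      have h0: "0 \<le> h y" for y unfolding h_def
        using \<alpha> S'S by (intro sum_nonneg mult_nonneg_nonneg divide_nonneg_nonneg) auto
      define D where "D = {y. h y \<le> 2 * A * t}"
      have D: "D \<in> sets borel" unfolding D_def using hm by measurable
      define H where "H = ball x (r x) \<inter> D"
      have Hm: "H \<in> sets borel" unfolding H_def using D by auto
      have finB: "emeasure \<mu> (ball x (r x)) < \<infinity>" by (rule emeasure_ball_finite)
      \<comment> \<open>Earlier radii are at most \<open>r x\<close>, so only sets with centre in
        \<open>ball x (4 * r x)\<close> meet the new ball, and each of their functions has integral
        at most \<alpha> k; hypothesis \<open>le\<close> bounds the sum.\<close>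
      have int: "(\<integral>\<^sup>+ y. ennreal (h y) * indicator (ball x (r x)) y \<partial>\<mu>) \<le> ennreal (t * A * ?V)"
      proof -
        have "(\<integral>\<^sup>+ y. ennreal (h y) * indicator (ball x (r x)) y \<partial>\<mu>)
           = (\<integral>\<^sup>+ y. (\<Sum>k\<in>S'. ennreal (\<alpha> k / measure \<mu> (E k)) * indicator (E k \<inter> ball x (r x)) y) \<partial>\<mu>)"
        proof (intro nn_integral_cong)
          fix y
          have "ennreal (h y) = (\<Sum>k\<in>S'. ennreal (\<alpha> k / measure \<mu> (E k) * indicator (E k) y))"
            unfolding h_def using \<alpha> S'S by (subst sum_ennreal) (auto intro!: mult_nonneg_nonneg divide_nonneg_nonneg)
          then show "ennreal (h y) * indicator (ball x (r x)) y = (\<Sum>k\<in>S'. ennreal (\<alpha> k / measure \<mu> (E k)) * indicator (E k \<inter> ball x (r x)) y)"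
            by (simp add: sum_distrib_right) (intro sum.cong, auto simp: indicator_def)
        qed
        also have "\<dots> = (\<Sum>k\<in>S'. ennreal (\<alpha> k / measure \<mu> (E k)) * emeasure \<mu> (E k \<inter> ball x (r x)))"
        proof (subst nn_integral_sum)
          fix k assume "k \<in> S'"
          then show "(\<lambda>y. ennreal (\<alpha> k / measure \<mu> (E k)) * indicator (E k \<inter> ball x (r x)) y) \<in> borel_measurable \<mu>"
            using Em by (intro borel_measurable_times_ennreal borel_measurable_indicator) auto
        qed (intro sum.cong refl nn_integral_cmult_indicator, use Em in auto)
        also have "\<dots> \<le> (\<Sum>k\<in>S'. if k \<in> ball x (4 * r x) then ennreal (\<alpha> k) else 0)"
        proof (rule sum_mono)
          fix k assume k: "k \<in> S'"
          have rk: "r k \<le> r x" using insert.hyps k by auto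
          show "ennreal (\<alpha> k / measure \<mu> (E k)) * emeasure \<mu> (E k \<inter> ball x (r x)) \<le> (if k \<in> ball x (4 * r x) then ennreal (\<alpha> k) else 0)"
          proof (cases "k \<in> ball x (4 * r x)")
            case True
            have fE: "emeasure \<mu> (E k) = ennreal (measure \<mu> (E k))"
              by (rule emeasure_subset_ball[OF Em(2)[OF k]])
            have "ennreal (\<alpha> k / measure \<mu> (E k)) * emeasure \<mu> (E k \<inter> ball x (r x)) \<le> ennreal (\<alpha> k / measure \<mu> (E k)) * emeasure \<mu> (E k)"
              using Em(1)[OF k] by (intro mult_left_mono emeasure_mono) auto
            also have "\<dots> = ennreal (\<alpha> k)" unfolding fE
              using Em(4)[OF k] \<alpha>[of k] k S'S by (subst ennreal_mult[symmetric]) auto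
            finally show ?thesis using True by simp
          next
            case False
            have "E k \<inter> ball x (r x) = {}"
            proof (rule ccontr)
              assume "E k \<inter> ball x (r x) \<noteq> {}"
              then obtain z where "z \<in> E k" "z \<in> ball x (r x)" by blast
              then have "dist k z < r k" "dist x z < r x" using Em(2)[OF k] by auto
              then have "dist x k < r x + r k" using dist_triangle[of x k z] by (simp add: dist_commute)
              then show False using False rk r[OF xS] by simp
            qed
            then show ?thesis by simp
          qed
        qed
        also have "\<dots> = ennreal (\<Sum>k\<in>S' \<inter> ball x (4 * r x). \<alpha> k)"
          using fS' \<alpha> S'S by (subst sum_ennreal[symmetric]) (auto simp: sum.inter_restrict subset_iff)
        also have "\<dots> \<le> ennreal (\<Sum>k\<in>S \<inter> ball x (4 * r x). \<alpha> k)"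
          using S \<alpha> S'S by (intro ennreal_leI sum_mono2) auto
        also have "\<dots> \<le> ennreal (t * A * ?V)" by (intro ennreal_leI le xS)
        finally show ?thesis .
      qed
      \<comment> \<open>Chebyshev's inequality: \<open>h\<close> exceeds 2 A t on the removed part,
        which therefore fills at most half of the ball.\<close>
      have "ennreal (2 * A * t) * emeasure \<mu> (ball x (r x) - H) = (\<integral>\<^sup>+ y. ennreal (2 * A * t) * indicator (ball x (r x) - H) y \<partial>\<mu>)"
        using Hm by (intro nn_integral_cmult_indicator[symmetric]) auto
      also have "\<dots> \<le> (\<integral>\<^sup>+ y. ennreal (h y) * indicator (ball x (r x)) y \<partial>\<mu>)"
        by (intro nn_integral_mono) (auto simp: indicator_def H_def D_def intro!: ennreal_leI)
      also note int
      finally have "ennreal (2 * A * t) * emeasure \<mu> (ball x (r x) - H) \<le> ennreal (t * A * ?V)" .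
      moreover have eD: "emeasure \<mu> (ball x (r x) - H) = ennreal (measure \<mu> (ball x (r x) - H))"
        by (rule emeasure_subset_ball) (rule Diff_subset)
      ultimately have "ennreal (2 * A * t * measure \<mu> (ball x (r x) - H)) \<le> ennreal (t * A * ?V)"
        using A_pos t by (simp add: ennreal_mult)
      then have "2 * A * t * measure \<mu> (ball x (r x) - H) \<le> t * A * ?V"
        using A_pos t by (subst (asm) ennreal_le_iff) auto
      then have "(A * t) * (2 * measure \<mu> (ball x (r x) - H)) \<le> (A * t) * ?V" by (simp add: mult_ac)
      then have "2 * measure \<mu> (ball x (r x) - H) \<le> ?V"
        by (rule mult_left_le_imp_le) (use A_pos t in simp)
      moreover have "measure \<mu> (ball x (r x) - H) = ?V - measure \<mu> H"
        using finB Hm by (intro measure_Diff) (auto simp: H_def)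
      ultimately have Hhalf: "?V \<le> 2 * measure \<mu> H" by simp
      have Hpos: "0 < measure \<mu> H" using Hhalf pos[OF xS] by simp
      \<comment> \<open>The centre counts itself in hypothesis \<open>le\<close>, which bounds the
        height of the new function by 2 A t. Together with h \<le> 2 A t on \<open>H\<close> this
        gives 4 A t; off \<open>H\<close> nothing changes.\<close>
      have w: "\<alpha> x / measure \<mu> H \<le> 2 * A * t"
      proof -
        have "\<alpha> x \<le> (\<Sum>k\<in>S \<inter> ball x (4 * r x). \<alpha> k)"
          using S \<alpha> xS r[OF xS] by (intro member_le_sum) auto
        also have "\<dots> \<le> t * A * ?V" by (rule le[OF xS])
        also have "\<dots> \<le> t * A * (2 * measure \<mu> H)" using Hhalf A_pos t by (intro mult_left_mono) auto
        finally show ?thesis using Hpos by (simp add: field_simps)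
      qed
      define E' where "E' = E(x := H)"
      have sumE': "(\<Sum>k\<in>S'. \<alpha> k / measure \<mu> (E' k) * indicator (E' k) y) = h y" for y
        unfolding h_def E'_def using x by (intro sum.cong) auto
      have "P (insert x S') E'"
        unfolding P_def
      proof (intro conjI ballI allI)
        fix k assume "k \<in> insert x S'"
        then show "E' k \<in> sets borel" "E' k \<subseteq> ball k (r k)" "vol k (r k) \<le> 2 * measure \<mu> (E' k)"
          using Em x Hm Hhalf unfolding E'_def by (auto simp: H_def simp del: mem_ball)
      next
        fix y
        have eq: "(\<Sum>k\<in>insert x S'. \<alpha> k / measure \<mu> (E' k) * indicator (E' k) y) = \<alpha> x / measure \<mu> H * indicator H y + h y"
          unfolding sum.insert[OF fS' x] sumE' by (simp add: E'_def)
        show "(\<Sum>k\<in>insert x S'. \<alpha> k / measure \<mu> (E' k) * indicator (E' k) y) \<le> 4 * A * t"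
        proof (cases "y \<in> H")
          case True
          then have "h y \<le> 2 * A * t" by (simp add: H_def D_def)
          then show ?thesis unfolding eq using w True by simp
        next
          case False
          have "h y \<le> 4 * A * t" using E unfolding P_def h_def by auto
          then show ?thesis unfolding eq using False by simp
        qed
      qed
      then show ?thesis by blast
    qed
  qed
  from this[OF order_refl] show ?thesis unfolding P_def .
qed

lemma emeasure_ball_le_3: "0 < s \<Longrightarrow> emeasure \<mu> (ball x s) \<le> ennreal (1 * vol x (3 * s))"
  by (auto simp: emeasure_ball intro!: ennreal_leI measure_ball_mono')

end

section \<open>Stopping balls at the atoms\<close>

context cz_operator
begin

text \<open>The stopping radius is the last scale at which the ball is so heavy for \<open>\<nu>\<close> that it may be discarded;
  it exists because \<open>\<mu> {k} = 0\<close> while \<open>k\<close> is an atom of \<open>\<nu>\<close>.\<close>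

lemma stopping_scale:
  assumes \<nu>: "finite_measure \<nu>" "sets \<nu> = sets borel" and t: "0 < t"
    and k: "0 < measure \<nu> {k}" and big: "ennreal (measure \<nu> UNIV / t) < emeasure \<mu> UNIV"
  shows "\<exists>s>0. t * vol k (16 * s) < measure \<nu> (ball k (4 * s)) \<and>
     (\<forall>l\<ge>1. measure \<nu> (ball k (4 * (16 ^ l * s))) \<le> t * vol k (16 * (16 ^ l * s)))"
proof -
  interpret nu: finite_measure \<nu> by fact
  define bad where "bad s \<longleftrightarrow> t * vol k (16 * s) < measure \<nu> (ball k (4 * s))" for s
  have "\<exists>s>0. bad s"
  proof -
    let ?B = "\<lambda>n::nat. ball k (1 / Suc n)"
    have lim: "(\<lambda>n. emeasure \<mu> (?B n)) \<longlonglongrightarrow> emeasure \<mu> (\<Inter>n. ?B n)"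
    proof (rule Lim_emeasure_decseq)
      show "decseq ?B" by (auto simp: decseq_def frac_le intro!: subset_ball)
    qed (use emeasure_ball_finite in \<open>auto simp: less_top\<close>)
    have "(\<Inter>n. ?B n) = {k}"
    proof -
      have "y = k" if "\<And>n. dist k y < 1 / Suc n" for y
      proof (rule ccontr)
        assume "y \<noteq> k"
        then have "0 < dist k y" by simp
        then obtain n where "1 / Suc n < dist k y" using nat_approx_posE by blast
        then show False using that[of n] by simp
      qed
      then show ?thesis by auto
    qed
    then have "(\<lambda>n. emeasure \<mu> (?B n)) \<longlonglongrightarrow> 0" using lim nonatomic by simp
    moreover have "0 < ennreal (measure \<nu> {k} / t)" using k t by simp
    ultimately have "\<forall>\<^sub>F n in sequentially. emeasure \<mu> (?B n) < ennreal (measure \<nu> {k} / t)"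
      by (rule order_tendstoD(2))
    then obtain n where "emeasure \<mu> (?B n) < ennreal (measure \<nu> {k} / t)"
      using eventually_happens sequentially_bot by blast
    then have "t * measure \<mu> (?B n) < measure \<nu> {k}"
      using t k by (simp add: emeasure_ball ennreal_less_iff field_simps)
    also have "measure \<nu> {k} \<le> measure \<nu> (ball k (4 * (1 / real (Suc n) / 16)))"
      by (intro nu.finite_measure_mono) (auto simp: \<nu>)
    finally have lt: "t * measure \<mu> (?B n) < measure \<nu> (ball k (4 * (1 / real (Suc n) / 16)))" .
    have e: "16 * (1 / real (Suc n) / 16) = 1 / real (Suc n)" by (simp del: of_nat_Suc)
    from lt have "bad (1 / real (Suc n) / 16)" unfolding bad_def e .
    then show ?thesis by (intro exI[of _ "1 / real (Suc n) / 16"]) auto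
  qed
  then obtain s0 where s0: "0 < s0" "bad s0" by blast
  \<comment> \<open>By \<open>big\<close> the \<mu>-measure of large balls exceeds \<nu>(X)/t, so
    large scales are not bad and there is a last bad one among the scales 16^l * s0.\<close>
  have ev: "\<exists>L. \<forall>l\<ge>L. \<not> bad (16 ^ l * s0)"
  proof -
    let ?B = "\<lambda>l::nat. ball k (16 * (16 ^ l * s0))"
    have "(\<lambda>l. emeasure \<mu> (?B l)) \<longlonglongrightarrow> emeasure \<mu> (\<Union>l. ?B l)"
    proof (rule Lim_emeasure_incseq)
      show "incseq ?B" using s0 by (auto simp: incseq_def intro!: subset_ball mult_right_mono power_increasing)
    qed auto
    moreover have "(\<Union>l. ?B l) = UNIV"
    proof -
      have "\<exists>l. dist k y < 16 * (16 ^ l * s0)" for y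
      proof -
        obtain l where "dist k y / s0 < 16 ^ l" using real_arch_pow[of 16] by auto
        then have "dist k y < 16 ^ l * s0" using s0 by (simp add: field_simps)
        also have "\<dots> \<le> 16 * (16 ^ l * s0)" using s0 by simp
        finally show ?thesis by blast
      qed
      then show ?thesis by auto
    qed
    ultimately have "(\<lambda>l. emeasure \<mu> (?B l)) \<longlonglongrightarrow> emeasure \<mu> UNIV" by simp
    then have "\<forall>\<^sub>F l in sequentially. ennreal (measure \<nu> UNIV / t) < emeasure \<mu> (?B l)"
      using big by (rule order_tendstoD(1))
    then obtain L where L: "\<And>l. l \<ge> L \<Longrightarrow> ennreal (measure \<nu> UNIV / t) < emeasure \<mu> (?B l)"
      by (auto simp: eventually_sequentially)
    have "\<not> bad (16 ^ l * s0)" if "l \<ge> L" for l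
    proof -
      have "measure \<nu> UNIV \<le> t * measure \<mu> (?B l)"
        using L[OF that] t by (simp add: emeasure_ball ennreal_less_iff field_simps)
      moreover have "measure \<nu> (ball k (4 * (16 ^ l * s0))) \<le> measure \<nu> UNIV"
        by (intro nu.finite_measure_mono) (auto simp: \<nu>)
      ultimately show ?thesis by (simp add: bad_def)
    qed
    then show ?thesis by blast
  qed
  then obtain L where L: "\<And>l. L \<le> l \<Longrightarrow> \<not> bad (16 ^ l * s0)" by blast
  let ?P = "\<lambda>l. bad (16 ^ l * s0)"
  define l0 where "l0 = (GREATEST l. ?P l)"
  have bd: "\<forall>l. ?P l \<longrightarrow> l \<le> L" using L by (meson linear)
  have 1: "?P l0" unfolding l0_def by (rule GreatestI_nat[of ?P 0 L]) (use s0 bd in auto)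
  have 2: "\<not> bad (16 ^ l * (16 ^ l0 * s0))" if "1 \<le> l" for l
  proof
    assume "bad (16 ^ l * (16 ^ l0 * s0))"
    then have "?P (l + l0)" by (simp add: power_add mult_ac)
    then have "l + l0 \<le> l0" unfolding l0_def[symmetric] using Greatest_le_nat[of ?P "l + l0" L] bd l0_def by simp
    then show False using that by simp
  qed
  show ?thesis
    using 1 2 s0 unfolding bad_def by (intro exI[of _ "16 ^ l0 * s0"]) (auto simp: not_less)
qed

text \<open>Three single annuli of ratio 16 and one chain of non-doubling scales: the way from the
  stopping scale to 16 times the doubling radius above it.\<close>

definition shell_const :: real where "shell_const = 3 * Cl ^ 6 + 4 * Cl ^ 8"

lemma shell_const_nonneg: "0 \<le> shell_const"
  unfolding shell_const_def using Cl_ge_1 by simp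

text \<open>Above the stopping scale \<open>s\<close> the scales 16^l * s are light, so at the first
  doubling radius \<open>r\<close> one has \<nu>(ball k (4 r)) \<le> t vol k (16 r) \<le> t A vol k
  r, which is what spreading the atom requires. The heavy ball of radius 4 s can be discarded, and
  the gap up to 16 r costs a bounded shell because apart from three annuli it consists of
  non-doubling scales.\<close>

lemma stopping_ball:
  assumes \<nu>: "finite_measure \<nu>" "sets \<nu> = sets borel" and t: "0 < t"
    and k: "0 < measure \<nu> {k}" and big: "ennreal (measure \<nu> UNIV / t) < emeasure \<mu> UNIV"
  obtains s r where "0 < s" "0 < r" "t * vol k (16 * s) < measure \<nu> (ball k (4 * s))"
    "measure \<nu> (ball k (4 * r)) \<le> t * A * vol k r" "dbl k r"
    "0 < vol k r" "shell \<mu> k s (16 * r) \<le> ennreal shell_const"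
proof -
  interpret nu: finite_measure \<nu> by fact
  obtain s where s: "0 < s" "t * vol k (16 * s) < measure \<nu> (ball k (4 * s))"
    and good: "\<And>l. 1 \<le> l \<Longrightarrow> measure \<nu> (ball k (4 * (16 ^ l * s))) \<le> t * vol k (16 * (16 ^ l * s))"
    using stopping_scale[OF assms] by blast
  \<comment> \<open>At this radius positive volume is known: lightness of the scale 16 s bounds the
    mass of the atom by t times the volume at 256 s.\<close>
  define s2 where "s2 = 256 * s"
  have s2: "0 < s2" using s by (simp add: s2_def)
  have "0 < measure \<nu> {k}" by (rule k)
  also have "\<dots> \<le> measure \<nu> (ball k (4 * (16 ^ 1 * s)))"
    using s by (intro nu.finite_measure_mono) (auto simp: \<nu>)
  also have "\<dots> \<le> t * vol k (16 * (16 ^ 1 * s))" by (rule good) simp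
  finally have pos2: "0 < vol k s2" using t by (simp add: s2_def zero_less_mult_iff)
  obtain n where n: "dbl k (16 ^ n * s2)" "\<And>i. i < n \<Longrightarrow> \<not> dbl k (16 ^ i * s2)"
    using ex_dbl[OF s2 pos2] by blast
  define r where "r = 16 ^ n * s2"
  have r: "0 < r" "s2 \<le> r" using s2 by (auto simp: r_def)
  have "measure \<nu> (ball k (4 * r)) \<le> t * vol k (16 * r)"
    using good[of "n + 2"] by (simp add: r_def s2_def power_add mult_ac)
  also have "\<dots> \<le> t * (A * vol k r)"
    using n(1) t by (intro mult_left_mono) (auto simp: dbl_def r_def)
  finally have c1: "measure \<nu> (ball k (4 * r)) \<le> t * A * vol k r" by (simp add: mult.assoc)
  have c2: "0 < vol k r" using pos2 measure_ball_mono'[OF r(2), of k] by linarith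
  have e3: "\<And>u. 0 < u \<Longrightarrow> emeasure \<mu> (ball k u) \<le> ennreal (1 * vol k (3 * u))"
    by (rule emeasure_ball_le_3)
  have "shell \<mu> k s (16 * r) \<le> shell \<mu> k s (16 * s) + shell \<mu> k (16 * s) (16 * r)"
    by (intro shell_split sets_mu) (use s in auto)
  also have "\<dots> \<le> shell \<mu> k s (16 * s) + (shell \<mu> k (16 * s) (16 * (16 * s)) + shell \<mu> k (16 * (16 * s)) (16 * r))"
    by (intro add_left_mono shell_split sets_mu) (use s in auto)
  also have "\<dots> \<le> shell \<mu> k s (16 * s) + (shell \<mu> k (16 * s) (16 * (16 * s)) + (shell \<mu> k s2 r + shell \<mu> k r (16 * r)))"
    using shell_split[OF s2 r(1) sets_mu, of k "16 * r"] by (intro add_left_mono) (simp add: s2_def)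
  also have "\<dots> \<le> ennreal (1 * Cl ^ 6) + (ennreal (1 * Cl ^ 6) + (ennreal (1 * (4 * Cl ^ 8)) + ennreal (1 * Cl ^ 6)))"
    unfolding r_def by (intro add_mono shell_16 shell_chain e3 sets_mu) (use s s2 n(2) in auto)
  also have "\<dots> = ennreal shell_const"
    unfolding shell_const_def using Cl_ge_1 by (simp add: ennreal_plus[symmetric] del: ennreal_plus)
  finally show ?thesis using that[OF s(1) r(1) s(2) c1 _ c2] n(1) by (simp add: r_def)
qed

end

section \<open>Cancellation between an atom and its spread-out copy\<close>

context cz_kernel
begin

lemma trunc_dens_integrable_of_finite:
  assumes "0 < r" and f: "f \<in> borel_measurable borel" "\<And>y. 0 \<le> f y" and fin: "finite_measure (dens f)"
  shows "integrable \<mu> (\<lambda>y. kern r x y * complex_of_real (f y))"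
proof -
  have fm: "f \<in> borel_measurable \<mu>" using f(1) by simp
  have "integrable (dens f) (\<lambda>y. kern r x y)"
    by (intro trunc_integrable assms(1) fin) simp
  then have "integrable \<mu> (\<lambda>y. f y *\<^sub>R (kern r x y))"
    using fm trunc_integrand_measurable[OF assms(1) sets_mu, of x] f(2)
    by (subst (asm) integrable_density) auto
  then show ?thesis by (simp add: scaleR_conv_of_real mult_ac)
qed

lemma trunc_dens_integrable:
  assumes "0 < r" "bdd_supp_fun f"
  shows "integrable \<mu> (\<lambda>y. kern r x y * complex_of_real (f y))"
  using assms
  by (intro trunc_dens_integrable_of_finite bdd_supp_fun_measurable bdd_supp_fun_nonneg bdd_supp_fun_finite_measure)

lemma trunc_dens_sum:
  assumes r: "0 < r" and S: "finite S" "\<And>k. k \<in> S \<Longrightarrow> bdd_supp_fun (f k)"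
  shows "trunc (dens (\<lambda>y. \<Sum>k\<in>S. f k y)) r x = (\<Sum>k\<in>S. trunc (dens (f k)) r x)"
proof -
  have "trunc (dens (\<lambda>y. \<Sum>k\<in>S. f k y)) r x
     = (\<integral>y. kern r x y * complex_of_real (\<Sum>k\<in>S. f k y) \<partial>\<mu>)"
    using S by (intro trunc_dens r bdd_supp_fun_measurable bdd_supp_fun_sum sum_nonneg bdd_supp_fun_nonneg) auto
  also have "\<dots> = (\<integral>y. (\<Sum>k\<in>S. kern r x y * complex_of_real (f k y)) \<partial>\<mu>)"
    by (simp add: sum_distrib_left)
  also have "\<dots> = (\<Sum>k\<in>S. (\<integral>y. kern r x y * complex_of_real (f k y) \<partial>\<mu>))"
    by (intro Bochner_Integration.integral_sum trunc_dens_integrable r S)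
  also have "\<dots> = (\<Sum>k\<in>S. trunc (dens (f k)) r x)"
    using S by (intro sum.cong refl trunc_dens[symmetric] r bdd_supp_fun_measurable bdd_supp_fun_nonneg) auto
  finally show ?thesis .
qed

text \<open>Away from the support the cancellation of the atom \<open>a \<delta>\<^sub>k\<close> against its spread-out copy \<open>\<phi> \<mu>\<close>
  gives decay, unless the truncation sphere meets the support.\<close>

lemma atom_minus_spread_le:
  assumes \<rho>: "0 < \<rho>" and r: "0 < r" and far: "2 * r \<le> dist x k"
    and \<phi>: "bdd_supp_fun \<phi>" "\<And>y. \<phi> y \<noteq> 0 \<Longrightarrow> dist k y < r"
    and a: "(\<integral>\<^sup>+ y. ennreal (\<phi> y) \<partial>\<mu>) = ennreal a" "0 \<le> a"
  shows "norm (complex_of_real a * (kern \<rho> x k) - trunc (dens \<phi>) \<rho> x)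
    \<le> CK * a * ((2 * r / dist k x) powr \<tau> / lam k (dist k x)) + (if dist x k < 3 * \<rho> then 2 * CK * a / lam x \<rho> else 0)"
proof -
  let ?\<kappa> = "\<lambda>y. kern \<rho> x y"
  note \<phi>m = bdd_supp_fun_measurable[OF \<phi>(1)] and \<phi>0 = bdd_supp_fun_nonneg[OF \<phi>(1)]
  have l: "0 < lam x \<rho>" by (rule lam_pos[OF \<rho>])
  have dk: "0 < dist k x" using far r unfolding dist_commute[of k x] by linarith
  have lk: "0 < lam k (dist k x)" by (rule lam_pos[OF dk])
  define c where "c = CK * ((2 * r / dist k x) powr \<tau> / lam k (dist k x)) + (if dist x k < 3 * \<rho> then 2 * CK / lam x \<rho> else 0)"
  have c0: "0 \<le> c" unfolding c_def using CK_pos lk l by (auto intro!: add_nonneg_nonneg mult_nonneg_nonneg divide_nonneg_nonneg)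
  have \<phi>int: "integrable \<mu> \<phi>"
    using \<phi>m \<phi>0 a by (intro integrableI_nn_integral_finite[of _ _ a]) auto
  have \<phi>a: "(\<integral>y. \<phi> y \<partial>\<mu>) = a"
    using \<phi>m \<phi>0 a by (subst integral_eq_nn_integral) auto
  have "complex_of_real a * ?\<kappa> k = (\<integral>y. ?\<kappa> k * complex_of_real (\<phi> y) \<partial>\<mu>)"
    using \<phi>int by (simp add: \<phi>a mult_ac)
  then have "complex_of_real a * ?\<kappa> k - trunc (dens \<phi>) \<rho> x = (\<integral>y. ?\<kappa> k * complex_of_real (\<phi> y) - ?\<kappa> y * complex_of_real (\<phi> y) \<partial>\<mu>)"
    using \<phi>int trunc_dens_integrable[OF \<rho> \<phi>(1), of x] trunc_dens[OF \<rho> \<phi>m \<phi>0, of x]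
    by (subst Bochner_Integration.integral_diff) auto
  moreover have "norm \<dots> \<le> c * a"
  proof (rule norm_integral_le_of_nn_integral)
    have pw: "norm (?\<kappa> k * complex_of_real (\<phi> y) - ?\<kappa> y * complex_of_real (\<phi> y)) \<le> c * \<phi> y" for y
    proof (cases "\<phi> y = 0")
      case False
      have ky: "dist k y < r" by (rule \<phi>(2)[OF False])
      have "norm (?\<kappa> k - ?\<kappa> y) \<le> c"
      \<comment> \<open>Either the whole ball around \<open>k\<close> is seen, or \<rho> \<ge> dist
        x k - r \<ge> dist x k / 2 by \<open>far\<close>; then the size bound at radius \<rho> is
        enough.\<close>
      proof (cases "\<rho> < dist x k - r")
        case True
        have "\<rho> < dist x y" using True ky dist_triangle[of x k y] by (simp add: dist_commute)
        moreover have "\<rho> < dist x k" using True r by simp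
        ultimately have "norm (?\<kappa> k - ?\<kappa> y) = norm (K x k - K x y)" by simp
        also have "\<dots> \<le> CK * (dist k y powr \<tau> / (dist k x powr \<tau> * lam k (dist k x)))"
          using dk ky far by (intro K_reg2) (auto simp: dist_commute)
        \<comment> \<open>Weakened from \<open>r\<close> to \<open>2 * r\<close> to match the tail
          that starts at distance 2 r.\<close>
        also have "\<dots> \<le> CK * ((2 * r) powr \<tau> / (dist k x powr \<tau> * lam k (dist k x)))"
          using ky r CK_pos tau_pos lk by (intro mult_left_mono divide_right_mono powr_mono2) auto
        also have "\<dots> = CK * ((2 * r / dist k x) powr \<tau> / lam k (dist k x))"
          using r by (simp add: powr_divide)
        also have "\<dots> \<le> c" unfolding c_def using l CK_pos by simp
        finally show ?thesis .
      next
        case near: False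
        have "dist x k < 3 * \<rho>" using near far \<rho> by linarith
        then have "2 * CK / lam x \<rho> \<le> c"
          unfolding c_def using CK_pos lk by simp
        moreover have "norm (?\<kappa> k - ?\<kappa> y) \<le> norm (?\<kappa> k) + norm (?\<kappa> y)" by (rule norm_triangle_ineq4)
        moreover have "norm (?\<kappa> k) \<le> CK / lam x \<rho>" "norm (?\<kappa> y) \<le> CK / lam x \<rho>"
          by (rule trunc_integrand_bound[OF \<rho>])+
        moreover have "2 * CK / lam x \<rho> = CK / lam x \<rho> + CK / lam x \<rho>" by simp
        ultimately show ?thesis by linarith
      qed
      then have "norm (?\<kappa> k - ?\<kappa> y) * \<phi> y \<le> c * \<phi> y" by (intro mult_right_mono \<phi>0)
      moreover have "norm (?\<kappa> k * complex_of_real (\<phi> y) - ?\<kappa> y * complex_of_real (\<phi> y)) = norm (?\<kappa> k - ?\<kappa> y) * \<phi> y"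
        using \<phi>0[of y] by (simp only: left_diff_distrib[symmetric] norm_mult norm_of_real abs_of_nonneg)
      ultimately show ?thesis by simp
    qed simp
    have "(\<integral>\<^sup>+ y. ennreal (norm (?\<kappa> k * complex_of_real (\<phi> y) - ?\<kappa> y * complex_of_real (\<phi> y))) \<partial>\<mu>)
      \<le> (\<integral>\<^sup>+ y. ennreal c * ennreal (\<phi> y) \<partial>\<mu>)"
      using pw c0 \<phi>0 by (intro nn_integral_mono) (auto simp: ennreal_mult[symmetric] intro!: ennreal_leI)
    also have "\<dots> = ennreal (c * a)"
      using \<phi>m a c0 by (subst nn_integral_cmult) (auto simp: ennreal_mult)
    finally show "(\<integral>\<^sup>+ y. ennreal (norm (?\<kappa> k * complex_of_real (\<phi> y) - ?\<kappa> y * complex_of_real (\<phi> y))) \<partial>\<mu>) \<le> ennreal (c * a)" .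
  qed (use c0 a in simp)
  ultimately have "norm (complex_of_real a * ?\<kappa> k - trunc (dens \<phi>) \<rho> x) \<le> c * a" by metis
  also have "c * a = CK * a * ((2 * r / dist k x) powr \<tau> / lam k (dist k x)) + (if dist x k < 3 * \<rho> then 2 * CK * a / lam x \<rho> else 0)"
    by (simp add: c_def algebra_simps)
  finally show ?thesis .
qed

end

section \<open>Weak type (1,1) for measures of finite support\<close>

context cz_operator
begin

text \<open>The summands bound, per unit of mass, the integrals of the majorants \<open>H1\<close>,
  \<open>H2\<close> and \<open>H3\<close> in the proof of \<open>weak_11_atomic\<close>.\<close>

definition Ch :: real where
  "Ch = CK * Ct * shell_const + CK * (Cl / (1 - (1/2) powr \<tau>)) + (2 * A + 4 * C22)"

text \<open>One unit for the spread-out measure, one for the sum of the majorants, and the rest for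
  the atoms near the truncation sphere.\<close>

definition Ca :: real where "Ca = 2 + 2 * CK * Cl ^ 4"

text \<open>The bracket counts the four exceptional sets of the decomposition at height
  \<open>t\<close>; the factor \<open>Ca\<close> rescales the level from \<open>t\<close> to
  \<open>Ca * t\<close>.\<close>

definition C11 :: real where "C11 = Ca * (2 + 4 * A * C22 + Ch)"

lemma Ch_nonneg: "0 \<le> Ch"
  unfolding Ch_def using CK_pos Ct_ge_1 Cl_ge_1 shell_const_nonneg C22_nonneg A_pos half_powr_lt_1
  by (intro add_nonneg_nonneg mult_nonneg_nonneg divide_nonneg_nonneg) auto

lemma Ca_pos: "0 < Ca"
  unfolding Ca_def using CK_pos Cl_ge_1 by (intro add_pos_nonneg) auto

lemma C11_pos: "0 < C11"
  unfolding C11_def using Ca_pos A_pos C22_nonneg Ch_nonneg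
  by (intro mult_pos_pos add_pos_nonneg) auto

text \<open>If \<mu> has total mass at most \<nu>(X)/t, the whole space is small enough. Otherwise
  stopping balls exist and four sets are discarded: the heavy balls, the points where the maximal
  function of \<nu> exceeds \<open>t\<close>, those where the operator on the spread-out measure
  does, and those where the sum \<open>H\<close> of majorants does. Each has measure at most a
  multiple of \<nu>(X)/t, and elsewhere every truncation is at most \<open>Ca * t\<close>.\<close>

lemma weak_11_atomic:
  assumes \<nu>: "finite_measure \<nu>" "sets \<nu> = sets borel"
    and S: "finite S" "AE y in \<nu>. y \<in> S" and t: "0 < t"
  shows "emeasure \<mu> {x. ennreal (Ca * t) < tsharp \<nu> x} \<le> ennreal (C11 / Ca * measure \<nu> UNIV / t)"
proof (cases "ennreal (measure \<nu> UNIV / t) < emeasure \<mu> UNIV")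
  case False
  have "emeasure \<mu> {x. ennreal (Ca * t) < tsharp \<nu> x} \<le> emeasure \<mu> UNIV" by (intro emeasure_mono) auto
  also have "\<dots> \<le> ennreal (measure \<nu> UNIV / t)" using False by simp
  also have "\<dots> \<le> ennreal (C11 / Ca * measure \<nu> UNIV / t)"
  proof (intro ennreal_leI divide_right_mono)
    have "1 \<le> C11 / Ca" using Ca_pos A_pos C22_nonneg Ch_nonneg by (simp add: C11_def add_increasing2)
    then show "measure \<nu> UNIV \<le> C11 / Ca * measure \<nu> UNIV"
      using mult_right_mono[of 1 "C11 / Ca" "measure \<nu> UNIV"] by simp
  qed (use t in simp)
  finally show ?thesis .
next
  case big: True
  interpret nu: finite_measure \<nu> by fact
  define \<alpha> where "\<alpha> k = measure \<nu> {k}" for k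
  define S0 where "S0 = {k\<in>S. 0 < \<alpha> k}"
  have S0: "finite S0" "\<And>k. k \<in> S0 \<Longrightarrow> 0 < \<alpha> k" using S(1) by (auto simp: S0_def)
  have AE0: "AE y in \<nu>. y \<in> S0"
  proof -
    have "AE y in \<nu>. y \<notin> S - S0"
    proof (rule AE_not_in)
      have "S - S0 = (\<Union>k\<in>S - S0. {k})" by auto
      moreover have "(\<Union>k\<in>S - S0. {k}) \<in> null_sets \<nu>"
        using S(1) by (intro null_sets_UN' countable_finite)
          (auto simp: S0_def \<alpha>_def null_sets_def \<nu>(2) nu.emeasure_eq_measure not_less measure_le_0_iff)
      ultimately show "S - S0 \<in> null_sets \<nu>" by simp
    qed
    with S(2) show ?thesis by eventually_elim auto
  qed
  have \<nu>B: "measure \<nu> B = (\<Sum>k\<in>S0 \<inter> B. \<alpha> k)" if "B \<in> sets borel" for B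
    unfolding \<alpha>_def by (rule measure_finite_support[OF \<nu> S0(1) AE0 that])
  define n where "n = measure \<nu> UNIV"
  have n: "n = (\<Sum>k\<in>S0. \<alpha> k)" using \<nu>B[of UNIV] by (simp add: n_def)
  have n0: "0 \<le> n" by (simp add: n_def)
  define Q where "Q k s r \<longleftrightarrow> 0 < s \<and> 0 < r \<and> t * vol k (16 * s) < measure \<nu> (ball k (4 * s)) \<and>
    measure \<nu> (ball k (4 * r)) \<le> t * A * vol k r \<and> dbl k r \<and>
    0 < vol k r \<and> shell \<mu> k s (16 * r) \<le> ennreal shell_const" for k s r
  have "\<exists>s r. Q k s r" if "k \<in> S0" for k
  proof -
    have "0 < measure \<nu> {k}" using S0(2)[OF that] by (simp add: \<alpha>_def)
    from stopping_ball[OF \<nu> t this big] obtain s r where "Q k s r" unfolding Q_def by blast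
    then show ?thesis by blast
  qed
  then obtain s r where Q: "\<And>k. k \<in> S0 \<Longrightarrow> Q k (s k) (r k)" by metis
  have sr: "\<And>k. k \<in> S0 \<Longrightarrow> 0 < s k" "\<And>k. k \<in> S0 \<Longrightarrow> 0 < r k"
    "\<And>k. k \<in> S0 \<Longrightarrow> t * vol k (16 * s k) < measure \<nu> (ball k (4 * s k))"
    "\<And>k. k \<in> S0 \<Longrightarrow> measure \<nu> (ball k (4 * r k)) \<le> t * A * vol k (r k)"
    "\<And>k. k \<in> S0 \<Longrightarrow> dbl k (r k)" "\<And>k. k \<in> S0 \<Longrightarrow> 0 < vol k (r k)"
    "\<And>k. k \<in> S0 \<Longrightarrow> shell \<mu> k (s k) (16 * r k) \<le> ennreal shell_const"
    using Q unfolding Q_def by blast+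
  have "\<exists>E. (\<forall>k\<in>S0. E k \<in> sets borel \<and> E k \<subseteq> ball k (r k) \<and> vol k (r k) \<le> 2 * measure \<mu> (E k)) \<and>
           (\<forall>y. (\<Sum>k\<in>S0. \<alpha> k / measure \<mu> (E k) * indicator (E k) y) \<le> 4 * A * t)"
    using sr S0 \<nu>B by (intro greedy_almost_disjoint t) (auto simp: less_imp_le)
  then obtain E where "\<forall>k\<in>S0. E k \<in> sets borel \<and> E k \<subseteq> ball k (r k) \<and> vol k (r k) \<le> 2 * measure \<mu> (E k)"
      and E4: "\<forall>y. (\<Sum>k\<in>S0. \<alpha> k / measure \<mu> (E k) * indicator (E k) y) \<le> 4 * A * t" by blast
  then have E: "\<And>k. k \<in> S0 \<Longrightarrow> E k \<in> sets borel" "\<And>k. k \<in> S0 \<Longrightarrow> E k \<subseteq> ball k (r k)"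
     "\<And>k. k \<in> S0 \<Longrightarrow> vol k (r k) \<le> 2 * measure \<mu> (E k)" by blast+
  have Epos: "0 < measure \<mu> (E k)" if "k \<in> S0" for k using E(3)[OF that] sr(6)[OF that] by linarith
  have Efin: "emeasure \<mu> (E k) = ennreal (measure \<mu> (E k))" if "k \<in> S0" for k
    by (rule emeasure_subset_ball[OF E(2)[OF that]])
  define \<phi> where "\<phi> k y = \<alpha> k / measure \<mu> (E k) * indicator (E k) y" for k y
  have \<phi>E: "\<phi> k y \<noteq> 0 \<Longrightarrow> y \<in> E k" for k y by (auto simp: \<phi>_def indicator_def split: if_splits)
  have \<phi>b: "bdd_supp_fun (\<phi> k)" if k: "k \<in> S0" for k
  proof (rule bdd_supp_funI)
    show "\<phi> k \<in> borel_measurable borel" unfolding \<phi>_def[abs_def] using E(1)[OF k]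
      by (intro borel_measurable_times borel_measurable_const borel_measurable_indicator)
    show "0 \<le> \<phi> k y" for y unfolding \<phi>_def using S0(2)[OF k] by simp
    show "\<phi> k y \<le> \<alpha> k / measure \<mu> (E k)" for y unfolding \<phi>_def using S0(2)[OF k] by (simp add: indicator_def)
    show "\<phi> k y \<noteq> 0 \<Longrightarrow> y \<in> ball k (r k)" for y using \<phi>E E(2)[OF k] by blast
  qed
  have \<phi>1: "(\<integral>\<^sup>+ y. ennreal (\<phi> k y) \<partial>\<mu>) = ennreal (\<alpha> k)" if k: "k \<in> S0" for k
  proof -
    have "(\<integral>\<^sup>+ y. ennreal (\<phi> k y) \<partial>\<mu>) = (\<integral>\<^sup>+ y. ennreal (\<alpha> k / measure \<mu> (E k)) * indicator (E k) y \<partial>\<mu>)"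
      by (intro nn_integral_cong) (simp add: \<phi>_def indicator_def)
    also have "\<dots> = ennreal (\<alpha> k / measure \<mu> (E k)) * ennreal (measure \<mu> (E k))"
      using E(1)[OF k] by (subst nn_integral_cmult_indicator) (auto simp: Efin[OF k])
    also have "\<dots> = ennreal (\<alpha> k)"
      using S0(2)[OF k] Epos[OF k] by (subst ennreal_mult[symmetric]) auto
    finally show ?thesis .
  qed
  define g where "g y = (\<Sum>k\<in>S0. \<phi> k y)" for y
  have gb: "bdd_supp_fun g" unfolding g_def[abs_def] by (intro bdd_supp_fun_sum S0(1) \<phi>b)
  have g4: "g y \<le> 4 * A * t" for y using E4 by (simp add: g_def \<phi>_def)
  have g1: "(\<integral>\<^sup>+ y. ennreal (g y) \<partial>\<mu>) = ennreal n"
  proof -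
    have "(\<integral>\<^sup>+ y. ennreal (g y) \<partial>\<mu>) = (\<integral>\<^sup>+ y. (\<Sum>k\<in>S0. ennreal (\<phi> k y)) \<partial>\<mu>)"
      unfolding g_def using bdd_supp_fun_nonneg[OF \<phi>b] by (simp add: sum_ennreal)
    also have "\<dots> = (\<Sum>k\<in>S0. ennreal (\<alpha> k))"
      using bdd_supp_fun_measurable[OF \<phi>b] by (subst nn_integral_sum) (auto simp: \<phi>1)
    also have "\<dots> = ennreal n" unfolding n using S0(2) by (intro sum_ennreal) (auto simp: less_imp_le)
    finally show ?thesis .
  qed
  have g2: "(\<integral>\<^sup>+ y. ennreal ((g y)\<^sup>2) \<partial>\<mu>) \<le> ennreal (4 * A * t * n)"
  proof -
    have "(g y)\<^sup>2 \<le> 4 * A * t * g y" for y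
      using mult_right_mono[OF g4[of y] bdd_supp_fun_nonneg[OF gb, of y]] by (simp add: power2_eq_square)
    then have "(\<integral>\<^sup>+ y. ennreal ((g y)\<^sup>2) \<partial>\<mu>) \<le> (\<integral>\<^sup>+ y. ennreal (4 * A * t) * ennreal (g y) \<partial>\<mu>)"
      using A_pos t bdd_supp_fun_nonneg[OF gb] by (intro nn_integral_mono) (auto simp: ennreal_mult[symmetric] intro!: ennreal_leI)
    also have "\<dots> = ennreal (4 * A * t * n)"
      using bdd_supp_fun_measurable[OF gb] A_pos t n0 by (subst nn_integral_cmult) (auto simp: g1 ennreal_mult)
    finally show ?thesis .
  qed
  let ?U1 = "\<Union>k\<in>S0. ball k (4 * s k)"
  let ?U2 = "{x. \<not> maximal_le \<mu> \<nu> t x}"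
  let ?U3 = "{x. ennreal t < tsharp (dens g) x}"
  have U1: "emeasure \<mu> ?U1 \<le> ennreal (n / t)"
  proof (rule emeasure_Union_balls_le[OF sets_mu])
    fix J assume J: "J \<subseteq> S0" "finite J" "disjoint_family_on (\<lambda>k. ball k (4 * s k)) J"
    have "(\<Sum>j\<in>J. emeasure \<mu> (ball j (3 * (4 * s j)))) \<le> (\<Sum>j\<in>J. ennreal (measure \<nu> (ball j (4 * s j)) / t))"
    proof (rule sum_mono)
      fix j assume "j \<in> J"
      then have j: "j \<in> S0" using J by auto
      have "vol j (3 * (4 * s j)) \<le> vol j (16 * s j)"
        using sr(1)[OF j] by (intro measure_ball_mono') simp
      also have "\<dots> \<le> measure \<nu> (ball j (4 * s j)) / t" using sr(3)[OF j] t by (simp add: field_simps)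
      finally show "emeasure \<mu> (ball j (3 * (4 * s j))) \<le> ennreal (measure \<nu> (ball j (4 * s j)) / t)"
        unfolding emeasure_ball by (rule ennreal_leI)
    qed
    also have "\<dots> = ennreal (measure \<nu> (\<Union>j\<in>J. ball j (4 * s j)) / t)"
      using J t \<nu>(2) by (subst nu.finite_measure_finite_Union) (auto simp: sum_divide_distrib sum_ennreal)
    also have "\<dots> \<le> ennreal (n / t)"
      using t nu.bounded_measure sets_eq_imp_space_eq[OF \<nu>(2)] by (intro ennreal_leI divide_right_mono) (auto simp: n_def)
    finally show "(\<Sum>j\<in>J. emeasure \<mu> (ball j (3 * (4 * s j)))) \<le> ennreal (n / t)" .
  qed
  have U2: "emeasure \<mu> ?U2 \<le> ennreal (n / t)" unfolding n_def by (rule maximal_weak_type[OF \<nu> t])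
  have U3: "emeasure \<mu> ?U3 \<le> ennreal (4 * A * C22 * n / t)"
    using tsharp_weak_22[OF gb g2 _ t] A_pos t n0 by (simp add: power2_eq_square mult_ac)
  \<comment> \<open>Majorants for the atom minus its spread-out copy, free of the truncation radius:
    \<open>H1\<close> for the atom near its ball but off the heavy ball, \<open>H2\<close> for the
    cancellation far away, \<open>H3\<close> for the spread-out copy near its ball.\<close>
  define H1 where "H1 k x = ennreal (CK * Ct * \<alpha> k) * (indicator {x. 4 * s k \<le> dist k x \<and> dist k x < 16 * r k} x * ennreal (1 / lam k (dist k x)))" for k x
  define H2 where "H2 k x = ennreal (CK * \<alpha> k) * (indicator {x. 2 * r k \<le> dist k x} x * ennreal ((2 * r k / dist k x) powr \<tau> / lam k (dist k x)))" for k x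
  define H3 where "H3 k x = indicator (ball k (2 * r k)) x * tsharp (dens (\<phi> k)) x" for k x
  have tm: "tsharp (dens (\<phi> k)) \<in> borel_measurable borel" if "k \<in> S0" for k
    by (intro tsharp_measurable bdd_supp_fun_finite_measure \<phi>b that) simp
  have H1m: "H1 k \<in> borel_measurable \<mu>" if k: "k \<in> S0" for k
    unfolding H1_def[abs_def] using sr(1)[OF k]
    by (intro borel_measurable_times_ennreal borel_measurable_const shell_integrand_measurable sets_mu) simp
  have H2m: "H2 k \<in> borel_measurable \<mu>" if k: "k \<in> S0" for k
    unfolding H2_def[abs_def] using sr(2)[OF k]
    by (intro borel_measurable_times_ennreal borel_measurable_const tail_integrand_measurable sets_mu) simp
  have H3m: "H3 k \<in> borel_measurable \<mu>" if k: "k \<in> S0" for k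
    unfolding H3_def[abs_def] using tm[OF k]
    by (intro borel_measurable_times_ennreal borel_measurable_indicator) auto
  have H1i: "(\<integral>\<^sup>+ x. H1 k x \<partial>\<mu>) \<le> ennreal (CK * Ct * shell_const * \<alpha> k)" if k: "k \<in> S0" for k
  proof -
    have "(\<integral>\<^sup>+ x. H1 k x \<partial>\<mu>) = ennreal (CK * Ct * \<alpha> k) * shell \<mu> k (4 * s k) (16 * r k)"
      unfolding H1_def shell_def using sr(1)[OF k]
      by (intro nn_integral_cmult shell_integrand_measurable sets_mu) simp
    also have "shell \<mu> k (4 * s k) (16 * r k) \<le> shell \<mu> k (s k) (16 * r k)"
      using sr(1)[OF k] by (intro shell_mono) auto
    also have "\<dots> \<le> ennreal shell_const" by (rule sr(7)[OF k])
    also have "ennreal (CK * Ct * \<alpha> k) * ennreal shell_const = ennreal (CK * Ct * shell_const * \<alpha> k)"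
      using CK_pos Ct_ge_1 S0(2)[OF k] shell_const_nonneg by (subst ennreal_mult[symmetric]) (auto simp: mult_ac)
    finally show ?thesis by (simp add: mult_left_mono)
  qed
  have H2i: "(\<integral>\<^sup>+ x. H2 k x \<partial>\<mu>) \<le> ennreal (CK * (Cl / (1 - (1/2) powr \<tau>)) * \<alpha> k)" if k: "k \<in> S0" for k
  proof -
    let ?f = "\<lambda>x. indicator {x. 2 * r k \<le> dist k x} x * ennreal ((2 * r k / dist k x) powr \<tau> / lam k (dist k x))"
    have r2: "0 < 2 * r k" using sr(2)[OF k] by simp
    have fm: "?f \<in> borel_measurable \<mu>" by (rule tail_integrand_measurable[OF r2 sets_mu])
    have "(\<integral>\<^sup>+ x. H2 k x \<partial>\<mu>) = ennreal (CK * \<alpha> k) * (\<integral>\<^sup>+ x. ?f x \<partial>\<mu>)"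
      unfolding H2_def by (rule nn_integral_cmult[OF fm])
    also have "\<dots> \<le> ennreal (CK * \<alpha> k) * ennreal (Cl / (1 - (1/2) powr \<tau>))"
    proof (intro mult_left_mono nn_integral_tail_le r2 sets_mu tau_pos)
      fix u assume u: "2 * r k \<le> u"
      then have "0 < u" using r2 by linarith
      then have "vol k (2 * u) \<le> Cl * lam k u"
        using measure_ball_le[of "2 * u" k] lam_half[of "2 * u" k] by simp
      then show "emeasure \<mu> (ball k (2 * u)) \<le> ennreal (Cl * lam k u)"
        unfolding emeasure_ball by (rule ennreal_leI)
    qed (use Cl_ge_1 in auto)
    also have "\<dots> = ennreal (CK * (Cl / (1 - (1/2) powr \<tau>)) * \<alpha> k)"
      using CK_pos S0(2)[OF k] Cl_ge_1 half_powr_lt_1 by (subst ennreal_mult[symmetric]) (auto simp: mult_ac)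
    finally show ?thesis .
  qed
  have H3i: "(\<integral>\<^sup>+ x. H3 k x \<partial>\<mu>) \<le> ennreal ((2 * A + 4 * C22) * \<alpha> k)" if k: "k \<in> S0" for k
  proof -
    let ?E = "measure \<mu> (E k)"
    \<comment> \<open>The height of the density. At this height both terms of Kolmogorov's
      inequality are multiples of \<alpha> k: the square integral is at most w * \<alpha> k, and by
      doubling \<open>ball k (2 * r k)\<close> has measure at most 2 A times that of
      \<open>E k\<close>.\<close>
    define w where "w = \<alpha> k / ?E"
    have w: "0 < w" using S0(2)[OF k] Epos[OF k] by (simp add: w_def)
    have wE: "w * ?E = \<alpha> k" using Epos[OF k] by (simp add: w_def)
    have sq: "(\<integral>\<^sup>+ y. ennreal ((\<phi> k y)\<^sup>2) \<partial>\<mu>) \<le> ennreal (w * \<alpha> k)"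
    proof -
      have "(\<integral>\<^sup>+ y. ennreal ((\<phi> k y)\<^sup>2) \<partial>\<mu>) = (\<integral>\<^sup>+ y. ennreal w * ennreal (\<phi> k y) \<partial>\<mu>)"
        using w by (intro nn_integral_cong) (auto simp: \<phi>_def w_def[symmetric] indicator_def power2_eq_square ennreal_mult)
      also have "\<dots> = ennreal w * ennreal (\<alpha> k)"
        using bdd_supp_fun_measurable[OF \<phi>b[OF k]] \<phi>1[OF k] by (subst nn_integral_cmult) auto
      finally show ?thesis using w S0(2)[OF k] by (simp add: ennreal_mult)
    qed
    have "(\<integral>\<^sup>+ x. H3 k x \<partial>\<mu>) \<le> ennreal w * emeasure \<mu> (ball k (2 * r k)) + ennreal (4 * (C22 * (w * \<alpha> k)) / w)"
      unfolding H3_def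
    proof (rule Kolmogorov_weak_22[OF _ _ _ _ w])
      fix u :: real assume "0 < u"
      then show "emeasure \<mu> {y \<in> space \<mu>. ennreal u < tsharp (dens (\<phi> k)) y} \<le> ennreal (C22 * (w * \<alpha> k) / u\<^sup>2)"
        using tsharp_weak_22[OF \<phi>b[OF k] sq] w S0(2)[OF k] by simp
    qed (use tm[OF k] C22_nonneg w S0(2)[OF k] in auto)
    also have "\<dots> \<le> ennreal (w * (A * (2 * ?E))) + ennreal (4 * C22 * \<alpha> k)"
    proof (rule add_mono)
      have "vol k (2 * r k) \<le> vol k (16 * r k)"
        using sr(2)[OF k] by (intro measure_ball_mono') simp
      also have "\<dots> \<le> A * vol k (r k)" using sr(5)[OF k] by (simp add: dbl_def)
      also have "\<dots> \<le> A * (2 * ?E)" using E(3)[OF k] A_pos by (intro mult_left_mono) auto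
      finally have "ennreal w * emeasure \<mu> (ball k (2 * r k)) \<le> ennreal w * ennreal (A * (2 * ?E))"
        unfolding emeasure_ball by (intro mult_left_mono ennreal_leI) auto
      then show "ennreal w * emeasure \<mu> (ball k (2 * r k)) \<le> ennreal (w * (A * (2 * ?E)))"
        using w A_pos by (simp add: ennreal_mult)
    qed (use w in \<open>simp add: mult.assoc\<close>)
    also have "\<dots> = ennreal ((2 * A + 4 * C22) * \<alpha> k)"
      using w A_pos C22_nonneg S0(2)[OF k] by (subst ennreal_plus[symmetric]) (auto simp: algebra_simps wE[symmetric])
    finally show ?thesis .
  qed
  define H where "H x = (\<Sum>k\<in>S0. H1 k x + H2 k x + H3 k x)" for x
  have "H \<in> borel_measurable \<mu>" unfolding H_def[abs_def]
    by (intro borel_measurable_sum borel_measurable_add H1m H2m H3m)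
  then have Hm [measurable]: "H \<in> borel_measurable borel"
    unfolding measurable_cong_sets[OF sets_mu refl] .
  have Hi: "(\<integral>\<^sup>+ x. H x \<partial>\<mu>) \<le> ennreal (Ch * n)"
  proof -
    have "(\<integral>\<^sup>+ x. H x \<partial>\<mu>) = (\<Sum>k\<in>S0. (\<integral>\<^sup>+ x. H1 k x \<partial>\<mu>) + (\<integral>\<^sup>+ x. H2 k x \<partial>\<mu>) + (\<integral>\<^sup>+ x. H3 k x \<partial>\<mu>))"
      unfolding H_def using H1m H2m H3m by (simp add: nn_integral_sum nn_integral_add)
    also have "\<dots> \<le> (\<Sum>k\<in>S0. ennreal (Ch * \<alpha> k))"
    proof (rule sum_mono)
      fix k assume k: "k \<in> S0"
      have "(\<integral>\<^sup>+ x. H1 k x \<partial>\<mu>) + (\<integral>\<^sup>+ x. H2 k x \<partial>\<mu>) + (\<integral>\<^sup>+ x. H3 k x \<partial>\<mu>)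
        \<le> ennreal (CK * Ct * shell_const * \<alpha> k) + ennreal (CK * (Cl / (1 - (1/2) powr \<tau>)) * \<alpha> k) + ennreal ((2 * A + 4 * C22) * \<alpha> k)"
        by (intro add_mono H1i H2i H3i k)
      also have "\<dots> = ennreal (Ch * \<alpha> k)"
        using CK_pos Ct_ge_1 Cl_ge_1 shell_const_nonneg C22_nonneg A_pos half_powr_lt_1 S0(2)[OF k]
        by (simp add: ennreal_plus[symmetric] Ch_def distrib_right del: ennreal_plus)
      finally show "(\<integral>\<^sup>+ x. H1 k x \<partial>\<mu>) + (\<integral>\<^sup>+ x. H2 k x \<partial>\<mu>) + (\<integral>\<^sup>+ x. H3 k x \<partial>\<mu>) \<le> ennreal (Ch * \<alpha> k)" .
    qed
    also have "\<dots> = ennreal (Ch * n)"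
      unfolding n using Ch_nonneg S0(2) by (subst sum_ennreal) (auto simp: sum_distrib_left less_imp_le)
    finally show ?thesis .
  qed
  let ?U4 = "{x. ennreal t < H x}"
  have U4: "emeasure \<mu> ?U4 \<le> ennreal (Ch * n / t)"
  proof -
    have "ennreal t * emeasure \<mu> ?U4 = (\<integral>\<^sup>+ x. ennreal t * indicator ?U4 x \<partial>\<mu>)"
      using Hm by (intro nn_integral_cmult_indicator[symmetric]) measurable
    also have "\<dots> \<le> (\<integral>\<^sup>+ x. H x \<partial>\<mu>)" by (intro nn_integral_mono) (auto simp: indicator_def less_imp_le)
    also note Hi
    finally have "ennreal t * emeasure \<mu> ?U4 \<le> ennreal t * ennreal (Ch * n / t)"
      using t Ch_nonneg n0 by (subst ennreal_mult[symmetric]) auto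
    then show ?thesis using t by (simp add: ennreal_mult_le_mult_iff)
  qed
  have sub: "{x. ennreal (Ca * t) < tsharp \<nu> x} \<subseteq> ?U1 \<union> ?U2 \<union> ?U3 \<union> ?U4"
  proof
    fix x assume x: "x \<in> {x. ennreal (Ca * t) < tsharp \<nu> x}"
    show "x \<in> ?U1 \<union> ?U2 \<union> ?U3 \<union> ?U4"
    proof (rule ccontr)
      assume no: "x \<notin> ?U1 \<union> ?U2 \<union> ?U3 \<union> ?U4"
      then have far: "\<And>k. k \<in> S0 \<Longrightarrow> 4 * s k \<le> dist k x" and M: "maximal_le \<mu> \<nu> t x"
        and gx: "tsharp (dens g) x \<le> ennreal t" and Hx: "H x \<le> ennreal t" by (auto simp: not_less)
      have "ennreal (norm (trunc \<nu> \<rho> x)) \<le> ennreal (Ca * t)" if \<rho>: "0 < \<rho>" for \<rho>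
      proof -
        let ?\<kappa> = "\<lambda>y. kern \<rho> x y"
        have l: "0 < lam x \<rho>" by (rule lam_pos[OF \<rho>])
        define \<beta> where "\<beta> k = complex_of_real (\<alpha> k) * ?\<kappa> k - trunc (dens (\<phi> k)) \<rho> x" for k
        \<comment> \<open>The contribution of atoms whose balls may meet the truncation sphere, the
          only part of the bound that depends on \<rho>. Summed over \<open>k\<close> it is a
          multiple of \<nu>(ball x (3 \<rho>)) / lam x \<rho>, which the maximal bound
          \<open>M\<close> controls.\<close>
        define b where "b k = (if dist x k < 3 * \<rho> then 2 * CK * \<alpha> k / lam x \<rho> else 0)" for k
        have b0: "0 \<le> b k" if "k \<in> S0" for k using CK_pos l S0(2)[OF that] by (simp add: b_def)
        have \<beta>: "ennreal (norm (\<beta> k)) \<le> H1 k x + H2 k x + H3 k x + ennreal (b k)" if k: "k \<in> S0" for k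
        proof (cases "dist k x < 2 * r k")
          case True
          have d: "0 < dist k x" using far[OF k] sr(1)[OF k] by linarith
          have lk: "0 < lam k (dist k x)" "0 < lam x (dist k x)" by (intro lam_pos d)+
          have "norm (?\<kappa> k) \<le> norm (K x k)" by (auto simp: indicator_def)
          also have "\<dots> \<le> CK / lam x (dist k x)" using d by (intro order_trans[OF K_size]) (auto simp: dist_commute)
          \<comment> \<open>The kernel bound is centred at \<open>x\<close>, while \<open>H1\<close>
            has to be integrated in \<open>x\<close> and is therefore centred at \<open>k\<close>;
            \<open>lam_shift\<close> exchanges the two.\<close>
          also have "\<dots> \<le> CK * Ct / lam k (dist k x)"
          proof -
            have "lam k (dist k x) \<le> Ct * lam x (dist k x)" by (intro lam_shift d) simp
            then show ?thesis using lk CK_pos by (simp add: field_simps)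
          qed
          finally have "\<alpha> k * norm (?\<kappa> k) \<le> \<alpha> k * (CK * Ct / lam k (dist k x))"
            using S0(2)[OF k] by (intro mult_left_mono) auto
          moreover have "H1 k x = ennreal (\<alpha> k * (CK * Ct / lam k (dist k x)))"
          proof -
            have "indicator {x. 4 * s k \<le> dist k x \<and> dist k x < 16 * r k} x = (1 :: ennreal)"
              using True far[OF k] sr(2)[OF k] by simp
            then show ?thesis unfolding H1_def using CK_pos Ct_ge_1 lk S0(2)[OF k]
              by (simp add: ennreal_mult[symmetric] mult_ac)
          qed
          ultimately have le1: "ennreal (\<alpha> k * norm (?\<kappa> k)) \<le> H1 k x" by (simp add: ennreal_leI)
          have le3: "ennreal (norm (trunc (dens (\<phi> k)) \<rho> x)) \<le> H3 k x"
            unfolding H3_def using True trunc_le_tsharp[OF \<rho>] by simp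
          have "norm (\<beta> k) \<le> \<alpha> k * norm (?\<kappa> k) + norm (trunc (dens (\<phi> k)) \<rho> x)"
            unfolding \<beta>_def using norm_triangle_ineq4[of "complex_of_real (\<alpha> k) * ?\<kappa> k" "trunc (dens (\<phi> k)) \<rho> x"] S0(2)[OF k]
            by (simp only: norm_mult norm_of_real abs_of_pos)
          then have "ennreal (norm (\<beta> k)) \<le> ennreal (\<alpha> k * norm (?\<kappa> k)) + ennreal (norm (trunc (dens (\<phi> k)) \<rho> x))"
            using S0(2)[OF k] by (simp add: ennreal_plus[symmetric] ennreal_leI del: ennreal_plus)
          then have "ennreal (norm (\<beta> k)) \<le> H1 k x + H3 k x"
            by (rule order_trans) (rule add_mono[OF le1 le3])
          also have "\<dots> \<le> H1 k x + H2 k x + H3 k x + ennreal (b k)"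
            by (simp add: add.assoc add_left_mono add_increasing add_increasing2)
          finally show ?thesis .
        next
          case False
          then have d2: "2 * r k \<le> dist x k" by (simp add: dist_commute)
          have "0 < dist k x" using d2 sr(2)[OF k] unfolding dist_commute[of k x] by linarith
          then have lk: "0 < lam k (dist k x)" by (rule lam_pos)
          have "norm (\<beta> k) \<le> CK * \<alpha> k * ((2 * r k / dist k x) powr \<tau> / lam k (dist k x)) + b k"
            unfolding \<beta>_def b_def
            by (rule atom_minus_spread_le[OF \<rho> sr(2)[OF k] d2 \<phi>b[OF k] _ \<phi>1[OF k]])
               (use \<phi>E E(2)[OF k] S0(2)[OF k] in \<open>auto simp: subset_iff\<close>)
          then have "ennreal (norm (\<beta> k)) \<le> H2 k x + ennreal (b k)"
            unfolding H2_def using False CK_pos S0(2)[OF k] lk b0[OF k]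
            by (auto simp: ennreal_mult[symmetric] ennreal_plus[symmetric] simp del: ennreal_plus intro!: ennreal_leI)
          also have "\<dots> \<le> H1 k x + H2 k x + H3 k x + ennreal (b k)"
            by (intro add_right_mono) (simp add: add_increasing add_increasing2)
          finally show ?thesis .
        qed
        have "trunc \<nu> \<rho> x = (\<Sum>k\<in>S0. complex_of_real (\<alpha> k) * ?\<kappa> k)"
          unfolding trunc_def \<alpha>_def
          using integral_finite_support[OF \<nu> S0(1) AE0, of ?\<kappa>] trunc_integrand_measurable[OF \<rho> refl, of x]
          by (simp add: scaleR_conv_of_real)
        moreover have "trunc (dens g) \<rho> x = (\<Sum>k\<in>S0. trunc (dens (\<phi> k)) \<rho> x)"
          unfolding g_def[abs_def] by (intro trunc_dens_sum \<rho> S0(1) \<phi>b)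
        ultimately have "trunc \<nu> \<rho> x = trunc (dens g) \<rho> x + (\<Sum>k\<in>S0. \<beta> k)"
          by (simp add: \<beta>_def sum_subtractf)
        then have "norm (trunc \<nu> \<rho> x) \<le> norm (trunc (dens g) \<rho> x) + norm (\<Sum>k\<in>S0. \<beta> k)"
          by (simp add: norm_triangle_ineq)
        also have "\<dots> \<le> norm (trunc (dens g) \<rho> x) + (\<Sum>k\<in>S0. norm (\<beta> k))"
          by (intro add_left_mono norm_sum)
        finally have "norm (trunc \<nu> \<rho> x) \<le> norm (trunc (dens g) \<rho> x) + (\<Sum>k\<in>S0. norm (\<beta> k))" .
        then have "ennreal (norm (trunc \<nu> \<rho> x)) \<le> ennreal (norm (trunc (dens g) \<rho> x)) + (\<Sum>k\<in>S0. ennreal (norm (\<beta> k)))"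
          by (subst sum_ennreal) (auto simp: ennreal_plus[symmetric] sum_nonneg simp del: ennreal_plus intro!: ennreal_leI)
        also have "\<dots> \<le> tsharp (dens g) x + (\<Sum>k\<in>S0. H1 k x + H2 k x + H3 k x + ennreal (b k))"
          by (intro add_mono sum_mono \<beta> trunc_le_tsharp \<rho>)
        also have "\<dots> = tsharp (dens g) x + (H x + ennreal (\<Sum>k\<in>S0. b k))"
          using b0 by (simp add: H_def sum.distrib sum_ennreal)
        also have "\<dots> \<le> ennreal t + (ennreal t + ennreal (2 * CK * Cl ^ 4 * t))"
        proof (intro add_mono gx Hx ennreal_leI)
          have "(\<Sum>k\<in>S0. b k) = (\<Sum>k\<in>S0 \<inter> ball x (3 * \<rho>). 2 * CK * \<alpha> k / lam x \<rho>)"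
            using S0(1) by (simp add: b_def sum.inter_restrict if_distrib cong: if_cong)
          also have "\<dots> = 2 * CK / lam x \<rho> * measure \<nu> (ball x (3 * \<rho>))"
            by (subst \<nu>B) (auto simp: sum_distrib_left)
          also have "\<dots> \<le> 2 * CK / lam x \<rho> * (t * (Cl ^ 4 * lam x \<rho>))"
          proof (intro mult_left_mono)
            \<comment> \<open>The exponent 4 in \<open>Ca\<close> arises here, from 9 \<rho> \<le>
              2^4 \<rho>.\<close>
            have "measure \<nu> (ball x (3 * \<rho>)) \<le> t * vol x (3 * (3 * \<rho>))"
              using \<rho> by (intro maximal_leD[OF M]) simp
            also have "\<dots> \<le> t * (Cl ^ 4 * lam x \<rho>)"
              using \<rho> t measure_ball_le[of "3 * (3 * \<rho>)" x] lam_le[of \<rho> "3 * (3 * \<rho>)" 4 x]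
              by (intro mult_left_mono) auto
            finally show "measure \<nu> (ball x (3 * \<rho>)) \<le> t * (Cl ^ 4 * lam x \<rho>)" .
          qed (use CK_pos l in simp)
          also have "\<dots> = 2 * CK * Cl ^ 4 * t" using l by simp
          finally show "(\<Sum>k\<in>S0. b k) \<le> 2 * CK * Cl ^ 4 * t" .
        qed
        also have "\<dots> = ennreal (Ca * t)"
          unfolding Ca_def using t CK_pos Cl_ge_1
          by (simp add: ennreal_plus[symmetric] distrib_right del: ennreal_plus)
        finally show ?thesis .
      qed
      then have "tsharp \<nu> x \<le> ennreal (Ca * t)" unfolding tsharp_def by (intro SUP_least) auto
      then show False using x by (simp add: not_less[symmetric])
    qed
  qed
  have m3: "?U3 \<in> sets \<mu>"
    using tsharp_measurable[OF bdd_supp_fun_finite_measure[OF gb]] by simp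
  have m4: "?U4 \<in> sets \<mu>" using Hm by measurable
  have m1: "?U1 \<in> sets \<mu>" by (simp add: borel_open open_UN)
  have m2: "?U2 \<in> sets \<mu>" using not_maximal_le_sets by simp
  have "emeasure \<mu> {x. ennreal (Ca * t) < tsharp \<nu> x} \<le> emeasure \<mu> (?U1 \<union> ?U2 \<union> ?U3 \<union> ?U4)"
    using m1 m2 m3 m4 by (intro emeasure_mono sub) auto
  also have "\<dots> \<le> emeasure \<mu> ?U1 + emeasure \<mu> ?U2 + emeasure \<mu> ?U3 + emeasure \<mu> ?U4"
    using m1 m2 m3 m4
    by (intro order_trans[OF emeasure_subadditive] add_right_mono order_trans[OF emeasure_subadditive] emeasure_subadditive) auto
  also have "\<dots> \<le> ennreal (n / t) + ennreal (n / t) + ennreal (4 * A * C22 * n / t) + ennreal (Ch * n / t)"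
    by (intro add_mono U1 U2 U3 U4)
  also have "\<dots> = ennreal (C11 / Ca * n / t)"
    using t n0 A_pos C22_nonneg Ch_nonneg Ca_pos
    by (simp add: ennreal_plus[symmetric] C11_def add_divide_distrib distrib_right del: ennreal_plus)
  finally show ?thesis by (simp add: n_def)
qed

end

subsection \<open>Weak type (1,1) for finite measures\<close>

context cz_kernel
begin

lemma K_tendsto:
  assumes "X \<longlonglongrightarrow> y" "x \<noteq> y"
  shows "(\<lambda>n. K x (X n)) \<longlonglongrightarrow> K x y"
proof -
  have "(\<lambda>n. (x, X n)) \<longlonglongrightarrow> (x, y)" by (intro tendsto_intros assms(1))
  from isCont_tendsto_compose[OF K_isCont[OF assms(2)] this] show ?thesis by simp
qed

text \<open>The truncated kernel jumps only across the sphere of radius \<open>r\<close>, so its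
  values converge off a \<nu>-null set; a constant, integrable as \<nu> is finite,
  dominates.\<close>

lemma trunc_distr_tendsto:
  assumes r: "0 < r" and \<nu>: "finite_measure \<nu>" "sets \<nu> = sets borel"
    and F: "\<And>i. F i \<in> borel_measurable borel" "\<And>y. (\<lambda>i. F i y) \<longlonglongrightarrow> y"
    and sphere: "measure \<nu> {y. dist x y = r} = 0"
  shows "(\<lambda>i. trunc (distr \<nu> borel (F i)) r x) \<longlonglongrightarrow> trunc \<nu> r x"
proof -
  interpret finite_measure \<nu> by fact
  let ?\<kappa> = "\<lambda>y. kern r x y"
  have km: "?\<kappa> \<in> borel_measurable borel" by (rule trunc_integrand_measurable[OF r refl])
  have Fm: "F i \<in> measurable \<nu> borel" for i
    using F(1)[of i] unfolding measurable_cong_sets[OF \<nu>(2) refl] .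
  have eq: "trunc (distr \<nu> borel (F i)) r x = (\<integral>y. ?\<kappa> (F i y) \<partial>\<nu>)" for i
    unfolding trunc_def by (rule integral_distr[OF Fm km])
  have ms: "{y. dist x y = r} \<in> sets \<nu>" unfolding \<nu>(2)
    by (intro borel_closed closed_Collect_eq continuous_intros)
  have AEs: "AE y in \<nu>. dist x y \<noteq> r"
    using ms sphere by (intro AE_I[of _ _ "{y. dist x y = r}"]) (auto simp: emeasure_eq_measure)
  show ?thesis unfolding eq unfolding trunc_def
  proof (rule integral_dominated_convergence[where w = "\<lambda>_. CK / lam x r"])
    show "AE y in \<nu>. (\<lambda>i. ?\<kappa> (F i y)) \<longlonglongrightarrow> ?\<kappa> y"
      using AEs
    proof eventually_elim
      case (elim y)
      have d: "(\<lambda>i. dist x (F i y)) \<longlonglongrightarrow> dist x y" by (intro tendsto_intros F(2))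
      show ?case
      proof (cases "r < dist x y")
        case True
        then have "x \<noteq> y" using r by auto
        have "\<forall>\<^sub>F i in sequentially. r < dist x (F i y)" using order_tendstoD(1)[OF d True] .
        then have "\<forall>\<^sub>F i in sequentially. K x (F i y) = ?\<kappa> (F i y)" by eventually_elim simp
        then have "(\<lambda>i. ?\<kappa> (F i y)) \<longlonglongrightarrow> K x y"
          by (rule Lim_transform_eventually[OF K_tendsto[OF F(2) \<open>x \<noteq> y\<close>]])
        then show ?thesis using True by simp
      next
        case False
        then have "dist x y < r" using elim by simp
        then have "\<forall>\<^sub>F i in sequentially. dist x (F i y) < r" by (rule order_tendstoD(2)[OF d])
        then have "\<forall>\<^sub>F i in sequentially. ?\<kappa> (F i y) = 0" by eventually_elim simp
        then show ?thesis using False by (simp add: tendsto_eventually)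
      qed
    qed
    fix i show "AE y in \<nu>. norm (?\<kappa> (F i y)) \<le> CK / lam x r"
      using trunc_integrand_bound[OF r] by simp
    show "(\<lambda>y. ?\<kappa> (F i y)) \<in> borel_measurable \<nu>" by (rule measurable_compose[OF Fm km])
  qed (use trunc_integrand_measurable[OF r \<nu>(2)] in auto)
qed

text \<open>Only countably many spheres around \<open>x\<close> carry mass, so a radius without mass can be chosen.\<close>

lemma tsharp_gtE:
  assumes \<nu>: "finite_measure \<nu>" "sets \<nu> = sets borel" and u: "ennreal u < tsharp \<nu> x" "0 \<le> u"
  obtains r where "0 < r" "u < norm (trunc \<nu> r x)" "measure \<nu> {y. dist x y = r} = 0"
proof -
  interpret finite_measure \<nu> by fact
  obtain r where r: "0 < r" "u < norm (trunc \<nu> r x)"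
    using u unfolding tsharp_def less_SUP_iff by (auto simp: ennreal_less_iff)
  let ?D = "distr \<nu> borel (dist x)"
  have dm: "dist x \<in> measurable \<nu> borel"
    unfolding measurable_cong_sets[OF \<nu>(2) refl] by measurable
  interpret D: finite_measure ?D by (rule finite_measure_distr[OF dm])
  have sph: "measure ?D {s} = measure \<nu> {y. dist x y = s}" for s
    using dm sets_eq_imp_space_eq[OF \<nu>(2)] by (subst measure_distr) (auto simp: vimage_def)
  have cnt: "countable {s. measure \<nu> {y. dist x y = s} \<noteq> 0}"
    using D.countable_support by (simp add: sph)
  have "\<exists>s. r < s \<and> s < r + 1 / Suc n \<and> measure \<nu> {y. dist x y = s} = 0" for n
  proof (rule ccontr)
    assume "\<not> ?thesis"
    then have "{r<..<r + 1 / Suc n} \<subseteq> {s. measure \<nu> {y. dist x y = s} \<noteq> 0}" by auto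
    then have "countable {r<..<r + 1 / Suc n}" using cnt countable_subset by blast
    then show False using uncountable_open_interval[of r "r + 1 / Suc n"] by simp
  qed
  then obtain X where X: "\<And>n. r < X n" "\<And>n. X n < r + 1 / Suc n" "\<And>n. measure \<nu> {y. dist x y = X n} = 0" by metis
  have "(\<lambda>n. r + 1 / Suc n) \<longlonglongrightarrow> r + 0"
    by (intro tendsto_add tendsto_const LIMSEQ_Suc[OF lim_1_over_n])
  then have "X \<longlonglongrightarrow> r"
    using X by (intro tendsto_sandwich[OF _ _ tendsto_const, of r X sequentially "\<lambda>n. r + 1 / Suc n"]) (auto intro!: always_eventually less_imp_le)
  then have "(\<lambda>n. norm (trunc \<nu> (X n) x)) \<longlonglongrightarrow> norm (trunc \<nu> r x)"
    by (intro tendsto_norm trunc_tendsto_right r \<nu> less_imp_le[OF X(1)])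
  then have "\<forall>\<^sub>F n in sequentially. u < norm (trunc \<nu> (X n) x)"
    using r(2) by (rule order_tendstoD(1))
  then obtain n where "u < norm (trunc \<nu> (X n) x)" using eventually_happens sequentially_bot by blast
  then show ?thesis using that[of "X n"] X(1)[of n] X(3)[of n] r(1) by simp
qed

end

context cz_operator
begin

text \<open>Simple functions converging pointwise to the identity push \<nu> forward to measures of
  finite support and the same mass. A strict inequality at a radius whose sphere is null persists
  for almost all indices, so the level set lies in the lower limit of the level sets of the
  approximants, which inherits their common bound.\<close>

theorem weak_11:
  assumes \<nu>: "finite_measure \<nu>" "sets \<nu> = sets borel" and u: "0 < u"
  shows "emeasure \<mu> {x. ennreal u < tsharp \<nu> x} \<le> ennreal (C11 * measure \<nu> UNIV / u)"
proof -
  interpret finite_measure \<nu> by fact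
  have idm: "(\<lambda>y::'a. y) \<in> borel_measurable borel" by simp
  obtain F :: "nat \<Rightarrow> 'a \<Rightarrow> 'a" where F: "\<And>i. simple_function borel (F i)" "\<And>y. (\<lambda>i. F i y) \<longlonglongrightarrow> y"
    using borel_measurable_implies_sequence_metric[OF idm, of undefined] by auto
  have Fm: "F i \<in> borel_measurable borel" for i by (rule borel_measurable_simple_function[OF F(1)])
  have Fm': "F i \<in> measurable \<nu> borel" for i
    using Fm[of i] unfolding measurable_cong_sets[OF \<nu>(2) refl] .
  let ?\<nu> = "\<lambda>i. distr \<nu> borel (F i)"
  have fin: "finite_measure (?\<nu> i)" for i by (rule finite_measure_distr[OF Fm'])
  have mass: "measure (?\<nu> i) UNIV = measure \<nu> UNIV" for i
    using Fm'[of i] sets_eq_imp_space_eq[OF \<nu>(2)] by (subst measure_distr) auto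
  let ?U = "\<lambda>i. {x. ennreal u < tsharp (?\<nu> i) x}"
  have Um: "?U i \<in> sets \<mu>" for i using tsharp_measurable[OF fin[of i]] by simp
  have Ui: "emeasure \<mu> (?U i) \<le> ennreal (C11 * measure \<nu> UNIV / u)" for i
  proof -
    have fr: "finite (range (F i))" using simple_functionD(1)[OF F(1)[of i]] by simp
    have ae: "AE y in ?\<nu> i. y \<in> range (F i)"
      using fr by (subst AE_distr_iff[OF Fm']) (auto intro!: borel_closed finite_imp_closed)
    have "0 < u / Ca" using u Ca_pos by simp
    from weak_11_atomic[OF fin _ fr ae this] show ?thesis
      using Ca_pos by (simp add: mass)
  qed
  let ?V = "\<lambda>m. \<Inter>i\<in>{m..}. ?U i"
  have Vm: "?V m \<in> sets \<mu>" for m using Um by (intro sets.countable_INT'') auto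
  have "{x. ennreal u < tsharp \<nu> x} \<subseteq> (\<Union>m. ?V m)"
  proof
    fix x assume "x \<in> {x. ennreal u < tsharp \<nu> x}"
    then obtain r where r: "0 < r" "u < norm (trunc \<nu> r x)" "measure \<nu> {y. dist x y = r} = 0"
      using tsharp_gtE[OF \<nu>] u by (metis less_imp_le mem_Collect_eq)
    have "(\<lambda>i. norm (trunc (?\<nu> i) r x)) \<longlonglongrightarrow> norm (trunc \<nu> r x)"
      by (intro tendsto_norm trunc_distr_tendsto r(1) \<nu> Fm F(2) r(3))
    then have "\<forall>\<^sub>F i in sequentially. u < norm (trunc (?\<nu> i) r x)"
      using r(2) by (rule order_tendstoD(1))
    then obtain m where m: "\<And>i. m \<le> i \<Longrightarrow> u < norm (trunc (?\<nu> i) r x)" by (auto simp: eventually_sequentially)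
    have "ennreal u < tsharp (?\<nu> i) x" if "m \<le> i" for i
    proof -
      have "ennreal u < ennreal (norm (trunc (?\<nu> i) r x))" using m[OF that] u by (simp add: ennreal_less_iff)
      also have "\<dots> \<le> tsharp (?\<nu> i) x" by (rule trunc_le_tsharp[OF r(1)])
      finally show ?thesis .
    qed
    then show "x \<in> (\<Union>m. ?V m)" by auto
  qed
  then have "emeasure \<mu> {x. ennreal u < tsharp \<nu> x} \<le> emeasure \<mu> (\<Union>m. ?V m)"
    using Vm by (intro emeasure_mono) auto
  also have "\<dots> = (SUP m. emeasure \<mu> (?V m))"
  proof (rule SUP_emeasure_incseq[symmetric])
    show "incseq ?V" unfolding incseq_def by fastforce
  qed (use Vm in auto)
  also have "\<dots> \<le> ennreal (C11 * measure \<nu> UNIV / u)"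
  proof (rule SUP_least)
    fix m
    have "emeasure \<mu> (?V m) \<le> emeasure \<mu> (?U m)" using Um by (intro emeasure_mono) auto
    then show "emeasure \<mu> (?V m) \<le> ennreal (C11 * measure \<nu> UNIV / u)" using Ui order_trans by blast
  qed
  finally show ?thesis .
qed

subsection \<open>Small doubling balls and the good-\<open>\<lambda>\<close> inequality\<close>

lemma cover_ball:
  assumes "0 < r"
  shows "\<exists>S. finite S \<and> card S \<le> N ^ m \<and> ball (x :: 'a) r \<subseteq> (\<Union>y\<in>S. ball y (r / 2 ^ m))"
proof (induction m)
  case 0
  show ?case by (intro exI[of _ "{x}"]) auto
next
  case (Suc m)
  then obtain S where S: "finite S" "card S \<le> N ^ m" "ball x r \<subseteq> (\<Union>y\<in>S. ball y (r / 2 ^ m))" by blast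
  have "\<exists>Q. finite Q \<and> card Q \<le> N \<and> ball y (r / 2 ^ m) \<subseteq> (\<Union>z\<in>Q. ball z (r / 2 ^ m / 2))" for y :: 'a
    using assms by (intro geometric) simp
  then obtain Q where Q: "\<And>y :: 'a. finite (Q y)" "\<And>y. card (Q y) \<le> N"
      "\<And>y. ball y (r / 2 ^ m) \<subseteq> (\<Union>z\<in>Q y. ball z (r / 2 ^ m / 2))" by metis
  have "card (\<Union>y\<in>S. Q y) \<le> (\<Sum>y\<in>S. card (Q y))" by (rule card_UN_le[OF S(1)])
  also have "\<dots> \<le> card S * N" using sum_bounded_above[of S "\<lambda>y. card (Q y)" N] Q(2) by simp
  also have "\<dots> \<le> N ^ m * N" using S(2) by (intro mult_right_mono) auto
  finally have "card (\<Union>y\<in>S. Q y) \<le> N ^ Suc m" by (simp add: mult.commute)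
  moreover have "ball x r \<subseteq> (\<Union>y\<in>(\<Union>y\<in>S. Q y). ball y (r / 2 ^ Suc m))"
    using S(3) Q(3) by (fastforce simp: mult.commute subset_iff)
  ultimately show ?case using S(1) Q(1) by (intro exI[of _ "\<Union>y\<in>S. Q y"]) auto
qed

lemma not_dbl_downward:
  assumes "\<And>l. \<not> dbl z (R / 16 ^ l)"
  shows "A ^ l * vol z (R / 16 ^ l) \<le> vol z R"
proof (induction l)
  case (Suc l)
  have "A ^ Suc l * vol z (R / 16 ^ Suc l) = A ^ l * (A * vol z (R / 16 ^ Suc l))" by simp
  also have "\<dots> \<le> A ^ l * vol z (R / 16 ^ l)"
    using assms[of "Suc l"] A_pos by (intro mult_left_mono) (auto simp: dbl_def)
  finally show ?case using Suc by simp
qed simp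

text \<open>A point with no doubling radius R / 16^l has balls whose volume shrinks at least like
  A^(-l), whereas the number of balls of that size needed to cover a fixed ball grows like N^(4 l)
  \<le> (A/2)^l. Hence such points have covers of measure of order 2^(-l).\<close>

lemma AE_dbl_scale:
  assumes R: "0 < R"
  shows "AE x in \<mu>. \<exists>l. dbl x (R / 16 ^ l)"
proof -
  define Z where "Z = {x. \<forall>l. \<not> dbl x (R / 16 ^ l)}"
  have null: "\<exists>W\<in>null_sets \<mu>. Z \<inter> ball x0 (2 ^ m * R) \<subseteq> W" for x0 :: 'a and m :: nat
  proof -
    define M0 where "M0 = vol x0 ((2 ^ m + 1) * R)"
    have cov: "\<exists>S. finite S \<and> card S \<le> N ^ (m + (4 * l + 1)) \<and> ball x0 (2 ^ m * R) \<subseteq> (\<Union>y\<in>S. ball y (R / (2 * 16 ^ l)))" for l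
    proof -
      have "2 ^ m * R / 2 ^ (m + (4 * l + 1)) = R / (2 * 16 ^ l)"
        by (simp add: power_add power_mult)
      then show ?thesis using cover_ball[of "2 ^ m * R" "m + (4 * l + 1)" x0] R by simp
    qed
    then obtain S where S: "\<And>l. finite (S l)" "\<And>l. card (S l) \<le> N ^ (m + (4 * l + 1))"
      "\<And>l. ball x0 (2 ^ m * R) \<subseteq> (\<Union>y\<in>S l. ball y (R / (2 * 16 ^ l)))" by metis
    \<comment> \<open>Only balls that meet \<open>Z\<close> are kept. They have half the radius R /
      16^l, so each lies in the ball of that radius around a point of \<open>Z\<close>, whose volume
      is known to be small.\<close>
    define S' where "S' l = {y\<in>S l. Z \<inter> ball x0 (2 ^ m * R) \<inter> ball y (R / (2 * 16 ^ l)) \<noteq> {}}" for l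
    define U where "U l = (\<Union>y\<in>S' l. ball y (R / (2 * 16 ^ l)))" for l
    have Um: "U l \<in> sets \<mu>" for l unfolding U_def by (simp add: borel_open open_UN)
    have sub: "Z \<inter> ball x0 (2 ^ m * R) \<subseteq> U l" for l
      using S(3)[of l] unfolding U_def S'_def by blast
    have Ul: "emeasure \<mu> (U l) \<le> ennreal (real N ^ (m + 1) * M0 * (1/2) ^ l)" for l
    proof -
      have each: "emeasure \<mu> (ball y (R / (2 * 16 ^ l))) \<le> ennreal (M0 / A ^ l)" if y: "y \<in> S' l" for y
      proof -
        obtain z where z: "z \<in> Z" "dist x0 z < 2 ^ m * R" "dist y z < R / (2 * 16 ^ l)"
          using y unfolding S'_def by auto
        have "vol y (R / (2 * 16 ^ l)) \<le> vol z (R / 16 ^ l)"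
        proof (intro measure_ball_mono subsetI)
          fix w assume "w \<in> ball y (R / (2 * 16 ^ l))"
          then have "dist y w < R / (2 * 16 ^ l)" by simp
          moreover have "dist z w \<le> dist y z + dist y w" using dist_triangle[of z w y] by (simp add: dist_commute)
          moreover have "R / 16 ^ l = R / (2 * 16 ^ l) + R / (2 * 16 ^ l)" by simp
          ultimately show "w \<in> ball z (R / 16 ^ l)" using z(3) by simp
        qed
        moreover have "vol z R \<le> M0"
          unfolding M0_def
        proof (intro measure_ball_mono subsetI)
          fix w assume "w \<in> ball z R"
          then show "w \<in> ball x0 ((2 ^ m + 1) * R)"
            using z(2) dist_triangle[of x0 w z] by (simp add: distrib_right)
        qed
        moreover have "A ^ l * vol z (R / 16 ^ l) \<le> vol z R"
          using z(1) by (intro not_dbl_downward) (auto simp: Z_def)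
        ultimately have "vol y (R / (2 * 16 ^ l)) \<le> M0 / A ^ l"
          using A_pos by (smt (verit, best) pos_le_divide_eq mult.commute zero_less_power)
        then show ?thesis unfolding emeasure_ball by (rule ennreal_leI)
      qed
      have fS': "finite (S' l)" using S(1) by (simp add: S'_def)
      have cS': "card (S' l) \<le> N ^ (m + (4 * l + 1))"
        by (rule order_trans[OF card_mono[OF S(1)] S(2)]) (auto simp: S'_def)
      have "emeasure \<mu> (U l) \<le> (\<Sum>y\<in>S' l. emeasure \<mu> (ball y (R / (2 * 16 ^ l))))"
        unfolding U_def by (intro emeasure_subadditive_finite fS') auto
      also have "\<dots> \<le> (\<Sum>y\<in>S' l. ennreal (M0 / A ^ l))" by (intro sum_mono each)
      also have "\<dots> = ennreal (real (card (S' l)) * (M0 / A ^ l))"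
        using A_pos by (subst sum_ennreal) (auto simp: M0_def)
      also have "\<dots> \<le> ennreal (real N ^ (m + 1) * M0 * (1/2) ^ l)"
      proof (intro ennreal_leI)
        have "real (card (S' l)) * (M0 / A ^ l) \<le> real N ^ (m + (4 * l + 1)) * (M0 / A ^ l)"
          using of_nat_mono[OF cS', where 'a = real] A_pos
          by (intro mult_right_mono) (simp_all only: of_nat_power, simp add: M0_def)
        also have "\<dots> = real N ^ (m + 1) * M0 * (real N ^ 4 / A) ^ l"
          by (simp add: power_add power_mult power_divide)
        also have "\<dots> \<le> real N ^ (m + 1) * M0 * (1/2) ^ l"
          using N_A A_pos by (intro mult_left_mono power_mono) (auto simp: M0_def field_simps)
        finally show "real (card (S' l)) * (M0 / A ^ l) \<le> real N ^ (m + 1) * M0 * (1/2) ^ l" .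
      qed
      finally show ?thesis .
    qed
    have "emeasure \<mu> (\<Inter>l. U l) \<le> 0"
    proof (rule LIMSEQ_le_const)
      have "(\<lambda>l. real N ^ (m + 1) * M0 * (1/2) ^ l) \<longlonglongrightarrow> real N ^ (m + 1) * M0 * 0"
        by (intro tendsto_mult tendsto_const LIMSEQ_power_zero) auto
      then show "(\<lambda>l. ennreal (real N ^ (m + 1) * M0 * (1/2) ^ l)) \<longlonglongrightarrow> 0"
        using tendsto_ennrealI by fastforce
      have "emeasure \<mu> (\<Inter>l. U l) \<le> ennreal (real N ^ (m + 1) * M0 * (1/2) ^ l)" for l
        by (rule order_trans[OF emeasure_mono[OF _ Um] Ul]) auto
      then show "\<exists>n. \<forall>l\<ge>n. emeasure \<mu> (\<Inter>l. U l) \<le> ennreal (real N ^ (m + 1) * M0 * (1/2) ^ l)" by blast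
    qed
    then have "(\<Inter>l. U l) \<in> null_sets \<mu>" using Um by (auto simp: null_sets_def)
    then show ?thesis using sub by (intro bexI[of _ "\<Inter>l. U l"]) auto
  qed
  then obtain W where W: "\<And>m. W m \<in> null_sets \<mu>" "\<And>m. Z \<inter> ball undefined (2 ^ m * R) \<subseteq> W m" by metis
  have "(\<Union>m. W m) \<in> null_sets \<mu>" using W(1) by (rule null_sets_UN)
  moreover have "{x \<in> space \<mu>. \<not> (\<exists>l. dbl x (R / 16 ^ l))} \<subseteq> (\<Union>m. W m)"
  proof
    fix x assume "x \<in> {x \<in> space \<mu>. \<not> (\<exists>l. dbl x (R / 16 ^ l))}"
    then have x: "x \<in> Z" by (simp add: Z_def)
    obtain m where "dist undefined x / R < 2 ^ m" using real_arch_pow[of 2] by auto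
    then have "x \<in> ball undefined (2 ^ m * R)" using R by (simp add: field_simps)
    then show "x \<in> (\<Union>m. W m)" using x W(2)[of m] by blast
  qed
  ultimately show ?thesis by (rule AE_I')
qed

text \<open>The scale from which the descent starts in \<open>good_lambda\<close> varies with the
  point. Restricting it to integer powers of 16 leaves countably many null sets.\<close>

lemma AE_dbl: "AE x in \<mu>. \<forall>i::int. \<exists>l. dbl x (16 powi i / 16 ^ l)"
  by (subst AE_all_countable) (auto intro!: AE_dbl_scale)

section \<open>Truncations on small doubling balls\<close>

definition C2 :: real where "C2 = CK * (2 * Cl ^ 6 + 4 * Cl ^ 8) + Cc"

lemma C2_nonneg: "0 \<le> C2"
  unfolding C2_def using CK_pos Cl_ge_1 Cc_nonneg by simp

text \<open>Lowering the truncation radius from 32 R to \<open>r\<close> crosses at most one annulus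
  above the doubling radius R / 16^l, a chain of non-doubling scales, and one annulus above 16 R;
  each costs a multiple of \<open>m\<close>.\<close>

lemma trunc_above_dbl_le:
  assumes \<nu>: "finite_measure \<nu>" "sets \<nu> = sets borel" and M: "maximal_le \<mu> \<nu> m x" and m: "0 \<le> m"
    and R: "0 < R" and big: "\<And>r. 32 * R \<le> r \<Longrightarrow> norm (trunc \<nu> r x) \<le> t + Cc * m"
    and nd: "\<And>j. j < l \<Longrightarrow> \<not> dbl x (R / 16 ^ j)" and r: "4 * (R / 16 ^ l) \<le> r"
  shows "norm (trunc \<nu> r x) \<le> t + C2 * m"
proof (cases "32 * R \<le> r")
  case True
  have "Cc * m \<le> C2 * m" using m CK_pos Cl_ge_1 by (intro mult_right_mono) (auto simp: C2_def)
  then show ?thesis using big[OF True] by linarith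
next
  case False
  define \<rho> where "\<rho> = R / 16 ^ l"
  have \<rho>: "0 < \<rho>" "16 ^ l * (16 * \<rho>) = 16 * R" using R by (auto simp: \<rho>_def)
  have r0: "0 < r" "\<rho> \<le> r" using r \<rho> unfolding \<rho>_def[symmetric] by linarith+
  have nd': "\<not> dbl x (16 ^ i * (16 * \<rho>))" if "i < l" for i
  proof -
    have e: "l = (l - Suc i) + Suc i" using that by simp
    have "16 ^ i * (16 * \<rho>) = R / 16 ^ (l - Suc i)"
      unfolding \<rho>_def by (subst e, simp only: power_add) (simp add: field_simps)
    then show ?thesis using nd[of "l - Suc i"] that by simp
  qed
  have e3: "\<And>u. 0 < u \<Longrightarrow> emeasure \<nu> (ball x u) \<le> ennreal (m * vol x (3 * u))"
    by (rule maximal_le_emeasure_ball[OF M \<nu>(1)])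
  have "shell \<nu> x r (16 * (16 * R)) \<le> shell \<nu> x \<rho> (16 * (16 * R))"
    using r0 by (intro shell_mono) auto
  also have "\<dots> \<le> shell \<nu> x \<rho> (16 * \<rho>) + shell \<nu> x (16 * \<rho>) (16 * (16 * R))"
    using \<rho> by (intro shell_split \<nu>) auto
  also have "\<dots> \<le> shell \<nu> x \<rho> (16 * \<rho>) + (shell \<nu> x (16 * \<rho>) (16 ^ l * (16 * \<rho>)) + shell \<nu> x (16 * R) (16 * (16 * R)))"
    unfolding \<rho>(2) using \<rho>(1) R by (intro add_left_mono shell_split \<nu>) auto
  also have "\<dots> \<le> ennreal (m * Cl ^ 6) + (ennreal (m * (4 * Cl ^ 8)) + ennreal (m * Cl ^ 6))"
    by (intro add_mono shell_16 shell_chain e3 \<nu>(2) m nd') (use \<rho> R in auto)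
  also have "\<dots> = ennreal (m * (2 * Cl ^ 6 + 4 * Cl ^ 8))"
    using m Cl_ge_1 by (simp add: ennreal_plus[symmetric] distrib_left del: ennreal_plus)
  finally have "norm (trunc \<nu> r x - trunc \<nu> (32 * R) x) \<le> CK * (m * (2 * Cl ^ 6 + 4 * Cl ^ 8))"
    using False R m Cl_ge_1 by (intro trunc_diff_le[OF r0(1), where b = "16 * (16 * R)"] \<nu>) auto
  moreover have "norm (trunc \<nu> r x) \<le> norm (trunc \<nu> r x - trunc \<nu> (32 * R) x) + norm (trunc \<nu> (32 * R) x)"
    by (metis diff_add_cancel norm_triangle_ineq)
  ultimately have "norm (trunc \<nu> r x) \<le> CK * (m * (2 * Cl ^ 6 + 4 * Cl ^ 8)) + (t + Cc * m)"
    using big[of "32 * R"] by linarith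
  then show ?thesis by (simp add: C2_def algebra_simps)
qed

text \<open>On the ball the part of \<open>f\<close> far from \<open>x\<close> keeps its truncations
  below (1 + \<epsilon>/2) t by the change of centre. By doubling the near part has mass at most
  \<delta> t A vol x \<rho>, so weak type (1,1) lets it exceed \<epsilon> t / 2 on at most half of
  the ball. The two smallness conditions on \<delta> are made for these two estimates.\<close>

lemma good_dbl_ball:
  assumes f: "bdd_supp_fun f" and M: "maximal_le \<mu> (dens f) (\<delta> * t) x" and t: "0 < t" and \<delta>: "0 < \<delta>"
    and \<epsilon>: "0 < \<epsilon>" "(C2 + Cc) * \<delta> \<le> \<epsilon> / 2" "4 * C11 * A * \<delta> \<le> \<epsilon>"
    and \<rho>: "0 < \<rho>" "dbl x \<rho>"
    and tr: "\<And>r. 4 * \<rho> \<le> r \<Longrightarrow> norm (trunc (dens f) r x) \<le> t + C2 * (\<delta> * t)"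
  shows "vol x \<rho> \<le> 2 * measure \<mu> (ball x \<rho> \<inter> {y. tsharp (dens f) y \<le> ennreal ((1 + \<epsilon>) * t)})"
proof -
  note fm = bdd_supp_fun_measurable[OF f] and f0 = bdd_supp_fun_nonneg[OF f]
  note fin = bdd_supp_fun_finite_measure[OF f]
  define f1 where "f1 = (\<lambda>y. f y * indicator (cball x (4 * \<rho>)) y)"
  define f2 where "f2 = (\<lambda>y. f y * indicator (- cball x (4 * \<rho>)) y)"
  have n1: "bdd_supp_fun f1" and n2: "bdd_supp_fun f2"
    unfolding f1_def f2_def by (intro bdd_supp_fun_mult_indicator f; simp)+
  note f1m = bdd_supp_fun_measurable[OF n1] and f2m = bdd_supp_fun_measurable[OF n2] and f20 = bdd_supp_fun_nonneg[OF n2]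
  define m where "m = \<delta> * t"
  have m: "0 < m" using \<delta> t by (simp add: m_def)
  have M2: "maximal_le \<mu> (dens f2) m x"
    by (rule maximal_le_mono_dens[OF f2m fm _ fin M[folded m_def]]) (auto simp: f2_def indicator_def f0)
  \<comment> \<open>\<open>f2\<close> vanishes within 4 \<rho> of \<open>x\<close>. Hence
    truncations of it at \<open>y\<close> below radius 2 \<rho> agree with the one at 2 \<rho>, and
    from 2 \<rho> on the displacement is at most half the radius.\<close>
  have far: "tsharp (dens f2) y \<le> ennreal (t + (C2 + Cc) * m)" if y: "dist x y < \<rho>" for y
  proof -
    have ge: "norm (trunc (dens f2) r y) \<le> t + (C2 + Cc) * m" if r: "2 * \<rho> \<le> r" for r
    proof -
      have "trunc (dens f2) r x = (\<integral>y. kern r x y * complex_of_real (f2 y) \<partial>\<mu>)"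
        using \<rho> r by (intro trunc_dens f2m f20) auto
      also have "\<dots> = (\<integral>y. kern (max r (4 * \<rho>)) x y * complex_of_real (f y) \<partial>\<mu>)"
        by (intro Bochner_Integration.integral_cong) (auto simp: f2_def indicator_def)
      also have "\<dots> = trunc (dens f) (max r (4 * \<rho>)) x"
        using \<rho> by (intro trunc_dens[symmetric] fm f0) auto
      finally have "norm (trunc (dens f2) r x) \<le> t + C2 * m"
        using tr[of "max r (4 * \<rho>)"] by (simp add: m_def)
      moreover have "norm (trunc (dens f2) r x - trunc (dens f2) r y) \<le> Cc * m"
        using \<rho> r y m by (intro trunc_diff_center_le M2 bdd_supp_fun_finite_measure n2 sets_dens) auto
      moreover have "norm (trunc (dens f2) r y) \<le> norm (trunc (dens f2) r x) + norm (trunc (dens f2) r x - trunc (dens f2) r y)"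
        by (metis add.commute diff_add_cancel norm_minus_commute norm_triangle_ineq)
      ultimately show ?thesis by (simp add: algebra_simps)
    qed
    have "norm (trunc (dens f2) r y) \<le> t + (C2 + Cc) * m" if r: "0 < r" for r
    proof (cases "2 * \<rho> \<le> r")
      case False
      have "2 * \<rho> < dist y z" if "f2 z \<noteq> 0" for z
      proof -
        have "4 * \<rho> < dist x z" using that by (auto simp: f2_def indicator_def split: if_splits)
        then show ?thesis using y dist_triangle[of x z y] \<rho>(1) by linarith
      qed
      then have "trunc (dens f2) r y = trunc (dens f2) (2 * \<rho>) y"
        using False \<rho> r unfolding trunc_dens[OF r f2m f20]
        by (subst trunc_dens) (force intro!: Bochner_Integration.integral_cong simp: f2m f20 indicator_def)+
      then show ?thesis using ge[of "2 * \<rho>"] by simp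
    qed (rule ge)
    then show ?thesis unfolding tsharp_def by (intro SUP_least ennreal_leI) auto
  qed
  have "trunc (dens f) r y = trunc (dens f1) r y + trunc (dens f2) r y" if r: "0 < r" for r y
  proof -
    have "trunc (dens f) r y = (\<integral>z. kern r y z * complex_of_real (f1 z) + kern r y z * complex_of_real (f2 z) \<partial>\<mu>)"
      unfolding trunc_dens[OF r fm f0]
      by (intro Bochner_Integration.integral_cong) (auto simp: f1_def f2_def indicator_def)
    then show ?thesis
      using trunc_dens_integrable[OF r n1] trunc_dens_integrable[OF r n2]
      by (simp add: trunc_dens[OF r f1m bdd_supp_fun_nonneg[OF n1]] trunc_dens[OF r f2m f20])
  qed
  then have le: "ennreal (norm (trunc (dens f) r y)) \<le> tsharp (dens f1) y + tsharp (dens f2) y" if r: "0 < r" for r y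
  proof -
    have "ennreal (norm (trunc (dens f) r y)) \<le> ennreal (norm (trunc (dens f1) r y)) + ennreal (norm (trunc (dens f2) r y))"
      using \<open>\<And>y r. 0 < r \<Longrightarrow> trunc (dens f) r y = trunc (dens f1) r y + trunc (dens f2) r y\<close>[OF r, of y]
      by (simp add: ennreal_plus[symmetric] norm_triangle_ineq ennreal_leI del: ennreal_plus)
    also have "\<dots> \<le> tsharp (dens f1) y + tsharp (dens f2) y" by (intro add_mono trunc_le_tsharp r)
    finally show ?thesis .
  qed
  have split: "tsharp (dens f) y \<le> tsharp (dens f1) y + tsharp (dens f2) y" for y
    unfolding tsharp_def[of "dens f"] using le by (intro SUP_least) auto
  let ?W = "{y. ennreal (\<epsilon> / 2 * t) < tsharp (dens f1) y}"
  let ?G = "{y. tsharp (dens f) y \<le> ennreal ((1 + \<epsilon>) * t)}"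
  let ?V = "vol x \<rho>"
  have Gm: "?G \<in> sets \<mu>" using tsharp_measurable[OF fin] by simp
  have Wm: "?W \<in> sets \<mu>" using tsharp_measurable[OF bdd_supp_fun_finite_measure[OF n1]] by simp
  have Wle: "emeasure \<mu> ?W \<le> ennreal (?V / 2)"
  proof -
    have "measure (dens f1) UNIV \<le> m * (A * ?V)"
    proof -
      have "(\<integral>\<^sup>+ y. ennreal (f1 y) \<partial>\<mu>) \<le> (\<integral>\<^sup>+ y. ennreal (f y) * indicator (ball x (5 * \<rho>)) y \<partial>\<mu>)"
        using \<rho> by (intro nn_integral_mono) (auto simp: f1_def indicator_def)
      also have "\<dots> = emeasure (dens f) (ball x (5 * \<rho>))" by (simp add: emeasure_dens[OF fm])
      also have "\<dots> \<le> ennreal (m * vol x (3 * (5 * \<rho>)))"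
        using \<rho> M by (intro maximal_le_emeasure_ball fin) (auto simp: m_def)
      also have "\<dots> \<le> ennreal (m * (A * ?V))"
      proof (intro ennreal_leI mult_left_mono)
        have "vol x (3 * (5 * \<rho>)) \<le> vol x (16 * \<rho>)"
          using \<rho> by (intro measure_ball_mono') simp
        also have "\<dots> \<le> A * ?V" using \<rho>(2) by (simp add: dbl_def)
        finally show "vol x (3 * (5 * \<rho>)) \<le> A * ?V" .
      qed (use m in simp)
      finally show ?thesis
        unfolding measure_dens_UNIV[OF f1m] using m A_pos by (intro enn2real_leI) auto
    qed
    then have "C11 * measure (dens f1) UNIV / (\<epsilon> / 2 * t) \<le> C11 * (m * (A * ?V)) / (\<epsilon> / 2 * t)"
      using C11_pos \<epsilon>(1) t by (intro divide_right_mono mult_left_mono) auto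
    also have "\<dots> = (4 * C11 * A * \<delta>) / \<epsilon> * (?V / 2)" using t \<epsilon>(1) by (simp add: m_def field_simps)
    also have "\<dots> \<le> 1 * (?V / 2)" using \<epsilon> by (intro mult_right_mono) auto
    finally have "C11 * measure (dens f1) UNIV / (\<epsilon> / 2 * t) \<le> ?V / 2" by simp
    moreover have "emeasure \<mu> ?W \<le> ennreal (C11 * measure (dens f1) UNIV / (\<epsilon> / 2 * t))"
      using \<epsilon>(1) t by (intro weak_11 bdd_supp_fun_finite_measure n1 sets_dens) auto
    ultimately show ?thesis using ennreal_leI order_trans by blast
  qed
  have sub: "ball x \<rho> \<subseteq> (ball x \<rho> \<inter> ?G) \<union> ?W"
  proof
    fix y assume y: "y \<in> ball x \<rho>"
    show "y \<in> (ball x \<rho> \<inter> ?G) \<union> ?W"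
    proof (rule ccontr)
      assume no: "y \<notin> (ball x \<rho> \<inter> ?G) \<union> ?W"
      then have "tsharp (dens f1) y \<le> ennreal (\<epsilon> / 2 * t)" by (simp add: not_less)
      then have "tsharp (dens f) y \<le> ennreal (\<epsilon> / 2 * t) + ennreal (t + (C2 + Cc) * m)"
        using split[of y] far[of y] y by (meson add_mono mem_ball order_trans)
      also have "\<dots> = ennreal (\<epsilon> / 2 * t + (t + (C2 + Cc) * m))"
        using \<epsilon>(1) t m C2_nonneg Cc_nonneg by (subst ennreal_plus) auto
      also have "\<dots> \<le> ennreal ((1 + \<epsilon>) * t)"
      proof (rule ennreal_leI)
        have "(C2 + Cc) * \<delta> * t \<le> \<epsilon> / 2 * t" using \<epsilon>(2) t by (intro mult_right_mono) auto
        then show "\<epsilon> / 2 * t + (t + (C2 + Cc) * m) \<le> (1 + \<epsilon>) * t" by (simp add: m_def field_simps)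
      qed
      finally show False using no y by simp
    qed
  qed
  have finB: "emeasure \<mu> (ball x \<rho> \<inter> ?G) = ennreal (measure \<mu> (ball x \<rho> \<inter> ?G))"
    by (rule emeasure_subset_ball) (rule Int_lower1)
  have "ennreal ?V \<le> emeasure \<mu> (ball x \<rho> \<inter> ?G) + emeasure \<mu> ?W"
    unfolding emeasure_ball[symmetric] using Gm Wm
    by (intro order_trans[OF emeasure_mono[OF sub] emeasure_subadditive]) auto
  also have "\<dots> \<le> ennreal (measure \<mu> (ball x \<rho> \<inter> ?G)) + ennreal (?V / 2)"
    unfolding finB by (intro add_left_mono Wle)
  also have "\<dots> = ennreal (measure \<mu> (ball x \<rho> \<inter> ?G) + ?V / 2)" by (simp add: ennreal_plus)
  finally have "?V \<le> measure \<mu> (ball x \<rho> \<inter> ?G) + ?V / 2" by (subst (asm) ennreal_le_iff) auto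
  then show ?thesis by simp
qed

lemma ex_powi_scale:
  fixes d :: real
  assumes "0 < d"
  obtains i :: int where "16 powi i \<le> d" "d < 16 * 16 powi i"
proof -
  define i where "i = \<lfloor>log 16 d\<rfloor>"
  have "16 powr (real_of_int i) \<le> 16 powr (log 16 d)" unfolding i_def by (intro powr_mono) auto
  moreover have "16 powr (log 16 d) < 16 powr (real_of_int i + 1)"
    unfolding i_def by (intro powr_less_mono) linarith+
  ultimately have "16 powi i \<le> d" "d < 16 * 16 powi i"
    using assms by (simp_all add: powr_add powr_real_of_int')
  then show ?thesis by (rule that)
qed

text \<open>Off the set where the maximal function exceeds \<delta> t, almost every point of
  \<open>?E\<close> is the centre of a doubling ball inside \<open>?\<Omega>\<close> of which at
  least half is good. Covering and doubling give \<mu>(E) \<le> \<mu>(X) + 2 A \<mu>(\<Omega>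
  \<inter> G), where \<open>X\<close> is that exceptional set. As \<Omega> is the disjoint union of
  \<Omega> \<inter> G and \<open>E\<close>, adding 2 A \<mu>(E) gives the claim; its gain is the
  factor 1 + 2 A against 2 A.\<close>

lemma good_lambda:
  assumes f: "bdd_supp_fun f" and t: "0 < t" and \<delta>: "0 < \<delta>"
    and \<epsilon>: "0 < \<epsilon>" "(C2 + Cc) * \<delta> \<le> \<epsilon> / 2" "4 * C11 * A * \<delta> \<le> \<epsilon>"
  shows "ennreal (1 + 2 * A) * emeasure \<mu> {x. ennreal ((1 + \<epsilon>) * t) < tsharp (dens f) x}
    \<le> emeasure \<mu> {x. \<not> maximal_le \<mu> (dens f) (\<delta> * t) x} + ennreal (2 * A) * emeasure \<mu> {x. ennreal t < tsharp (dens f) x}"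
proof -
  note fm = bdd_supp_fun_measurable[OF f] and f0 = bdd_supp_fun_nonneg[OF f]
  note fin = bdd_supp_fun_finite_measure[OF f]
  let ?F = "tsharp (dens f)"
  let ?m = "\<delta> * t"
  let ?G = "{y. ?F y \<le> ennreal ((1 + \<epsilon>) * t)}" and ?\<Omega> = "{y. ennreal t < ?F y}"
  let ?E = "{x. ennreal ((1 + \<epsilon>) * t) < ?F x}" and ?X = "{x. \<not> maximal_le \<mu> (dens f) ?m x}"
  have m: "0 < ?m" using \<delta> t by simp
  have Fm: "?F \<in> borel_measurable borel" using tsharp_measurable[OF fin] by simp
  have sets: "?G \<in> sets \<mu>" "?\<Omega> \<in> sets \<mu>" "?E \<in> sets \<mu>" "?X \<in> sets \<mu>"
    using Fm not_maximal_le_sets by simp_all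
  have "Cc * \<delta> \<le> \<epsilon>"
    using \<epsilon>(1,2) mult_nonneg_nonneg[OF C2_nonneg less_imp_le[OF \<delta>]] by (simp add: distrib_right)
  then have Cm: "Cc * ?m \<le> \<epsilon> * t" using mult_right_mono[of "Cc * \<delta>" \<epsilon> t] t by (simp add: mult.assoc)
  have key: "\<exists>\<rho>>0. ball x \<rho> \<subseteq> ?\<Omega> \<and> dbl x \<rho> \<and> vol x \<rho> \<le> 2 * measure \<mu> (ball x \<rho> \<inter> ?G)"
    if xE: "x \<in> ?E" and xM: "maximal_le \<mu> (dens f) ?m x" and xd: "\<And>i::int. \<exists>l. dbl x (16 powi i / 16 ^ l)" for x
  proof -
    have "\<exists>i::int. ball x (16 powi i) \<subseteq> ?\<Omega> \<and> (\<forall>r\<ge>32 * 16 powi i. norm (trunc (dens f) r x) \<le> t + Cc * ?m)"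
    \<comment> \<open>Without a point outside \<Omega> to compare with, the scale is chosen so large
      that the truncations miss the bounded support of \<open>f\<close>.\<close>
    proof (cases "?\<Omega> = UNIV")
      case True
      obtain b x0 r0 where supp: "\<And>y. f y \<noteq> 0 \<Longrightarrow> y \<in> ball x0 r0" using f unfolding bdd_supp_fun_def by blast
      define d where "d = 1 + \<bar>r0\<bar> + dist x x0"
      have d: "0 < d" by (simp add: d_def add_pos_nonneg)
      obtain i :: int where i: "16 powi i \<le> d" "d < 16 * 16 powi i" using ex_powi_scale[OF d] by blast
      have "trunc (dens f) r x = 0" if r: "32 * 16 powi i \<le> r" for r
      proof -
        have rp: "0 < r" "d < r" using r i d by linarith+
        have z: "kern r x y * complex_of_real (f y) = 0" for y
        proof (cases "f y = 0")
          case False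
          have "dist x y < d" using supp[OF False] dist_triangle[of x y x0] by (simp add: d_def)
          then show ?thesis using rp by simp
        qed simp
        show ?thesis unfolding trunc_dens[OF rp(1) fm f0] z by simp
      qed
      then show ?thesis using True t m Cc_nonneg by (intro exI[of _ i]) auto
    next
      case False
      let ?C = "- ?\<Omega>"
      have ne: "?C \<noteq> {}" using False by blast
      have near: "norm (trunc (dens f) r x) \<le> t + Cc * ?m" if z: "z \<in> ?C" "dist x z \<le> r / 2" "0 < r" for z r
      proof -
        have "ennreal (norm (trunc (dens f) r z)) \<le> ennreal t"
          using trunc_le_tsharp[OF z(3), of "dens f" z] z(1) by (auto simp: not_less intro: order_trans)
        then have "norm (trunc (dens f) r z) \<le> t" using t by (subst (asm) ennreal_le_iff) auto
        moreover have "norm (trunc (dens f) r x - trunc (dens f) r z) \<le> Cc * ?m"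
          using m by (intro trunc_diff_center_le z xM fin sets_dens) auto
        moreover have "norm (trunc (dens f) r x) \<le> norm (trunc (dens f) r x - trunc (dens f) r z) + norm (trunc (dens f) r z)"
          by (metis diff_add_cancel norm_triangle_ineq)
        ultimately show ?thesis by linarith
      qed
      obtain r where r: "0 < r" "(1 + \<epsilon>) * t < norm (trunc (dens f) r x)"
        using xE t \<epsilon>(1) unfolding tsharp_def by (auto simp: less_SUP_iff ennreal_less_iff)
      \<comment> \<open>A point of the complement closer than r / 2 would transfer its bound
        \<open>t\<close> to \<open>x\<close>, giving t + Cc \<delta> t \<le> (1 + \<epsilon>) t at
        the very radius where this level is exceeded.\<close>
      have "r / 2 \<le> dist x z" if "z \<in> ?C" for z
      proof (rule ccontr)
        assume "\<not> ?thesis"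
        then have "norm (trunc (dens f) r x) \<le> t + Cc * ?m" using near[OF that _ r(1)] by simp
        then show False using r(2) Cm by (simp add: distrib_right)
      qed
      then have "r / 2 \<le> infdist x ?C"
        unfolding infdist_notempty[OF ne] using ne by (intro cINF_greatest) auto
      then have d: "0 < infdist x ?C" using r(1) by linarith
      \<comment> \<open>A scale comparable to the distance from the complement: the ball stays
        inside \<Omega>, and from 32 times this radius on a point of the complement lies within half
        the truncation radius.\<close>
      obtain i :: int where i: "16 powi i \<le> infdist x ?C" "infdist x ?C < 16 * 16 powi i" using ex_powi_scale[OF d] by blast
      have "ball x (16 powi i) \<subseteq> ?\<Omega>"
      proof
        fix y assume y: "y \<in> ball x (16 powi i)"
        show "y \<in> ?\<Omega>"
        proof (rule ccontr)
          assume "y \<notin> ?\<Omega>"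
          then have "infdist x ?C \<le> dist x y" by (intro infdist_le) simp
          then show False using y i(1) by simp
        qed
      qed
      moreover have "norm (trunc (dens f) r' x) \<le> t + Cc * ?m" if r': "32 * 16 powi i \<le> r'" for r'
      proof -
        obtain z where z: "z \<in> ?C" "dist x z < 16 * 16 powi i"
          using i(2) unfolding infdist_notempty[OF ne] by (subst (asm) cINF_less_iff) (use ne in \<open>auto intro: bdd_belowI[of _ 0]\<close>)
        have "0 < (16::real) powi i" by simp
        then show ?thesis using z r' by (intro near[OF z(1)]) linarith+
      qed
      ultimately show ?thesis by blast
    qed
    then obtain i :: int where i: "ball x (16 powi i) \<subseteq> ?\<Omega>" "\<And>r. 32 * 16 powi i \<le> r \<Longrightarrow> norm (trunc (dens f) r x) \<le> t + Cc * ?m" by blast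
    obtain l where l: "dbl x (16 powi i / 16 ^ l)" "\<And>j. j < l \<Longrightarrow> \<not> dbl x (16 powi i / 16 ^ j)"
      using xd[of i] exists_least_iff[of "\<lambda>l. dbl x (16 powi i / 16 ^ l)"] by auto
    define \<rho> where "\<rho> = (16 powi i / 16 ^ l :: real)"
    have p: "0 < (16::real) powi i" by simp
    have \<rho>: "0 < \<rho>" using p by (simp add: \<rho>_def)
    have \<rho>le: "\<rho> \<le> 16 powi i" unfolding \<rho>_def using p by (simp add: divide_le_eq)
    have "norm (trunc (dens f) r x) \<le> t + C2 * ?m" if "4 * \<rho> \<le> r" for r
      using that m l(2) by (intro trunc_above_dbl_le[OF fin sets_dens xM _ p i(2)]) (auto simp: \<rho>_def)
    then have "vol x \<rho> \<le> 2 * measure \<mu> (ball x \<rho> \<inter> ?G)"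
      using l(1) by (intro good_dbl_ball[OF f xM t \<delta> \<epsilon> \<rho>]) (auto simp: \<rho>_def)
    moreover have "ball x \<rho> \<subseteq> ?\<Omega>" using i(1) \<rho>le by (meson order_trans subset_ball)
    moreover have "dbl x \<rho>" using l(1) by (simp add: \<rho>_def)
    ultimately show ?thesis using \<rho> by blast
  qed
  define I where "I = {x. x \<in> ?E \<and> maximal_le \<mu> (dens f) ?m x \<and> (\<forall>i::int. \<exists>l. dbl x (16 powi i / 16 ^ l))}"
  obtain \<rho> where \<rho>: "\<And>x. x \<in> I \<Longrightarrow> 0 < \<rho> x" "\<And>x. x \<in> I \<Longrightarrow> ball x (\<rho> x) \<subseteq> ?\<Omega>"
    "\<And>x. x \<in> I \<Longrightarrow> dbl x (\<rho> x)" "\<And>x. x \<in> I \<Longrightarrow> vol x (\<rho> x) \<le> 2 * measure \<mu> (ball x (\<rho> x) \<inter> ?G)"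
  proof -
    have "\<forall>x\<in>I. \<exists>\<rho>. 0 < \<rho> \<and> ball x \<rho> \<subseteq> ?\<Omega> \<and> dbl x \<rho> \<and> vol x \<rho> \<le> 2 * measure \<mu> (ball x \<rho> \<inter> ?G)"
      using key unfolding I_def by blast
    from bchoice[OF this] show ?thesis using that by blast
  qed
  let ?U = "\<Union>x\<in>I. ball x (\<rho> x)"
  have U: "emeasure \<mu> ?U \<le> ennreal (2 * A) * emeasure \<mu> (?\<Omega> \<inter> ?G)"
  proof (rule emeasure_Union_balls_le[OF sets_mu])
    fix J assume J: "J \<subseteq> I" "finite J" "disjoint_family_on (\<lambda>x. ball x (\<rho> x)) J"
    have Bm: "ball x (\<rho> x) \<inter> ?G \<in> sets \<mu>" for x using sets(1) by (intro sets.Int) auto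
    have "(\<Sum>j\<in>J. emeasure \<mu> (ball j (3 * \<rho> j))) \<le> (\<Sum>j\<in>J. ennreal (2 * A) * emeasure \<mu> (ball j (\<rho> j) \<inter> ?G))"
    proof (rule sum_mono)
      fix j assume "j \<in> J"
      then have j: "j \<in> I" using J by auto
      have "vol j (3 * \<rho> j) \<le> vol j (16 * \<rho> j)"
        using \<rho>(1)[OF j] by (intro measure_ball_mono') simp
      also have "\<dots> \<le> A * vol j (\<rho> j)" using \<rho>(3)[OF j] by (simp add: dbl_def)
      also have "\<dots> \<le> A * (2 * measure \<mu> (ball j (\<rho> j) \<inter> ?G))" using A_pos \<rho>(4)[OF j] by (intro mult_left_mono) auto
      finally have "emeasure \<mu> (ball j (3 * \<rho> j)) \<le> ennreal (2 * A * measure \<mu> (ball j (\<rho> j) \<inter> ?G))"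
        unfolding emeasure_ball by (intro ennreal_leI) simp
      also have "\<dots> = ennreal (2 * A) * emeasure \<mu> (ball j (\<rho> j) \<inter> ?G)"
      proof -
        have "emeasure \<mu> (ball j (\<rho> j) \<inter> ?G) = ennreal (measure \<mu> (ball j (\<rho> j) \<inter> ?G))"
          by (rule emeasure_subset_ball) (rule Int_lower1)
        then show ?thesis using A_pos by (simp add: ennreal_mult)
      qed
      finally show "emeasure \<mu> (ball j (3 * \<rho> j)) \<le> ennreal (2 * A) * emeasure \<mu> (ball j (\<rho> j) \<inter> ?G)" .
    qed
    also have "\<dots> = ennreal (2 * A) * emeasure \<mu> (\<Union>j\<in>J. ball j (\<rho> j) \<inter> ?G)"
      unfolding sum_distrib_left[symmetric] using J Bm
      by (subst sum_emeasure) (auto simp: disjoint_family_on_def)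
    also have "\<dots> \<le> ennreal (2 * A) * emeasure \<mu> (?\<Omega> \<inter> ?G)"
      using \<rho>(2) J sets by (intro mult_left_mono emeasure_mono) auto
    finally show "(\<Sum>j\<in>J. emeasure \<mu> (ball j (3 * \<rho> j))) \<le> ennreal (2 * A) * emeasure \<mu> (?\<Omega> \<inter> ?G)" .
  qed
  have Um: "?U \<in> sets \<mu>" by (simp add: borel_open open_UN)
  have "emeasure \<mu> ?E \<le> emeasure \<mu> (?X \<union> ?U)"
  proof (rule emeasure_mono_AE)
    show "AE x in \<mu>. x \<in> ?E \<longrightarrow> x \<in> ?X \<union> ?U"
      using AE_dbl
    proof eventually_elim
      case (elim x)
      show ?case
      proof
        assume xE: "x \<in> ?E"
        show "x \<in> ?X \<union> ?U"
        proof (cases "maximal_le \<mu> (dens f) ?m x")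
          case True
          then have "x \<in> I" using xE elim by (simp add: I_def)
          then have "x \<in> ?U" using \<rho>(1) by force
          then show ?thesis by simp
        qed simp
      qed
    qed
  qed (use sets Um in auto)
  also have "\<dots> \<le> emeasure \<mu> ?X + emeasure \<mu> ?U" using sets Um by (intro emeasure_subadditive) auto
  also have "\<dots> \<le> emeasure \<mu> ?X + ennreal (2 * A) * emeasure \<mu> (?\<Omega> \<inter> ?G)" by (intro add_left_mono U)
  finally have E: "emeasure \<mu> ?E \<le> emeasure \<mu> ?X + ennreal (2 * A) * emeasure \<mu> (?\<Omega> \<inter> ?G)" .
  have tt: "ennreal t \<le> ennreal ((1 + \<epsilon>) * t)" using t \<epsilon>(1) by (intro ennreal_leI) simp
  \<comment> \<open>The measures may be infinite, so the absorption is arranged by adding a term to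
    both sides and not by subtraction.\<close>
  have "emeasure \<mu> (?\<Omega> \<inter> ?G) + emeasure \<mu> ?E = emeasure \<mu> ((?\<Omega> \<inter> ?G) \<union> ?E)"
    using sets by (intro plus_emeasure) auto
  also have "(?\<Omega> \<inter> ?G) \<union> ?E = ?\<Omega>" using tt by auto
  finally have sum: "emeasure \<mu> (?\<Omega> \<inter> ?G) + emeasure \<mu> ?E = emeasure \<mu> ?\<Omega>" .
  have "ennreal (1 + 2 * A) * emeasure \<mu> ?E = emeasure \<mu> ?E + ennreal (2 * A) * emeasure \<mu> ?E"
    using A_pos by (simp add: ennreal_plus distrib_right)
  also have "\<dots> \<le> (emeasure \<mu> ?X + ennreal (2 * A) * emeasure \<mu> (?\<Omega> \<inter> ?G)) + ennreal (2 * A) * emeasure \<mu> ?E"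
    by (intro add_right_mono E)
  also have "\<dots> = emeasure \<mu> ?X + ennreal (2 * A) * emeasure \<mu> ?\<Omega>"
    unfolding sum[symmetric] by (simp add: distrib_left add.assoc)
  finally show ?thesis .
qed

end

subsection \<open>Integration of the good-\<open>\<lambda>\<close> inequality\<close>

lemma ennreal_rpow_ennreal [simp]: "0 \<le> a \<Longrightarrow> ennreal_rpow (ennreal a) p = ennreal (a powr p)"
  by (simp add: ennreal_rpow_def)

lemma ennreal_rpow_top [simp]: "ennreal_rpow top p = top"
  by (simp add: ennreal_rpow_def)

lemma ennreal_rpow_measurable [measurable]: "(\<lambda>x. ennreal_rpow x p) \<in> borel_measurable borel"
  unfolding ennreal_rpow_def by measurable

lemma ennreal_rpow_mono: "0 < p \<Longrightarrow> a \<le> b \<Longrightarrow> ennreal_rpow a p \<le> ennreal_rpow b p"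
  by (cases a; cases b) (auto intro!: ennreal_leI powr_mono2 simp: ennreal_le_iff top_unique)

lemma ennreal_rpow_less_iff: "0 < p \<Longrightarrow> ennreal_rpow a p < ennreal_rpow b p \<longleftrightarrow> a < b"
proof -
  assume p: "0 < p"
  have "r powr p < s powr p \<longleftrightarrow> r < s" if "0 \<le> r" "0 \<le> s" for r s
    using powr_mono2[of p s r] powr_less_mono2[of p r s] p that by (auto simp: not_less[symmetric])
  then show ?thesis by (cases a; cases b) (auto simp: ennreal_less_iff)
qed

lemma ennreal_enn2real_min: "ennreal (enn2real (min a (ennreal L))) = min a (ennreal L)"
  by (rule ennreal_enn2real) (simp add: min_less_iff_disj)

lemma ennreal_rpow_rpow: "ennreal_rpow (ennreal_rpow a p) q = ennreal_rpow a (p * q)"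
  by (cases a) (auto simp: powr_powr)

lemma ennreal_rpow_1 [simp]: "ennreal_rpow a 1 = a"
  by (cases a) auto

lemma ennreal_rpow_cmult: "0 < c \<Longrightarrow> ennreal_rpow (ennreal c * a) p = ennreal (c powr p) * ennreal_rpow a p"
  by (cases a) (auto simp: ennreal_mult[symmetric] powr_mult ennreal_mult_top)

lemma ennreal_rpow_add_le:
  assumes "0 < p"
  shows "ennreal_rpow (a + b) p \<le> ennreal (2 powr p) * (ennreal_rpow a p + ennreal_rpow b p)"
proof -
  have "a + b \<le> ennreal 2 * max a b"
    using add_mono[of a "max a b" b "max a b"] by (simp add: mult_2)
  then have "ennreal_rpow (a + b) p \<le> ennreal_rpow (ennreal 2 * max a b) p"
    using assms by (intro ennreal_rpow_mono)
  also have "\<dots> = ennreal (2 powr p) * ennreal_rpow (max a b) p" by (rule ennreal_rpow_cmult) simp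
  also have "\<dots> \<le> ennreal (2 powr p) * (ennreal_rpow a p + ennreal_rpow b p)"
    by (intro mult_left_mono) (auto simp: max_def add_increasing add_increasing2)
  finally show ?thesis .
qed

text \<open>The power is strictly increasing with inverse exponent 1/p, so each level strictly below
  the power of \<open>a\<close> comes from a level strictly below \<open>a\<close>.\<close>

lemma ennreal_rpow_Liminf_le:
  assumes "0 < p" "a \<le> liminf X"
  shows "ennreal_rpow a p \<le> liminf (\<lambda>n. ennreal_rpow (X n) p)"
  unfolding le_Liminf_iff
proof (intro allI impI)
  fix y assume y: "y < ennreal_rpow a p"
  have eq: "ennreal_rpow (ennreal_rpow y (1 / p)) p = y" using assms(1) by (simp add: ennreal_rpow_rpow)
  then have "ennreal_rpow y (1 / p) < a" using y ennreal_rpow_less_iff[OF assms(1)] by metis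
  then have "\<forall>\<^sub>F n in sequentially. ennreal_rpow y (1 / p) < X n"
    using assms(2) unfolding le_Liminf_iff by blast
  then show "\<forall>\<^sub>F n in sequentially. y < ennreal_rpow (X n) p"
    by eventually_elim (metis eq ennreal_rpow_less_iff[OF assms(1)])
qed

lemma nn_integral_powr_interval:
  assumes q: "0 < q" and c: "0 \<le> c"
  shows "(\<integral>\<^sup>+ t. ennreal (t powr (q - 1)) * indicator {0<..<c} t \<partial>lborel) = ennreal (c powr q / q)"
proof -
  have "((\<lambda>t. t powr (q - 1)) has_integral (c powr q / q)) {0..c}"
    using has_integral_powr_from_0[of "q - 1" c] q c by simp
  then have "((\<lambda>t. if t \<in> {0..c} then t powr (q - 1) else 0) has_integral (c powr q / q)) UNIV"
    by (simp only: has_integral_restrict_UNIV)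
  then have "(\<integral>\<^sup>+ t. ennreal (if t \<in> {0..c} then t powr (q - 1) else 0) \<partial>lborel) = ennreal (c powr q / q)"
    by (intro nn_integral_has_integral_lborel) auto
  moreover have "(\<integral>\<^sup>+ t. ennreal (t powr (q - 1)) * indicator {0<..<c} t \<partial>lborel)
     = (\<integral>\<^sup>+ t. ennreal (if t \<in> {0..c} then t powr (q - 1) else 0) \<partial>lborel)"
  proof (rule nn_integral_cong_AE)
    show "AE t in lborel. ennreal (t powr (q - 1)) * indicator {0<..<c} t = ennreal (if t \<in> {0..c} then t powr (q - 1) else 0)"
      using AE_lborel_singleton[of c] AE_lborel_singleton[of 0]
      by eventually_elim (auto simp: indicator_def)
  qed
  ultimately show ?thesis by simp
qed

lemma layer_cake:
  fixes g :: "'a \<Rightarrow> real"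
  assumes M: "sigma_finite_measure M" and g[measurable]: "g \<in> borel_measurable M" and g0: "\<And>x. 0 \<le> g x" and p: "0 < p"
  shows "(\<integral>\<^sup>+ x. ennreal (g x powr p) \<partial>M)
    = (\<integral>\<^sup>+ t. ennreal (p * t powr (p - 1)) * indicator {0<..} t * emeasure M {x \<in> space M. t < g x} \<partial>lborel)"
proof -
  interpret M: sigma_finite_measure M by fact
  interpret P: pair_sigma_finite M lborel ..
  have "(\<integral>\<^sup>+ x. ennreal (g x powr p) \<partial>M)
    = (\<integral>\<^sup>+ x. (\<integral>\<^sup>+ t. ennreal (p * t powr (p - 1)) * indicator {0<..} t * indicator {t. t < g x} t \<partial>lborel) \<partial>M)"
  proof (rule nn_integral_cong)
    fix x
    have "(\<integral>\<^sup>+ t. ennreal (p * t powr (p - 1)) * indicator {0<..} t * indicator {t. t < g x} t \<partial>lborel)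
      = (\<integral>\<^sup>+ t. ennreal p * (ennreal (t powr (p - 1)) * indicator {0<..<g x} t) \<partial>lborel)"
      using p by (intro nn_integral_cong) (auto simp: indicator_def ennreal_mult)
    also have "\<dots> = ennreal p * ennreal (g x powr p / p)"
      by (subst nn_integral_cmult) (auto simp: nn_integral_powr_interval[OF p g0])
    also have "\<dots> = ennreal (g x powr p)" using p by (simp add: ennreal_mult[symmetric])
    finally show "ennreal (g x powr p) = (\<integral>\<^sup>+ t. ennreal (p * t powr (p - 1)) * indicator {0<..} t * indicator {t. t < g x} t \<partial>lborel)" by simp
  qed
  also have "\<dots> = (\<integral>\<^sup>+ t. (\<integral>\<^sup>+ x. ennreal (p * t powr (p - 1)) * indicator {0<..} t * indicator {t. t < g x} t \<partial>M) \<partial>lborel)"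
    by (rule P.Fubini'[symmetric]) measurable
  also have "\<dots> = (\<integral>\<^sup>+ t. ennreal (p * t powr (p - 1)) * indicator {0<..} t * emeasure M {x \<in> space M. t < g x} \<partial>lborel)"
  proof (rule nn_integral_cong)
    fix t
    have "(\<integral>\<^sup>+ x. ennreal (p * t powr (p - 1)) * indicator {0<..} t * indicator {t. t < g x} t \<partial>M)
      = (\<integral>\<^sup>+ x. (ennreal (p * t powr (p - 1)) * indicator {0<..} t) * indicator {x \<in> space M. t < g x} x \<partial>M)"
      by (intro nn_integral_cong) (auto simp: indicator_def)
    also have "\<dots> = ennreal (p * t powr (p - 1)) * indicator {0<..} t * emeasure M {x \<in> space M. t < g x}"
      by (intro nn_integral_cmult_indicator) measurable
    finally show "(\<integral>\<^sup>+ x. ennreal (p * t powr (p - 1)) * indicator {0<..} t * indicator {t. t < g x} t \<partial>M)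
      = ennreal (p * t powr (p - 1)) * indicator {0<..} t * emeasure M {x \<in> space M. t < g x}" .
  qed
  finally show ?thesis .
qed

section \<open>The maximal function in L^p\<close>

context upper_doubling_space
begin

text \<open>The values of \<open>f\<close> that are at most s/2 add at most s/2 to any mean, so only
  the part above s/2 enters the maximal theorem.\<close>

lemma maximal_weak_type_truncated:
  assumes f: "bdd_supp_fun f" and s: "0 < s"
  shows "emeasure \<mu> {x. \<not> maximal_le \<mu> (dens f) s x}
    \<le> ennreal (2 / s) * (\<integral>\<^sup>+ x. ennreal (f x) * indicator {x. s / 2 < f x} x \<partial>\<mu>)"
proof -
  note fm [measurable] = bdd_supp_fun_measurable[OF f] and f0 = bdd_supp_fun_nonneg[OF f]
  let ?S = "{x. s / 2 < f x}"
  have S: "?S \<in> sets borel" by measurable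
  define f' where "f' = (\<lambda>x. f x * indicator ?S x)"
  have f': "bdd_supp_fun f'" unfolding f'_def by (rule bdd_supp_fun_mult_indicator[OF f S])
  note f'm = bdd_supp_fun_measurable[OF f'] and fin' = bdd_supp_fun_finite_measure[OF f']
  have sub: "maximal_le \<mu> (dens f) s x" if M: "maximal_le \<mu> (dens f') (s / 2) x" for x
    unfolding maximal_le_def
  proof (intro allI impI)
    fix y r assume *: "x \<in> ball y r"
    then have r: "0 < r" using zero_le_dist[of y x] by (simp del: zero_le_dist)
    let ?V = "vol y (3 * r)"
    have "emeasure (dens f) (ball y r) = (\<integral>\<^sup>+ z. ennreal (f z) * indicator (ball y r) z \<partial>\<mu>)"
      by (simp add: emeasure_dens fm)
    also have "\<dots> \<le> (\<integral>\<^sup>+ z. ennreal (f' z) * indicator (ball y r) z + ennreal (s / 2) * indicator (ball y r) z \<partial>\<mu>)"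
      using s f0 by (intro nn_integral_mono) (auto simp: f'_def indicator_def intro!: ennreal_leI)
    also have "\<dots> = emeasure (dens f') (ball y r) + ennreal (s / 2) * emeasure \<mu> (ball y r)"
      using f'm by (subst nn_integral_add)
        (auto simp: emeasure_dens nn_integral_cmult_indicator intro!: borel_measurable_times_ennreal borel_measurable_indicator)
    also have "\<dots> \<le> ennreal (s / 2 * ?V) + ennreal (s / 2) * ennreal ?V"
    proof (intro add_mono mult_left_mono)
      show "emeasure (dens f') (ball y r) \<le> ennreal (s / 2 * ?V)"
        unfolding finite_measure.emeasure_eq_measure[OF fin']
        using M * unfolding maximal_le_def by (intro ennreal_leI) blast
      show "emeasure \<mu> (ball y r) \<le> ennreal ?V"
        using r by (auto simp: emeasure_ball intro!: ennreal_leI measure_ball_mono')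
    qed auto
    also have "\<dots> = ennreal (s * ?V)"
      using s by (simp add: ennreal_mult[symmetric] ennreal_plus[symmetric] del: ennreal_plus)
    finally show "measure (dens f) (ball y r) \<le> s * ?V"
      unfolding measure_def[of "dens f"] using s by (intro enn2real_leI) auto
  qed
  have "emeasure \<mu> {x. \<not> maximal_le \<mu> (dens f) s x} \<le> emeasure \<mu> {x. \<not> maximal_le \<mu> (dens f') (s / 2) x}"
    using sub not_maximal_le_sets by (intro emeasure_mono) auto
  also have "\<dots> \<le> ennreal (measure (dens f') UNIV / (s / 2))"
    using s by (intro maximal_weak_type fin' sets_dens) simp
  also have "\<dots> = ennreal (2 / s) * ennreal (measure (dens f') UNIV)"
    using s by (simp add: ennreal_mult[symmetric] mult.commute)
  also have "ennreal (measure (dens f') UNIV) = (\<integral>\<^sup>+ x. ennreal (f' x) \<partial>\<mu>)"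
    unfolding measure_dens_UNIV[OF f'm] using bdd_supp_fun_integral_finite[OF f'] by (simp add: less_top)
  also have "\<dots> = (\<integral>\<^sup>+ x. ennreal (f x) * indicator ?S x \<partial>\<mu>)"
    by (intro nn_integral_cong) (simp add: f'_def indicator_def)
  finally show ?thesis .
qed

text \<open>Marcinkiewicz's computation: the bound of \<open>maximal_weak_type_truncated\<close> at
  s = \<delta> t is integrated against p t^(p-1) dt. After Fubini the inner integral is that of
  t^(p-2) over 0 < t < 2 f(x)/\<delta>, finite because p > 1.\<close>

lemma maximal_strong_type:
  assumes f: "bdd_supp_fun f" and p: "1 < p" and \<delta>: "0 < \<delta>"
  shows "(\<integral>\<^sup>+ t. ennreal (p * t powr (p - 1)) * indicator {0<..} t *
      (ennreal (2 / (\<delta> * t)) * (\<integral>\<^sup>+ x. ennreal (f x) * indicator {x. \<delta> * t / 2 < f x} x \<partial>\<mu>)) \<partial>lborel)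
    = ennreal (p / (p - 1) * (2 / \<delta>) powr p) * (\<integral>\<^sup>+ x. ennreal (f x powr p) \<partial>\<mu>)"
proof -
  interpret M: sigma_finite_measure \<mu> by (rule sigma_finite_mu)
  interpret P: pair_sigma_finite \<mu> lborel ..
  note fb [measurable] = bdd_supp_fun_measurable[OF f] and f0 = bdd_supp_fun_nonneg[OF f]
  let ?H = "\<lambda>x t. ennreal (p * t powr (p - 1)) * indicator {0<..} t * (ennreal (2 / (\<delta> * t)) * (ennreal (f x) * indicator {t. \<delta> * t / 2 < f x} t))"
  have "(\<integral>\<^sup>+ t. ennreal (p * t powr (p - 1)) * indicator {0<..} t *
      (ennreal (2 / (\<delta> * t)) * (\<integral>\<^sup>+ x. ennreal (f x) * indicator {x. \<delta> * t / 2 < f x} x \<partial>\<mu>)) \<partial>lborel)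
    = (\<integral>\<^sup>+ t. (\<integral>\<^sup>+ x. ?H x t \<partial>\<mu>) \<partial>lborel)"
  proof (rule nn_integral_cong)
    fix t
    have "(\<lambda>x. ennreal (f x) * indicator {x. \<delta> * t / 2 < f x} x) \<in> borel_measurable \<mu>" by measurable
    then have "ennreal (p * t powr (p - 1)) * indicator {0<..} t * (ennreal (2 / (\<delta> * t)) * (\<integral>\<^sup>+ x. ennreal (f x) * indicator {x. \<delta> * t / 2 < f x} x \<partial>\<mu>))
      = (\<integral>\<^sup>+ x. ennreal (p * t powr (p - 1)) * indicator {0<..} t * (ennreal (2 / (\<delta> * t)) * (ennreal (f x) * indicator {x. \<delta> * t / 2 < f x} x)) \<partial>\<mu>)"
      by (simp add: nn_integral_cmult)
    also have "\<dots> = (\<integral>\<^sup>+ x. ?H x t \<partial>\<mu>)" by (intro nn_integral_cong) (simp add: indicator_def)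
    finally show "ennreal (p * t powr (p - 1)) * indicator {0<..} t * (ennreal (2 / (\<delta> * t)) * (\<integral>\<^sup>+ x. ennreal (f x) * indicator {x. \<delta> * t / 2 < f x} x \<partial>\<mu>))
      = (\<integral>\<^sup>+ x. ?H x t \<partial>\<mu>)" .
  qed
  also have "\<dots> = (\<integral>\<^sup>+ x. (\<integral>\<^sup>+ t. ?H x t \<partial>lborel) \<partial>\<mu>)"
    by (rule P.Fubini') measurable
  also have "\<dots> = (\<integral>\<^sup>+ x. ennreal (p / (p - 1) * (2 / \<delta>) powr p) * ennreal (f x powr p) \<partial>\<mu>)"
  proof (rule nn_integral_cong)
    fix x
    let ?c = "2 * f x / \<delta>"
    have "(\<integral>\<^sup>+ t. ?H x t \<partial>lborel) = (\<integral>\<^sup>+ t. ennreal (2 * p / \<delta> * f x) * (ennreal (t powr ((p - 1) - 1)) * indicator {0<..<?c} t) \<partial>lborel)"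
    proof (rule nn_integral_cong)
      fix t :: real
      show "?H x t = ennreal (2 * p / \<delta> * f x) * (ennreal (t powr ((p - 1) - 1)) * indicator {0<..<?c} t)"
      proof (cases "0 < t \<and> t < ?c")
        case True
        then have "\<delta> * t / 2 < f x" using \<delta> by (simp add: field_simps)
        moreover have "t powr (p - 1) = t * t powr ((p - 1) - 1)"
          using True powr_add[of t 1 "(p - 1) - 1"] by simp
        ultimately show ?thesis using True \<delta> p f0[of x]
          by (simp add: ennreal_mult[symmetric])
      next
        case False
        then have "t \<le> 0 \<or> \<not> \<delta> * t / 2 < f x" using \<delta> by (auto simp: field_simps)
        then show ?thesis using False by auto
      qed
    qed
    also have "\<dots> = ennreal (2 * p / \<delta> * f x) * ennreal (?c powr (p - 1) / (p - 1))"
    proof (subst nn_integral_cmult)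
      show "ennreal (2 * p / \<delta> * f x) * (\<integral>\<^sup>+ t. ennreal (t powr ((p - 1) - 1)) * indicator {0<..<?c} t \<partial>lborel)
        = ennreal (2 * p / \<delta> * f x) * ennreal (?c powr (p - 1) / (p - 1))"
        using \<delta> p f0[of x] by (subst nn_integral_powr_interval) auto
    qed measurable
    also have "\<dots> = ennreal (2 * p / \<delta> * f x * (?c powr (p - 1) / (p - 1)))"
      using \<delta> p f0[of x] by (subst ennreal_mult) auto
    also have "2 * p / \<delta> * f x * (?c powr (p - 1) / (p - 1)) = p / (p - 1) * (2 / \<delta>) powr p * f x powr p"
    proof (cases "f x = 0")
      case True then show ?thesis by simp
    next
      case False
      then have fx: "0 < f x" using f0[of x] by linarith
      have "?c powr p = ?c * ?c powr (p - 1)"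
        using powr_add[of ?c 1 "p - 1"] fx \<delta> by simp
      moreover have "?c powr p = (2 / \<delta>) powr p * f x powr p"
        using powr_mult[of "2 / \<delta>" "f x" p] fx \<delta> by simp
      ultimately have "(2 / \<delta>) powr p * f x powr p = ?c * ?c powr (p - 1)" by simp
      then have "p / (p - 1) * ((2 / \<delta>) powr p * f x powr p) = p / (p - 1) * (?c * ?c powr (p - 1))" by simp
      then show ?thesis by (simp add: mult_ac)
    qed
    also have "ennreal \<dots> = ennreal (p / (p - 1) * (2 / \<delta>) powr p) * ennreal (f x powr p)"
      using p \<delta> by (intro ennreal_mult) auto
    finally show "(\<integral>\<^sup>+ t. ?H x t \<partial>lborel) = ennreal (p / (p - 1) * (2 / \<delta>) powr p) * ennreal (f x powr p)" .
  qed
  also have "\<dots> = ennreal (p / (p - 1) * (2 / \<delta>) powr p) * (\<integral>\<^sup>+ x. ennreal (f x powr p) \<partial>\<mu>)"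
    by (intro nn_integral_cmult) measurable
  finally show ?thesis .
qed

end

section \<open>Absorption and strong type\<close>

context cz_operator
begin

text \<open>\<epsilon> comes first: (1 + \<epsilon>)^p * 2 A \<le> 2 A + 1/2 stays below 1 + 2 A,
  which leaves half of the integral after absorption. Then \<delta> is made small in terms of
  \<epsilon>.\<close>

lemma good_lambda_parameters:
  assumes "1 < p"
  obtains \<epsilon> \<delta> where "0 < \<epsilon>" "0 < \<delta>" "(C2 + Cc) * \<delta> \<le> \<epsilon> / 2" "4 * C11 * A * \<delta> \<le> \<epsilon>"
    "(1 + \<epsilon>) powr p \<le> 1 + 1 / (4 * A)"
proof -
  define \<epsilon> where "\<epsilon> = (1 + 1 / (4 * A)) powr (1 / p) - 1"
  have "1 powr (1 / p) < (1 + 1 / (4 * A)) powr (1 / p)"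
    using assms A_pos by (intro powr_less_mono2) auto
  then have \<epsilon>: "0 < \<epsilon>" by (simp add: \<epsilon>_def)
  have p: "(1 + \<epsilon>) powr p \<le> 1 + 1 / (4 * A)"
    using assms A_pos by (simp add: \<epsilon>_def powr_powr)
  define \<delta> where "\<delta> = min (\<epsilon> / (2 * (C2 + Cc + 1))) (\<epsilon> / (4 * C11 * A))"
  have c: "0 \<le> C2 + Cc" using C2_nonneg Cc_nonneg by simp
  have \<delta>: "0 < \<delta>" using \<epsilon> c C11_pos A_pos by (simp add: \<delta>_def)
  have "(C2 + Cc) * \<delta> \<le> (C2 + Cc + 1) * (\<epsilon> / (2 * (C2 + Cc + 1)))"
    using c \<delta> by (intro mult_mono) (auto simp: \<delta>_def)
  also have "\<dots> = \<epsilon> / 2"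
  proof -
    have "D * (\<epsilon> / (2 * D)) = \<epsilon> / 2" if "0 < D" for D using that by simp
    then show ?thesis using c by (metis add_nonneg_pos zero_less_one)
  qed
  finally have 1: "(C2 + Cc) * \<delta> \<le> \<epsilon> / 2" .
  have "4 * C11 * A * \<delta> \<le> 4 * C11 * A * (\<epsilon> / (4 * C11 * A))"
    using C11_pos A_pos by (intro mult_left_mono) (auto simp: \<delta>_def)
  also have "\<dots> = \<epsilon>" using C11_pos A_pos by simp
  finally show ?thesis using that[OF \<epsilon> \<delta> 1 _ p] by simp
qed

text \<open>By weak type (1,1) the level sets have measure at most c/t, and t^(p-2) is integrable on
  (0, L) for p > 1. This qualitative finiteness legitimises the absorption and does not enter the
  final constant.\<close>

lemma tsharp_truncated_Lp_finite:
  assumes f: "bdd_supp_fun f" and p: "1 < p" and L: "0 < L"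
  shows "(\<integral>\<^sup>+ x. ennreal (enn2real (min (tsharp (dens f) x) (ennreal L)) powr p) \<partial>\<mu>) < \<infinity>"
proof -
  note fin = bdd_supp_fun_finite_measure[OF f]
  let ?F = "tsharp (dens f)"
  let ?h = "\<lambda>x. enn2real (min (?F x) (ennreal L))"
  have Fm [measurable]: "?F \<in> borel_measurable borel" using tsharp_measurable[OF fin] by simp
  have hm: "?h \<in> borel_measurable \<mu>" by measurable
  define c where "c = C11 * measure (dens f) UNIV"
  have c: "0 \<le> c" using C11_pos by (simp add: c_def)
  have h: "emeasure \<mu> {x \<in> space \<mu>. t < ?h x} \<le> ennreal (c / t) * indicator {..<L} t" if t: "0 < t" for t
  proof (cases "t < L")
    case True
    have "{x \<in> space \<mu>. t < ?h x} \<subseteq> {x. ennreal t < ?F x}"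
    proof
      fix x assume "x \<in> {x \<in> space \<mu>. t < ?h x}"
      then have x: "t < ?h x" by simp
      have "ennreal t < ennreal (?h x)" using x t by (simp add: ennreal_less_iff)
      also have "\<dots> \<le> ?F x" by (simp add: ennreal_enn2real_min)
      finally show "x \<in> {x. ennreal t < ?F x}" by simp
    qed
    then have "emeasure \<mu> {x \<in> space \<mu>. t < ?h x} \<le> emeasure \<mu> {x. ennreal t < ?F x}"
      by (intro emeasure_mono) simp_all
    also have "\<dots> \<le> ennreal (c / t)" unfolding c_def by (rule weak_11[OF fin sets_dens t])
    finally show ?thesis using True by simp
  next
    case False
    have "?h x \<le> L" for x using L by (intro enn2real_leI) auto
    then have "\<not> t < ?h x" for x using False by (meson not_less order_trans)
    then have "{x \<in> space \<mu>. t < ?h x} = {}" by blast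
    then show ?thesis by simp
  qed
  have "(\<integral>\<^sup>+ x. ennreal (?h x powr p) \<partial>\<mu>)
     = (\<integral>\<^sup>+ t. ennreal (p * t powr (p - 1)) * indicator {0<..} t * emeasure \<mu> {x \<in> space \<mu>. t < ?h x} \<partial>lborel)"
    using p hm by (intro layer_cake sigma_finite_mu) auto
  also have "\<dots> \<le> (\<integral>\<^sup>+ t. ennreal (p * c) * (ennreal (t powr ((p - 1) - 1)) * indicator {0<..<L} t) \<partial>lborel)"
  proof (rule nn_integral_mono)
    fix t :: real
    show "ennreal (p * t powr (p - 1)) * indicator {0<..} t * emeasure \<mu> {x \<in> space \<mu>. t < ?h x}
      \<le> ennreal (p * c) * (ennreal (t powr ((p - 1) - 1)) * indicator {0<..<L} t)"
    proof (cases "0 < t")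
      case True
      have e: "t powr (p - 1) = t * t powr ((p - 1) - 1)"
        using True powr_add[of t 1 "(p - 1) - 1"] by simp
      have "ennreal (p * t powr (p - 1)) * emeasure \<mu> {x \<in> space \<mu>. t < ?h x}
        \<le> ennreal (p * t powr (p - 1)) * (ennreal (c / t) * indicator {..<L} t)"
        by (intro mult_left_mono h True) auto
      also have "\<dots> = ennreal (p * c) * (ennreal (t powr ((p - 1) - 1)) * indicator {0<..<L} t)"
        using True p c unfolding e by (cases "t < L") (auto simp: ennreal_mult[symmetric])
      finally show ?thesis using True by simp
    qed simp
  qed
  also have "\<dots> = ennreal (p * c) * ennreal (L powr (p - 1) / (p - 1))"
    using p L nn_integral_powr_interval[of "p - 1" L] by (subst nn_integral_cmult) auto
  also have "\<dots> < \<infinity>" by (simp add: ennreal_mult_less_top)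
  finally show ?thesis .
qed

theorem tsharp_Lp_bdd_supp:
  assumes p: "1 < p"
  shows "\<exists>c>0. \<forall>f. bdd_supp_fun f \<longrightarrow>
    (\<integral>\<^sup>+ x. ennreal_rpow (tsharp (dens f) x) p \<partial>\<mu>) \<le> ennreal c * (\<integral>\<^sup>+ x. ennreal (f x powr p) \<partial>\<mu>)"
proof -
  obtain \<epsilon> \<delta> where \<epsilon>: "0 < \<epsilon>" and \<delta>: "0 < \<delta>" and cond: "(C2 + Cc) * \<delta> \<le> \<epsilon> / 2" "4 * C11 * A * \<delta> \<le> \<epsilon>"
    and ep: "(1 + \<epsilon>) powr p \<le> 1 + 1 / (4 * A)" using good_lambda_parameters[OF p] by blast
  define cJ where "cJ = p / (p - 1) * (2 / \<delta>) powr p"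
  have cJ: "0 < cJ" using p \<delta> by (simp add: cJ_def)
  have main: "(\<integral>\<^sup>+ x. ennreal_rpow (tsharp (dens f) x) p \<partial>\<mu>) \<le> ennreal (4 * cJ) * (\<integral>\<^sup>+ x. ennreal (f x powr p) \<partial>\<mu>)"
    if f: "bdd_supp_fun f" for f
  proof -
    note fb [measurable] = bdd_supp_fun_measurable[OF f] and f0 = bdd_supp_fun_nonneg[OF f]
    note fin = bdd_supp_fun_finite_measure[OF f]
    interpret M: sigma_finite_measure \<mu> by (rule sigma_finite_mu)
    let ?F = "tsharp (dens f)"
    have Fm [measurable]: "?F \<in> borel_measurable borel" using tsharp_measurable[OF fin] by simp
    let ?h = "\<lambda>L x. enn2real (min (?F x) (ennreal L))"
    have hm: "?h L \<in> borel_measurable \<mu>" for L by measurable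
    have hL: "?h L x \<le> L" if "0 \<le> L" for L x using that by (intro enn2real_leI) auto
    have hless: "t < ?h L x \<longleftrightarrow> ennreal t < ?F x" if "0 \<le> t" "t < L" for t L x
    proof -
      have "ennreal (?h L x) = min (?F x) (ennreal L)" by (rule ennreal_enn2real_min)
      then have "t < ?h L x \<longleftrightarrow> ennreal t < min (?F x) (ennreal L)"
        using that(1) by (metis ennreal_less_iff)
      also have "\<dots> \<longleftrightarrow> ennreal t < ?F x" using that by (simp add: ennreal_less_iff)
      finally show ?thesis .
    qed
    define J where "J = ennreal cJ * (\<integral>\<^sup>+ x. ennreal (f x powr p) \<partial>\<mu>)"
    have bound: "(\<integral>\<^sup>+ x. ennreal (?h L x powr p) \<partial>\<mu>) \<le> 4 * J" if L: "0 < L" for L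
    proof -
      let ?\<theta> = "1 + \<epsilon>"
      \<comment> \<open>Cut at \<theta> L and then rescaled, so that for t < L the level
        \<open>t\<close> of \<open>?g\<close> is the level \<theta> t of the operator, while both
        \<open>?g\<close> and \<open>?h L\<close> stop at \<open>L\<close>.\<close>
      let ?g = "\<lambda>x. ?h (?\<theta> * L) x / ?\<theta>"
      let ?w = "\<lambda>t. ennreal (p * t powr (p - 1)) * indicator {0<..} t :: ennreal"
      let ?W = "\<lambda>t. ennreal (2 / (\<delta> * t)) * (\<integral>\<^sup>+ x. ennreal (f x) * indicator {x. \<delta> * t / 2 < f x} x \<partial>\<mu>)"
      let ?I = "\<integral>\<^sup>+ x. ennreal (?h L x powr p) \<partial>\<mu>"
      have lev: "ennreal (1 + 2 * A) * emeasure \<mu> {x \<in> space \<mu>. t < ?g x} \<le> ?W t + ennreal (2 * A) * emeasure \<mu> {x \<in> space \<mu>. t < ?h L x}"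
        if t: "0 < t" for t
      proof (cases "t < L")
        case True
        have "{x \<in> space \<mu>. t < ?g x} = {x. ennreal (?\<theta> * t) < ?F x}"
        proof -
          have "0 \<le> ?\<theta> * t" "?\<theta> * t < ?\<theta> * L" using t True \<epsilon> by (auto intro!: mult_strict_left_mono)
          from hless[OF this] have "t < ?g x \<longleftrightarrow> ennreal (?\<theta> * t) < ?F x" for x
            using \<epsilon> by (subst pos_less_divide_eq) (auto simp: mult.commute)
          then show ?thesis by simp
        qed
        moreover have "{x \<in> space \<mu>. t < ?h L x} = {x. ennreal t < ?F x}"
          using hless[of t L] t True by auto
        moreover have "emeasure \<mu> {x. \<not> maximal_le \<mu> (dens f) (\<delta> * t) x} \<le> ?W t"
          using \<delta> t by (intro maximal_weak_type_truncated f) simp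
        ultimately show ?thesis
          using good_lambda[OF f t \<delta> \<epsilon> cond] by (auto intro: order_trans add_right_mono)
      next
        case False
        have "?g x \<le> L" for x using hL[of "?\<theta> * L" x] L \<epsilon> by (simp add: field_simps)
        then have "\<not> t < ?g x" for x using False by (meson not_less order_trans)
        then have "{x \<in> space \<mu>. t < ?g x} = {}" by blast
        then show ?thesis by simp
      qed
      have lc: "(\<integral>\<^sup>+ x. ennreal (?g x powr p) \<partial>\<mu>) = (\<integral>\<^sup>+ t. ?w t * emeasure \<mu> {x \<in> space \<mu>. t < ?g x} \<partial>lborel)"
        using p hm[of "?\<theta> * L"] \<epsilon> by (intro layer_cake sigma_finite_mu) auto
      have lch: "?I = (\<integral>\<^sup>+ t. ?w t * emeasure \<mu> {x \<in> space \<mu>. t < ?h L x} \<partial>lborel)"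
        using p hm[of L] by (intro layer_cake sigma_finite_mu) auto
      have mg: "(\<lambda>t. emeasure \<mu> {x \<in> space \<mu>. t < ?h L' x / c}) \<in> borel_measurable lborel" for L' c
        using hm[of L'] by measurable
      have mW: "(\<lambda>t. \<integral>\<^sup>+ x. ennreal (f x) * indicator {x. \<delta> * t / 2 < f x} x \<partial>\<mu>) \<in> borel_measurable lborel"
        by measurable
      have "ennreal (1 + 2 * A) * (\<integral>\<^sup>+ x. ennreal (?g x powr p) \<partial>\<mu>)
         = (\<integral>\<^sup>+ t. ?w t * (ennreal (1 + 2 * A) * emeasure \<mu> {x \<in> space \<mu>. t < ?g x}) \<partial>lborel)"
        unfolding lc using mg[of "?\<theta> * L" ?\<theta>] by (subst nn_integral_cmult[symmetric]) (auto simp: mult_ac)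
      also have "\<dots> \<le> (\<integral>\<^sup>+ t. ?w t * ?W t + ennreal (2 * A) * (?w t * emeasure \<mu> {x \<in> space \<mu>. t < ?h L x}) \<partial>lborel)"
      proof (rule nn_integral_mono)
        fix t :: real
        show "?w t * (ennreal (1 + 2 * A) * emeasure \<mu> {x \<in> space \<mu>. t < ?g x})
          \<le> ?w t * ?W t + ennreal (2 * A) * (?w t * emeasure \<mu> {x \<in> space \<mu>. t < ?h L x})"
        proof (cases "0 < t")
          case True
          have "?w t * (ennreal (1 + 2 * A) * emeasure \<mu> {x \<in> space \<mu>. t < ?g x})
            \<le> ?w t * (?W t + ennreal (2 * A) * emeasure \<mu> {x \<in> space \<mu>. t < ?h L x})"
            by (intro mult_left_mono lev True) auto
          then show ?thesis by (simp add: distrib_left mult_ac)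
        qed simp
      qed
      also have "\<dots> = (\<integral>\<^sup>+ t. ?w t * ?W t \<partial>lborel) + ennreal (2 * A) * ?I"
        unfolding lch using mg[of L 1] mW by (subst nn_integral_add) (auto simp: nn_integral_cmult)
      also have "(\<integral>\<^sup>+ t. ?w t * ?W t \<partial>lborel) = J"
        unfolding J_def cJ_def by (rule maximal_strong_type[OF f p \<delta>])
      finally have 1: "ennreal (1 + 2 * A) * (\<integral>\<^sup>+ x. ennreal (?g x powr p) \<partial>\<mu>) \<le> J + ennreal (2 * A) * ?I" .
      have "?I \<le> (\<integral>\<^sup>+ x. ennreal (?\<theta> powr p) * ennreal (?g x powr p) \<partial>\<mu>)"
      proof (rule nn_integral_mono)
        fix x
        have "L \<le> ?\<theta> * L" using L \<epsilon> by simp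
        then have "?h L x \<le> ?h (?\<theta> * L) x"
          by (intro enn2real_mono min.mono ennreal_leI) (auto simp: min_less_iff_disj)
        also have "\<dots> = ?\<theta> * ?g x" using \<epsilon> by simp
        finally have "?h L x powr p \<le> (?\<theta> * ?g x) powr p" using p by (simp add: powr_mono2)
        also have "\<dots> = ?\<theta> powr p * ?g x powr p" by (rule powr_mult)
        finally show "ennreal (?h L x powr p) \<le> ennreal (?\<theta> powr p) * ennreal (?g x powr p)"
          by (simp add: ennreal_mult[symmetric] ennreal_leI)
      qed
      also have "\<dots> = ennreal (?\<theta> powr p) * (\<integral>\<^sup>+ x. ennreal (?g x powr p) \<partial>\<mu>)"
        using hm[of "?\<theta> * L"] by (intro nn_integral_cmult) auto
      finally have "ennreal (1 + 2 * A) * ?I \<le> ennreal (1 + 2 * A) * (ennreal (?\<theta> powr p) * (\<integral>\<^sup>+ x. ennreal (?g x powr p) \<partial>\<mu>))"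
        by (intro mult_left_mono) auto
      also have "\<dots> = ennreal (?\<theta> powr p) * (ennreal (1 + 2 * A) * (\<integral>\<^sup>+ x. ennreal (?g x powr p) \<partial>\<mu>))"
        by (simp add: mult_ac)
      also have "\<dots> \<le> ennreal (1 + 1 / (4 * A)) * (J + ennreal (2 * A) * ?I)"
        by (intro mult_mono ennreal_leI ep 1) auto
      finally have 2: "ennreal (1 + 2 * A) * ?I \<le> ennreal (1 + 1 / (4 * A)) * (J + ennreal (2 * A) * ?I)" .
      show ?thesis
      proof (cases "J = top")
        case True then show ?thesis by simp
      next
        case False
        then obtain j where j: "J = ennreal j" "0 \<le> j" by (cases J) auto
        have "?I < \<infinity>" by (rule tsharp_truncated_Lp_finite[OF f p L])
        then obtain i where i: "?I = ennreal i" "0 \<le> i" by (cases ?I) auto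
        \<comment> \<open>Expanding the right side leaves (2 A + 1/2) i there, so i/2 survives on
          the left; with A \<ge> 2 the remaining factor is at most 2, whence i \<le> 4 j.\<close>
        have "(1 + 2 * A) * i \<le> (1 + 1 / (4 * A)) * (j + 2 * A * i)"
          using 2 A_pos i(2) j(2) unfolding i(1) j(1)
          by (simp add: ennreal_mult[symmetric] ennreal_plus[symmetric] del: ennreal_plus)
        also have "\<dots> = (1 + 1 / (4 * A)) * j + (2 * A + 1 / 2) * i"
          using A_pos by (simp add: field_simps)
        finally have "i \<le> 2 * ((1 + 1 / (4 * A)) * j)" by (simp add: algebra_simps)
        also have "\<dots> \<le> 2 * (2 * j)"
          using A_ge_2 j(2) by (intro mult_left_mono mult_right_mono) (auto simp: field_simps)
        finally have "i \<le> 4 * j" by simp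
        then have "ennreal i \<le> ennreal (4 * j)" by (rule ennreal_leI)
        then show ?thesis unfolding i(1) j(1) using j(2) by (simp add: ennreal_mult)
      qed
    qed
    \<comment> \<open>The bound does not depend on \<open>L\<close>; Fatou's lemma along integer
      heights removes the cut.\<close>
    have "(\<integral>\<^sup>+ x. ennreal_rpow (?F x) p \<partial>\<mu>) \<le> (\<integral>\<^sup>+ x. liminf (\<lambda>n. ennreal (?h (real (Suc n)) x powr p)) \<partial>\<mu>)"
    proof (rule nn_integral_mono)
      fix x
      have "?F x \<le> liminf (\<lambda>n. ennreal (?h (real (Suc n)) x))"
        unfolding le_Liminf_iff
      proof (intro allI impI)
        fix y assume y: "y < ?F x"
        then obtain z where z: "y = ennreal z" "0 \<le> z" by (cases y) auto
        obtain n0 where n0: "z < real n0" using reals_Archimedean2 by blast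
        have "y < ennreal (?h (real (Suc n)) x)" if "n0 \<le> n" for n
        proof -
          have "z < real (Suc n)" using n0 that by linarith
          from hless[OF z(2) this, of x] y z show ?thesis by (simp add: ennreal_less_iff del: of_nat_Suc)
        qed
        then show "\<forall>\<^sub>F n in sequentially. y < ennreal (?h (real (Suc n)) x)"
          by (auto simp: eventually_sequentially)
      qed
      then have "ennreal_rpow (?F x) p \<le> liminf (\<lambda>n. ennreal_rpow (ennreal (?h (real (Suc n)) x)) p)"
        using p by (intro ennreal_rpow_Liminf_le) auto
      then show "ennreal_rpow (?F x) p \<le> liminf (\<lambda>n. ennreal (?h (real (Suc n)) x powr p))" by simp
    qed
    also have "\<dots> \<le> liminf (\<lambda>n. \<integral>\<^sup>+ x. ennreal (?h (real (Suc n)) x powr p) \<partial>\<mu>)"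
      using hm by (intro nn_integral_liminf) auto
    also have "\<dots> \<le> 4 * J"
    proof -
      have "liminf (\<lambda>n. \<integral>\<^sup>+ x. ennreal (?h (real (Suc n)) x powr p) \<partial>\<mu>) \<le> liminf (\<lambda>n::nat. 4 * J)"
        by (intro Liminf_mono always_eventually allI bound) simp
      then show ?thesis by (simp add: Liminf_const)
    qed
    also have "4 * J = ennreal (4 * cJ) * (\<integral>\<^sup>+ x. ennreal (f x powr p) \<partial>\<mu>)"
      using cJ by (simp add: J_def ennreal_mult mult.assoc)
    finally show ?thesis .
  qed
  show ?thesis using main cJ by (intro exI[of _ "4 * cJ"]) auto
qed

end

subsection \<open>Complex functions and complex measures\<close>

lemma norm_four_parts_le:
  "norm (a - b + \<i> * (c - d)) \<le> norm a + norm b + norm c + norm (d :: complex)"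
proof -
  have "norm (a - b + \<i> * (c - d)) \<le> norm (a - b) + norm (\<i> * (c - d))" by (rule norm_triangle_ineq)
  also have "norm (\<i> * (c - d)) = norm (c - d)" by (simp add: norm_mult)
  finally show ?thesis using norm_triangle_ineq4[of a b] norm_triangle_ineq4[of c d] by linarith
qed

lemma ennreal_norm_four_parts_le:
  "ennreal (norm (a - b + \<i> * (c - d))) \<le>
     ennreal (norm a) + ennreal (norm b) + ennreal (norm c) + ennreal (norm (d :: complex))"
  using norm_four_parts_le[of a b c d]
  by (simp add: ennreal_plus[symmetric] ennreal_leI del: ennreal_plus)

lemma ennreal_rpow_add4_le:
  assumes "0 < p"
  shows "ennreal_rpow (a + b + c + d) p
    \<le> ennreal (4 powr p) * (ennreal_rpow a p + ennreal_rpow b p + ennreal_rpow c p + ennreal_rpow d p)"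
proof -
  let ?k = "ennreal (2 powr p)"
  have "ennreal_rpow (a + b + c + d) p = ennreal_rpow ((a + b) + (c + d)) p" by (simp add: add.assoc)
  also have "\<dots> \<le> ?k * (ennreal_rpow (a + b) p + ennreal_rpow (c + d) p)"
    by (rule ennreal_rpow_add_le[OF assms])
  also have "\<dots> \<le> ?k * (?k * (ennreal_rpow a p + ennreal_rpow b p) + ?k * (ennreal_rpow c p + ennreal_rpow d p))"
    by (intro mult_left_mono add_mono ennreal_rpow_add_le assms) auto
  also have "\<dots> = (?k * ?k) * (ennreal_rpow a p + ennreal_rpow b p + ennreal_rpow c p + ennreal_rpow d p)"
    by (simp add: distrib_left mult.assoc add.assoc)
  also have "?k * ?k = ennreal (4 powr p)"
    using powr_mult[of 2 2 p] by (simp add: ennreal_mult[symmetric])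
  finally show ?thesis .
qed

lemma norm_le_total_variation:
  assumes "complex_measure \<nu>" "B \<in> sets borel"
  shows "ennreal (norm (\<nu> B)) \<le> total_variation \<nu>"
proof -
  define D where "D n = (if n = 0 then B else if n = 1 then - B else {})" for n :: nat
  have "(\<Union>n. D n) = UNIV"
  proof -
    have "x \<in> D 0 \<or> x \<in> D 1" for x by (auto simp: D_def)
    then show ?thesis by blast
  qed
  then have "D \<in> {A. range A \<subseteq> sets borel \<and> disjoint_family A \<and> (\<Union>n. A n) = UNIV}"
    using assms(2) by (auto simp: D_def disjoint_family_on_def)
  then have "(\<Sum>n. ennreal (norm (\<nu> (D n)))) \<le> total_variation \<nu>"
    unfolding total_variation_def by (rule SUP_upper)
  moreover have "(\<Sum>n\<in>{0}. ennreal (norm (\<nu> (D n)))) \<le> (\<Sum>n. ennreal (norm (\<nu> (D n))))"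
    by (rule sum_le_suminf) auto
  ultimately show ?thesis by (simp add: D_def)
qed

lemma sets_pos_variation: "sets (pos_variation s) = sets borel"
  unfolding pos_variation_def by (simp add: sets_measure_of sets.sigma_sets_eq[of borel, simplified])

text \<open>No additivity of \<open>s\<close> is needed: otherwise \<open>measure_of\<close> yields the zero measure.\<close>

lemma emeasure_pos_variation_le:
  assumes "\<And>B. B \<in> sets borel \<Longrightarrow> ennreal (s B) \<le> V"
  shows "emeasure (pos_variation s) UNIV \<le> V"
  unfolding pos_variation_def emeasure_measure_of_conv
  using assms by (auto intro!: SUP_least)

context cz_kernel
begin

lemma trunc_dens_four_parts:
  assumes r: "0 < r"
    and g: "\<And>g. g \<in> {a, b, c, d} \<Longrightarrow> g \<in> borel_measurable borel \<and> (\<forall>y. 0 \<le> g y) \<and> finite_measure (dens g)"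
  shows "(\<integral>y. kern r x y *
      (complex_of_real (a y) - complex_of_real (b y) + \<i> * (complex_of_real (c y) - complex_of_real (d y))) \<partial>\<mu>)
    = trunc (dens a) r x - trunc (dens b) r x + \<i> * (trunc (dens c) r x - trunc (dens d) r x)"
proof -
  let ?k = "\<lambda>g y. kern r x y * complex_of_real (g y)"
  have int: "integrable \<mu> (?k g)" if "g \<in> {a, b, c, d}" for g
    using g[OF that] by (intro trunc_dens_integrable_of_finite r) auto
  have eq: "trunc (dens g) r x = (\<integral>y. ?k g y \<partial>\<mu>)" if "g \<in> {a, b, c, d}" for g
    using g[OF that] by (intro trunc_dens r) auto
  have "(\<integral>y. kern r x y *
      (complex_of_real (a y) - complex_of_real (b y) + \<i> * (complex_of_real (c y) - complex_of_real (d y))) \<partial>\<mu>)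
    = (\<integral>y. (?k a y - ?k b y) + \<i> * (?k c y - ?k d y) \<partial>\<mu>)"
    by (intro Bochner_Integration.integral_cong) (auto simp: algebra_simps)
  also have "\<dots> = (\<integral>y. ?k a y - ?k b y \<partial>\<mu>) + (\<integral>y. \<i> * (?k c y - ?k d y) \<partial>\<mu>)"
    by (intro Bochner_Integration.integral_add Bochner_Integration.integrable_diff integrable_mult_right int) auto
  also have "\<dots> = ((\<integral>y. ?k a y \<partial>\<mu>) - (\<integral>y. ?k b y \<partial>\<mu>)) + \<i> * ((\<integral>y. ?k c y \<partial>\<mu>) - (\<integral>y. ?k d y \<partial>\<mu>))"
    using int[of a] int[of b] int[of c] int[of d] by simp
  finally show ?thesis by (simp add: eq)
qed

lemma truncated_fun_eq:
  "truncated_fun \<mu> K r f x = (\<integral>y. kern r x y * f y \<partial>\<mu>)"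
  unfolding truncated_fun_def set_lebesgue_integral_def
  by (intro Bochner_Integration.integral_cong) (auto simp: indicator_def)

end

text \<open>Applied to \<open>f\<close> and to \<open>- f\<close>, this and \<open>Im_pos\<close>
  give the four nonnegative parts of \<open>f\<close>, each of which has a positive measure as
  density.\<close>

definition Re_pos :: "('a \<Rightarrow> complex) \<Rightarrow> 'a \<Rightarrow> real" where "Re_pos f x = max 0 (Re (f x))"
definition Im_pos :: "('a \<Rightarrow> complex) \<Rightarrow> 'a \<Rightarrow> real" where "Im_pos f x = max 0 (Im (f x))"

lemma four_parts_eq:
  "f x = complex_of_real (Re_pos f x) - complex_of_real (Re_pos (- f) x)
     + \<i> * (complex_of_real (Im_pos f x) - complex_of_real (Im_pos (- f) x))"
  by (auto simp: Re_pos_def Im_pos_def complex_eq_iff max_def)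

lemma parts_of:
  assumes "g \<in> {Re_pos f, Re_pos (- f), Im_pos f, Im_pos (- f)}"
  shows "0 \<le> g x" "g x \<le> norm (f x)" "f \<in> borel_measurable M \<Longrightarrow> g \<in> borel_measurable M"
proof -
  show "0 \<le> g x" using assms by (auto simp: Re_pos_def Im_pos_def)
  show "g x \<le> norm (f x)" using assms abs_Re_le_cmod[of "f x"] abs_Im_le_cmod[of "f x"]
    by (auto simp: Re_pos_def Im_pos_def)
  show "g \<in> borel_measurable M" if [measurable]: "f \<in> borel_measurable M"
    using assms by (auto simp: Re_pos_def[abs_def] Im_pos_def[abs_def])
qed

context cz_operator
begin

abbreviation tsharp4 :: "'a measure \<Rightarrow> 'a measure \<Rightarrow> 'a measure \<Rightarrow> 'a measure \<Rightarrow> 'a \<Rightarrow> ennreal" where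
  "tsharp4 P1 P2 P3 P4 x \<equiv> tsharp P1 x + tsharp P2 x + tsharp P3 x + tsharp P4 x"

text \<open>If a sum of four terms exceeds \<open>t\<close>, one of them exceeds t/4. Four level
  sets, each bounded by 4 C11 V / t, account for the factor 16.\<close>

lemma weak_L1_norm_le_four:
  assumes P: "\<And>P. P \<in> {P1, P2, P3, P4} \<Longrightarrow> finite_measure P \<and> sets P = sets borel \<and> measure P UNIV \<le> V"
    and G: "\<And>x. G x \<le> tsharp4 P1 P2 P3 P4 x"
  shows "weak_L1_norm \<mu> G \<le> ennreal (16 * C11) * ennreal V"
  unfolding weak_L1_norm_def
proof (rule SUP_least)
  fix t :: real assume "t \<in> {0<..}"
  then have t: "0 < t" by simp
  have "measure P1 UNIV \<le> V" using P[of P1] by simp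
  then have V: "0 \<le> V" using measure_nonneg[of P1 UNIV] by linarith
  let ?U = "\<lambda>P. {x. ennreal (t / 4) < tsharp P x}"
  have Um: "?U P \<in> sets \<mu>" if "P \<in> {P1, P2, P3, P4}" for P
    using tsharp_measurable[of P] P[OF that] by simp
  have Ule: "emeasure \<mu> (?U P) \<le> ennreal (4 * C11 * V / t)" if "P \<in> {P1, P2, P3, P4}" for P
  proof -
    have "emeasure \<mu> (?U P) \<le> ennreal (C11 * measure P UNIV / (t / 4))"
      using P[OF that] t by (intro weak_11) auto
    also have "C11 * measure P UNIV / (t / 4) \<le> C11 * V / (t / 4)"
      using P[OF that] t C11_pos by (intro divide_right_mono mult_left_mono) auto
    then have "ennreal (C11 * measure P UNIV / (t / 4)) \<le> ennreal (4 * C11 * V / t)"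
      by (intro ennreal_leI) (simp add: mult_ac)
    finally show ?thesis .
  qed
  have "{x \<in> space \<mu>. ennreal t < G x} \<subseteq> ?U P1 \<union> ?U P2 \<union> ?U P3 \<union> ?U P4"
  proof
    fix x assume "x \<in> {x \<in> space \<mu>. ennreal t < G x}"
    then have x: "ennreal t < G x" by simp
    show "x \<in> ?U P1 \<union> ?U P2 \<union> ?U P3 \<union> ?U P4"
    proof (rule ccontr)
      assume "x \<notin> ?U P1 \<union> ?U P2 \<union> ?U P3 \<union> ?U P4"
      then have "tsharp4 P1 P2 P3 P4 x
         \<le> ennreal (t / 4) + ennreal (t / 4) + ennreal (t / 4) + ennreal (t / 4)"
        by (intro add_mono) (auto simp: not_less)
      also have "\<dots> = ennreal t" using t by (simp add: ennreal_plus[symmetric] del: ennreal_plus)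
      finally show False using x G[of x] by (meson not_less order_trans)
    qed
  qed
  then have "emeasure \<mu> {x \<in> space \<mu>. ennreal t < G x} \<le> emeasure \<mu> (?U P1 \<union> ?U P2 \<union> ?U P3 \<union> ?U P4)"
    using Um by (intro emeasure_mono) (auto simp del: sets_mu)
  also have "\<dots> \<le> emeasure \<mu> (?U P1) + emeasure \<mu> (?U P2) + emeasure \<mu> (?U P3) + emeasure \<mu> (?U P4)"
    using Um by (intro order_trans[OF emeasure_subadditive] add_right_mono order_trans[OF emeasure_subadditive] emeasure_subadditive)
      (auto simp del: sets_mu)
  also have "\<dots> \<le> ennreal (4 * C11 * V / t) + ennreal (4 * C11 * V / t) + ennreal (4 * C11 * V / t) + ennreal (4 * C11 * V / t)"
    by (intro add_mono Ule) auto
  also have "\<dots> = ennreal (16 * C11 * V / t)"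
    using t V C11_pos by (simp add: ennreal_plus[symmetric] del: ennreal_plus)
  finally have "ennreal t * emeasure \<mu> {x \<in> space \<mu>. ennreal t < G x} \<le> ennreal t * ennreal (16 * C11 * V / t)"
    by (intro mult_left_mono) auto
  also have "\<dots> = ennreal (16 * C11) * ennreal V"
    using t V C11_pos by (simp add: ennreal_mult[symmetric])
  finally show "ennreal t * emeasure \<mu> {x \<in> space \<mu>. ennreal t < G x} \<le> ennreal (16 * C11) * ennreal V" .
qed

text \<open>Each of the four variations has mass at most the total variation, because the value of
  \<nu> on any Borel set occurs in the sum over a partition. If the total variation is infinite, so
  is the right side.\<close>

theorem maximal_meas_weak_11:
  assumes \<nu>: "complex_measure \<nu>"
  shows "weak_L1_norm \<mu> (maximal_meas K \<nu>) \<le> ennreal (16 * C11) * total_variation \<nu>"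
proof (cases "total_variation \<nu> = top")
  case True
  then show ?thesis using C11_pos by (simp add: ennreal_mult_top)
next
  case False
  then obtain V where V: "total_variation \<nu> = ennreal V" "0 \<le> V" by (cases "total_variation \<nu>") auto
  let ?P1 = "pos_variation (\<lambda>A. Re (\<nu> A))" and ?P2 = "pos_variation (\<lambda>A. - Re (\<nu> A))"
  let ?P3 = "pos_variation (\<lambda>A. Im (\<nu> A))" and ?P4 = "pos_variation (\<lambda>A. - Im (\<nu> A))"
  have P: "finite_measure (pos_variation s) \<and> sets (pos_variation s) = sets borel \<and> measure (pos_variation s) UNIV \<le> V"
    if "\<And>B. s B \<le> norm (\<nu> B)" for s
  proof -
    have le: "emeasure (pos_variation s) UNIV \<le> ennreal V"
      unfolding V(1)[symmetric]
      by (rule emeasure_pos_variation_le) (rule order_trans[OF ennreal_leI[OF that] norm_le_total_variation[OF \<nu>]])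
    have sp: "space (pos_variation s) = UNIV" using sets_eq_imp_space_eq[OF sets_pos_variation] by simp
    have "finite_measure (pos_variation s)"
      using le by (intro finite_measureI) (auto simp: sp top_unique)
    moreover have "measure (pos_variation s) UNIV \<le> V"
      unfolding measure_def using le V(2) by (intro enn2real_leI)
    ultimately show ?thesis using sets_pos_variation by blast
  qed
  have G: "maximal_meas K \<nu> x \<le> tsharp4 ?P1 ?P2 ?P3 ?P4 x" for x
    unfolding maximal_meas_def
  proof (rule SUP_least)
    fix r :: real assume "r \<in> {0<..}"
    then have r: "0 < r" by simp
    have "truncated_meas K r \<nu> x = trunc ?P1 r x - trunc ?P2 r x + \<i> * (trunc ?P3 r x - trunc ?P4 r x)"
      unfolding truncated_meas_def cm_integral_def trunc_def ..
    then have "ennreal (norm (truncated_meas K r \<nu> x)) \<le> ennreal (norm (trunc ?P1 r x)) + ennreal (norm (trunc ?P2 r x)) + ennreal (norm (trunc ?P3 r x)) + ennreal (norm (trunc ?P4 r x))"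
      using ennreal_norm_four_parts_le by metis
    also have "\<dots> \<le> tsharp4 ?P1 ?P2 ?P3 ?P4 x"
      by (intro add_mono trunc_le_tsharp r)
    finally show "ennreal (norm (truncated_meas K r \<nu> x)) \<le> tsharp4 ?P1 ?P2 ?P3 ?P4 x" .
  qed
  have b: "Re z \<le> norm z" "- Re z \<le> norm z" "Im z \<le> norm z" "- Im z \<le> norm z" for z
    using abs_Re_le_cmod[of z] abs_Im_le_cmod[of z] by auto
  show ?thesis unfolding V(1)
    by (rule weak_L1_norm_le_four[OF _ G]) (use P b in auto)
qed

text \<open>The four parts of an integrable \<open>f\<close> have finite mass, so
  \<open>weak_11\<close> applies to their densities directly.\<close>

theorem maximal_fun_weak_11:
  assumes f: "f \<in> Lp_space \<mu> 1"
  shows "weak_L1_norm \<mu> (maximal_fun \<mu> K f) \<le> ennreal (16 * C11) * Lp_norm \<mu> 1 (\<lambda>x. ennreal (norm (f x)))"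
proof -
  have norm1: "Lp_norm \<mu> 1 (\<lambda>x. ennreal (norm (f x))) = (\<integral>\<^sup>+ x. ennreal (norm (f x)) \<partial>\<mu>)"
    by (simp add: Lp_norm_def)
  then obtain V where V: "(\<integral>\<^sup>+ x. ennreal (norm (f x)) \<partial>\<mu>) = ennreal V" "0 \<le> V"
    using f unfolding Lp_space_def by (cases "\<integral>\<^sup>+ x. ennreal (norm (f x)) \<partial>\<mu>") auto
  have fm: "f \<in> borel_measurable borel" using f unfolding Lp_space_def measurable_cong_sets[OF sets_mu refl] by blast
  let ?S = "{Re_pos f, Re_pos (- f), Im_pos f, Im_pos (- f)}"
  have S: "g \<in> borel_measurable borel" "(\<forall>y. 0 \<le> g y)" "finite_measure (dens g)" "measure (dens g) UNIV \<le> V" if g: "g \<in> ?S" for g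
  proof -
    show gm: "g \<in> borel_measurable borel" "(\<forall>y. 0 \<le> g y)" using parts_of[OF g] fm by auto
    have le: "(\<integral>\<^sup>+ x. ennreal (g x) \<partial>\<mu>) \<le> ennreal V"
      unfolding V(1)[symmetric] using parts_of(2)[OF g] by (intro nn_integral_mono ennreal_leI)
    then show "finite_measure (dens g)" using gm(1) by (intro finite_measure_dens) (auto intro: le_less_trans)
    show "measure (dens g) UNIV \<le> V"
      unfolding measure_dens_UNIV[OF gm(1)] using le V(2) by (intro enn2real_leI)
  qed
  let ?R = "dens (Re_pos f)" and ?R' = "dens (Re_pos (- f))" and ?J = "dens (Im_pos f)" and ?J' = "dens (Im_pos (- f))"
  have G: "maximal_fun \<mu> K f x \<le> tsharp4 ?R ?R' ?J ?J' x" for x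
    unfolding maximal_fun_def
  proof (rule SUP_least)
    fix r :: real assume "r \<in> {0<..}"
    then have r: "0 < r" by simp
    have "truncated_fun \<mu> K r f x = trunc ?R r x - trunc ?R' r x
        + \<i> * (trunc ?J r x - trunc ?J' r x)"
      unfolding truncated_fun_eq
      by (subst four_parts_eq[of f], rule trunc_dens_four_parts[OF r]) (use S in blast)
    then have "ennreal (norm (truncated_fun \<mu> K r f x)) \<le> ennreal (norm (trunc ?R r x)) + ennreal (norm (trunc ?R' r x))
      + ennreal (norm (trunc ?J r x)) + ennreal (norm (trunc ?J' r x))"
      using ennreal_norm_four_parts_le by metis
    also have "\<dots> \<le> tsharp4 ?R ?R' ?J ?J' x"
      by (intro add_mono trunc_le_tsharp r)
    finally show "ennreal (norm (truncated_fun \<mu> K r f x)) \<le> tsharp4 ?R ?R' ?J ?J' x" .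
  qed
  show ?thesis unfolding norm1 V(1)
  proof (rule weak_L1_norm_le_four[OF _ G])
    fix P assume "P \<in> {?R, ?R', ?J, ?J'}"
    then obtain g where "g \<in> ?S" "P = dens g" by blast
    then show "finite_measure P \<and> sets P = sets borel \<and> measure P UNIV \<le> V"
      using S(3,4) sets_dens by blast
  qed
qed

section \<open>From bounded functions of bounded support to all of L^p\<close>

definition cutoff :: "nat \<Rightarrow> ('a \<Rightarrow> real) \<Rightarrow> 'a \<Rightarrow> real" where
  "cutoff n g y = min (g y) (real n) * indicator (ball undefined (real n)) y"

lemma cutoff_le: "0 \<le> g y \<Longrightarrow> cutoff n g y \<le> g y"
  by (auto simp: cutoff_def indicator_def)

lemma bdd_supp_fun_cutoff:
  assumes "g \<in> borel_measurable borel" "\<And>y. 0 \<le> g y"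
  shows "bdd_supp_fun (cutoff n g)"
  by (rule bdd_supp_funI[of _ "real n" undefined "real n"])
     (use assms in \<open>auto simp: cutoff_def[abs_def] indicator_def split: if_splits\<close>)

lemma cutoff_tendsto: "(\<lambda>n. cutoff n g y) \<longlonglongrightarrow> g y"
proof -
  obtain n1 :: nat where n1: "g y < real n1" using reals_Archimedean2 by blast
  obtain n2 :: nat where n2: "dist undefined y < real n2" using reals_Archimedean2 by blast
  have "cutoff n g y = g y" if "max n1 n2 \<le> n" for n
  proof -
    have "g y < real n" "dist undefined y < real n" using n1 n2 that by (auto intro: less_le_trans)
    then show ?thesis by (simp add: cutoff_def min_def)
  qed
  then show ?thesis
    by (intro tendsto_eventually) (auto simp: eventually_sequentially intro!: exI[of _ "max n1 n2"])
qed

text \<open>If the kernel times \<open>f\<close> is not integrable, the Bochner integral in the truncation is zero.\<close>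

lemma maximal_fun_le_liminf:
  assumes fm: "f \<in> borel_measurable borel"
  shows "maximal_fun \<mu> K f x \<le> liminf (\<lambda>n. tsharp (dens (cutoff n (Re_pos f))) x + tsharp (dens (cutoff n (Re_pos (- f)))) x
      + tsharp (dens (cutoff n (Im_pos f))) x + tsharp (dens (cutoff n (Im_pos (- f)))) x)" (is "_ \<le> liminf ?H")
  unfolding maximal_fun_def
proof (rule SUP_least)
  fix r :: real assume "r \<in> {0<..}"
  then have r: "0 < r" by simp
  let ?S = "{Re_pos f, Re_pos (- f), Im_pos f, Im_pos (- f)}"
  have S: "bdd_supp_fun (cutoff n g)" if g: "g \<in> ?S" for g n
    using parts_of[OF g] fm by (intro bdd_supp_fun_cutoff) auto
  let ?\<kappa> = "\<lambda>y. kern r x y"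
  let ?c = "\<lambda>n y. complex_of_real (cutoff n (Re_pos f) y) - complex_of_real (cutoff n (Re_pos (- f)) y)
       + \<i> * (complex_of_real (cutoff n (Im_pos f) y) - complex_of_real (cutoff n (Im_pos (- f)) y))"
  show "ennreal (norm (truncated_fun \<mu> K r f x)) \<le> liminf ?H"
  proof (cases "integrable \<mu> (\<lambda>y. ?\<kappa> y * f y)")
    case False
    then show ?thesis unfolding truncated_fun_eq by (simp add: not_integrable_integral_eq)
  next
    case True
    have c: "(\<integral>y. ?\<kappa> y * ?c n y \<partial>\<mu>) = trunc (dens (cutoff n (Re_pos f))) r x - trunc (dens (cutoff n (Re_pos (- f)))) r x
       + \<i> * (trunc (dens (cutoff n (Im_pos f))) r x - trunc (dens (cutoff n (Im_pos (- f)))) r x)" for n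
      by (rule trunc_dens_four_parts[OF r])
         (use S[of _ n] in \<open>auto intro: bdd_supp_fun_measurable bdd_supp_fun_nonneg bdd_supp_fun_finite_measure\<close>)
    have km: "?\<kappa> \<in> borel_measurable \<mu>" by (rule trunc_integrand_measurable[OF r sets_mu])
    have cm: "?c n \<in> borel_measurable \<mu>" for n
    proof -
      have [measurable]: "cutoff n g \<in> borel_measurable borel" if "g \<in> ?S" for g
        by (rule bdd_supp_fun_measurable[OF S[OF that]])
      show ?thesis by simp
    qed
    have "(\<lambda>n. \<integral>y. ?\<kappa> y * ?c n y \<partial>\<mu>) \<longlonglongrightarrow> (\<integral>y. ?\<kappa> y * f y \<partial>\<mu>)"
    proof (rule integral_dominated_convergence[where w = "\<lambda>y. 4 * norm (?\<kappa> y * f y)"])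
      show "AE y in \<mu>. (\<lambda>n. ?\<kappa> y * ?c n y) \<longlonglongrightarrow> ?\<kappa> y * f y"
      proof (rule AE_I2)
        fix y
        have "(\<lambda>n. ?\<kappa> y * ?c n y) \<longlonglongrightarrow> ?\<kappa> y * (complex_of_real (Re_pos f y) - complex_of_real (Re_pos (- f) y)
           + \<i> * (complex_of_real (Im_pos f y) - complex_of_real (Im_pos (- f) y)))"
          by (intro tendsto_intros cutoff_tendsto)
        then show "(\<lambda>n. ?\<kappa> y * ?c n y) \<longlonglongrightarrow> ?\<kappa> y * f y" unfolding four_parts_eq[symmetric] .
      qed
      fix n
      show "AE y in \<mu>. norm (?\<kappa> y * ?c n y) \<le> 4 * norm (?\<kappa> y * f y)"
      proof (rule AE_I2)
        fix y
        have "norm (complex_of_real (cutoff n g y)) \<le> norm (f y)" if g: "g \<in> ?S" for g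
          using cutoff_le[of g y n] parts_of(1,2)[OF g, of y] bdd_supp_fun_nonneg[OF S[OF g], of n y] by simp
        then have "norm (complex_of_real (cutoff n (Re_pos f) y)) + norm (complex_of_real (cutoff n (Re_pos (- f)) y))
          + norm (complex_of_real (cutoff n (Im_pos f) y)) + norm (complex_of_real (cutoff n (Im_pos (- f)) y))
          \<le> norm (f y) + norm (f y) + norm (f y) + norm (f y)" by (intro add_mono) blast+
        then have "norm (?c n y) \<le> 4 * norm (f y)"
          using norm_four_parts_le[of "complex_of_real (cutoff n (Re_pos f) y)" "complex_of_real (cutoff n (Re_pos (- f)) y)"
             "complex_of_real (cutoff n (Im_pos f) y)" "complex_of_real (cutoff n (Im_pos (- f)) y)"] by linarith
        then have "norm (?\<kappa> y) * norm (?c n y) \<le> norm (?\<kappa> y) * (4 * norm (f y))" by (intro mult_left_mono) auto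
        then show "norm (?\<kappa> y * ?c n y) \<le> 4 * norm (?\<kappa> y * f y)" unfolding norm_mult by simp
      qed
      show "(\<lambda>y. ?\<kappa> y * ?c n y) \<in> borel_measurable \<mu>" using km cm by (rule borel_measurable_times)
    qed (use True in \<open>auto intro: borel_measurable_integrable\<close>)
    then have lim: "(\<lambda>n. ennreal (norm (\<integral>y. ?\<kappa> y * ?c n y \<partial>\<mu>))) \<longlonglongrightarrow> ennreal (norm (truncated_fun \<mu> K r f x))"
      unfolding truncated_fun_eq by (intro tendsto_ennrealI tendsto_norm)
    have "ennreal (norm (\<integral>y. ?\<kappa> y * ?c n y \<partial>\<mu>)) \<le> ?H n" for n
      unfolding c
      by (rule order_trans[OF ennreal_norm_four_parts_le]) (intro add_mono trunc_le_tsharp r)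
    then have "liminf (\<lambda>n. ennreal (norm (\<integral>y. ?\<kappa> y * ?c n y \<partial>\<mu>))) \<le> liminf ?H"
      by (intro Liminf_mono) simp
    then show ?thesis using lim_imp_Liminf[OF sequentially_bot lim] by simp
  qed
qed

theorem maximal_fun_Lp:
  assumes p: "1 < p"
  shows "\<exists>c>0. \<forall>f\<in>Lp_space \<mu> p.
    Lp_norm \<mu> p (maximal_fun \<mu> K f) \<le> ennreal c * Lp_norm \<mu> p (\<lambda>x. ennreal (norm (f x)))"
proof -
  obtain c where c: "0 < c" and bound: "\<And>f. bdd_supp_fun f \<Longrightarrow>
    (\<integral>\<^sup>+ x. ennreal_rpow (tsharp (dens f) x) p \<partial>\<mu>) \<le> ennreal c * (\<integral>\<^sup>+ x. ennreal (f x powr p) \<partial>\<mu>)"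
    using tsharp_Lp_bdd_supp[OF p] by blast
  \<comment> \<open>4 powr p is the price of the p-th power of a sum of four terms, 4 * c the sum of
    the bounds for the four parts.\<close>
  define D where "D = 4 powr p * (4 * c)"
  have D: "0 < D" using c by (simp add: D_def)
  have main: "Lp_norm \<mu> p (maximal_fun \<mu> K f) \<le> ennreal (D powr (1 / p)) * Lp_norm \<mu> p (\<lambda>x. ennreal (norm (f x)))"
    if f: "f \<in> Lp_space \<mu> p" for f
  proof -
    have fm: "f \<in> borel_measurable borel" using f unfolding Lp_space_def measurable_cong_sets[OF sets_mu refl] by blast
    let ?I = "\<integral>\<^sup>+ x. ennreal_rpow (ennreal (norm (f x))) p \<partial>\<mu>"
    let ?S = "{Re_pos f, Re_pos (- f), Im_pos f, Im_pos (- f)}"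
    let ?t = "\<lambda>n g x. tsharp (dens (cutoff n g)) x"
    let ?H = "\<lambda>n x. ?t n (Re_pos f) x + ?t n (Re_pos (- f)) x + ?t n (Im_pos f) x + ?t n (Im_pos (- f)) x"
    have S: "bdd_supp_fun (cutoff n g)" if g: "g \<in> ?S" for g n
      using parts_of[OF g] fm by (intro bdd_supp_fun_cutoff) auto
    have tm: "?t n g \<in> borel_measurable \<mu>" if "g \<in> ?S" for n g
      using tsharp_measurable[OF bdd_supp_fun_finite_measure[OF S[OF that]]] by simp
    have Hm: "(\<lambda>x. ennreal_rpow (?H n x) p) \<in> borel_measurable \<mu>" for n
      by (intro measurable_compose[OF _ ennreal_rpow_measurable] borel_measurable_add tm) auto
    have ti: "(\<integral>\<^sup>+ x. ennreal_rpow (?t n g x) p \<partial>\<mu>) \<le> ennreal c * ?I" if g: "g \<in> ?S" for n g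
    proof -
      have "(\<integral>\<^sup>+ x. ennreal (cutoff n g x powr p) \<partial>\<mu>) \<le> ?I"
      proof (rule nn_integral_mono)
        fix x
        have "cutoff n g x \<le> norm (f x)"
          using cutoff_le[of g x n] parts_of(1,2)[OF g, of x] by linarith
        then have "cutoff n g x powr p \<le> norm (f x) powr p"
          using p bdd_supp_fun_nonneg[OF S[OF g]] by (intro powr_mono2) auto
        then show "ennreal (cutoff n g x powr p) \<le> ennreal_rpow (ennreal (norm (f x))) p" by (simp add: ennreal_leI)
      qed
      then show ?thesis using bound[OF S[OF g, of n]] by (meson mult_left_mono order_trans zero_le)
    qed
    have Hi: "(\<integral>\<^sup>+ x. ennreal_rpow (?H n x) p \<partial>\<mu>) \<le> ennreal D * ?I" for n
    proof -
      have rm: "(\<lambda>x. ennreal_rpow (?t n g x) p) \<in> borel_measurable \<mu>" if "g \<in> ?S" for g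
        by (intro measurable_compose[OF _ ennreal_rpow_measurable] tm that)
      have "(\<integral>\<^sup>+ x. ennreal_rpow (?H n x) p \<partial>\<mu>) \<le> (\<integral>\<^sup>+ x. ennreal (4 powr p) * (ennreal_rpow (?t n (Re_pos f) x) p
          + ennreal_rpow (?t n (Re_pos (- f)) x) p + ennreal_rpow (?t n (Im_pos f) x) p + ennreal_rpow (?t n (Im_pos (- f)) x) p) \<partial>\<mu>)"
        using p by (intro nn_integral_mono ennreal_rpow_add4_le) simp
      also have "\<dots> = ennreal (4 powr p) * ((\<integral>\<^sup>+ x. ennreal_rpow (?t n (Re_pos f) x) p \<partial>\<mu>)
          + (\<integral>\<^sup>+ x. ennreal_rpow (?t n (Re_pos (- f)) x) p \<partial>\<mu>) + (\<integral>\<^sup>+ x. ennreal_rpow (?t n (Im_pos f) x) p \<partial>\<mu>)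
          + (\<integral>\<^sup>+ x. ennreal_rpow (?t n (Im_pos (- f)) x) p \<partial>\<mu>))"
        using rm[of "Re_pos f"] rm[of "Re_pos (- f)"] rm[of "Im_pos f"] rm[of "Im_pos (- f)"]
        by (simp add: nn_integral_cmult nn_integral_add borel_measurable_add)
      also have "\<dots> \<le> ennreal (4 powr p) * (ennreal c * ?I + ennreal c * ?I + ennreal c * ?I + ennreal c * ?I)"
        by (intro mult_left_mono add_mono ti) auto
      also have "ennreal c * ?I + ennreal c * ?I + ennreal c * ?I + ennreal c * ?I = ennreal (4 * c) * ?I"
      proof -
        have "ennreal (4 * c) = ennreal c + ennreal c + ennreal c + ennreal c"
          using c by (simp add: ennreal_plus[symmetric] del: ennreal_plus)
        then show ?thesis by (simp add: distrib_right)
      qed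
      also have "ennreal (4 powr p) * (ennreal (4 * c) * ?I) = ennreal D * ?I"
        using c by (simp add: D_def ennreal_mult mult.assoc)
      finally show ?thesis .
    qed
    have "(\<integral>\<^sup>+ x. ennreal_rpow (maximal_fun \<mu> K f x) p \<partial>\<mu>) \<le> (\<integral>\<^sup>+ x. liminf (\<lambda>n. ennreal_rpow (?H n x) p) \<partial>\<mu>)"
      using p by (intro nn_integral_mono ennreal_rpow_Liminf_le maximal_fun_le_liminf fm) simp
    also have "\<dots> \<le> liminf (\<lambda>n. \<integral>\<^sup>+ x. ennreal_rpow (?H n x) p \<partial>\<mu>)"
      by (rule nn_integral_liminf[OF Hm])
    also have "\<dots> \<le> liminf (\<lambda>n::nat. ennreal D * ?I)"
      by (intro Liminf_mono always_eventually allI Hi)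
    also have "\<dots> = ennreal D * ?I" by (simp add: Liminf_const)
    finally have "Lp_norm \<mu> p (maximal_fun \<mu> K f) \<le> ennreal_rpow (ennreal D * ?I) (1 / p)"
      unfolding Lp_norm_def using p by (intro ennreal_rpow_mono) auto
    also have "\<dots> = ennreal (D powr (1 / p)) * Lp_norm \<mu> p (\<lambda>x. ennreal (norm (f x)))"
      unfolding Lp_norm_def by (rule ennreal_rpow_cmult[OF D])
    finally show ?thesis .
  qed
  show ?thesis using main D by (intro exI[of _ "D powr (1 / p)"]) auto
qed

end

section \<open>From the hypotheses to the constants of the locale\<close>

lemma Lp_norm_2_le_imp:
  fixes f g :: "'a \<Rightarrow> complex"
  assumes C: "0 < C" and le: "Lp_norm M 2 (\<lambda>x. ennreal (norm (g x))) \<le> ennreal C * Lp_norm M 2 (\<lambda>x. ennreal (norm (f x)))"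
  shows "(\<integral>\<^sup>+ x. ennreal ((norm (g x))\<^sup>2) \<partial>M) \<le> ennreal (C\<^sup>2) * (\<integral>\<^sup>+ x. ennreal ((norm (f x))\<^sup>2) \<partial>M)"
proof -
  have sq: "a powr 2 = a\<^sup>2" if "0 \<le> a" for a :: real
    using that by (cases "a = 0") auto
  have N: "ennreal_rpow (Lp_norm M 2 (\<lambda>x. ennreal (norm (h x)))) 2 = (\<integral>\<^sup>+ x. ennreal ((norm (h x))\<^sup>2) \<partial>M)" for h :: "'a \<Rightarrow> complex"
    unfolding Lp_norm_def by (simp add: ennreal_rpow_rpow sq)
  have "(\<integral>\<^sup>+ x. ennreal ((norm (g x))\<^sup>2) \<partial>M) = ennreal_rpow (Lp_norm M 2 (\<lambda>x. ennreal (norm (g x)))) 2" by (simp add: N)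
  also have "\<dots> \<le> ennreal_rpow (ennreal C * Lp_norm M 2 (\<lambda>x. ennreal (norm (f x)))) 2"
    by (intro ennreal_rpow_mono le) simp
  also have "\<dots> = ennreal (C powr 2) * ennreal_rpow (Lp_norm M 2 (\<lambda>x. ennreal (norm (f x)))) 2"
    by (rule ennreal_rpow_cmult[OF C])
  also have "\<dots> = ennreal (C\<^sup>2) * (\<integral>\<^sup>+ x. ennreal ((norm (f x))\<^sup>2) \<partial>M)"
    using C by (simp add: N sq)
  finally show ?thesis .
qed

theorem corollary1p1:
  fixes \<mu> :: "'a::{metric_space, second_countable_topology} measure"
    and lam :: "'a \<Rightarrow> real \<Rightarrow> real"
    and K :: "'a \<Rightarrow> 'a \<Rightarrow> complex"
    and T :: "('a \<Rightarrow> complex) \<Rightarrow> 'a \<Rightarrow> complex"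
  assumes borel: "sets \<mu> = sets borel"
    and upper_doubling: "dominating_function \<mu> lam"
    and geom_doubling: "geometrically_doubling TYPE('a)"
    and non_atomic: "\<And>x. emeasure \<mu> {x} = 0"
    and kernel: "standard_kernel lam K"
    and CZ: "CZ_operator \<mu> K T"
    and L2_bounded: "bounded_on_Lp \<mu> 2 T"
  shows "(\<forall>p>1. \<exists>c>0. \<forall>f\<in>Lp_space \<mu> p.
            Lp_norm \<mu> p (maximal_fun \<mu> K f) \<le> ennreal c * Lp_norm \<mu> p (\<lambda>x. ennreal (norm (f x))))
       \<and> (\<exists>c>0.
            (\<forall>\<nu>. complex_measure \<nu> \<longrightarrow>
               weak_L1_norm \<mu> (maximal_meas K \<nu>) \<le> ennreal c * total_variation \<nu>) \<and>
            (\<forall>f\<in>Lp_space \<mu> 1.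
               weak_L1_norm \<mu> (maximal_fun \<mu> K f) \<le> ennreal c * Lp_norm \<mu> 1 (\<lambda>x. ennreal (norm (f x)))))"
proof -
  have dom: "\<forall>x. \<forall>r>0. 0 < lam x r" "\<forall>x. mono_on {0<..} (lam x)"
      "\<exists>C>0. \<forall>x. \<forall>r>0. emeasure \<mu> (ball x r) \<le> ennreal (lam x r) \<and> lam x r \<le> C * lam x (r / 2)"
      "\<exists>C>0. \<forall>x y. \<forall>r>0. dist x y \<le> r \<longrightarrow> lam x r \<le> C * lam y r"
    using upper_doubling unfolding dominating_function_def by blast+
  obtain C1 where "\<forall>x. \<forall>r>0. emeasure \<mu> (ball x r) \<le> ennreal (lam x r) \<and> lam x r \<le> C1 * lam x (r / 2)"
    using dom(3) by blast
  then have C1: "\<And>x r. 0 < r \<Longrightarrow> emeasure \<mu> (ball x r) \<le> ennreal (lam x r)"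
      "\<And>x r. 0 < r \<Longrightarrow> lam x r \<le> C1 * lam x (r / 2)" by simp_all
  obtain C2 where "\<forall>x y. \<forall>r>0. dist x y \<le> r \<longrightarrow> lam x r \<le> C2 * lam y r"
    using dom(4) by blast
  then have C2: "\<And>x y r. 0 < r \<Longrightarrow> dist x y \<le> r \<Longrightarrow> lam x r \<le> C2 * lam y r" by simp
  have lam_pos: "\<And>x r. 0 < r \<Longrightarrow> 0 < lam x r" using dom(1) by simp
  obtain N :: nat where "\<forall>x::'a. \<forall>r>0. \<exists>S. finite S \<and> card S \<le> N \<and> ball x r \<subseteq> (\<Union>y\<in>S. ball y (r / 2))"
    using geom_doubling unfolding geometrically_doubling_def by blast
  then have N: "\<And>x r. 0 < r \<Longrightarrow> \<exists>S. finite S \<and> card S \<le> N \<and> ball (x :: 'a) r \<subseteq> (\<Union>y\<in>S. ball y (r / 2))"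
    by simp
  obtain \<tau> C where K0: "0 < \<tau>" "0 < C" "\<forall>x y. x \<noteq> y \<longrightarrow> norm (K x y) \<le> C / lam x (dist x y)"
    "\<forall>x x' y. x \<noteq> y \<and> 2 * dist x x' \<le> dist x y \<longrightarrow> norm (K x y - K x' y) + norm (K y x - K y x')
       \<le> C * (dist x x' powr \<tau> / (dist x y powr \<tau> * lam x (dist x y)))"
    using kernel unfolding standard_kernel_def by auto
  have K: "\<And>x y. x \<noteq> y \<Longrightarrow> norm (K x y) \<le> C / lam x (dist x y)"
    "\<And>x x' y. x \<noteq> y \<Longrightarrow> 2 * dist x x' \<le> dist x y \<Longrightarrow> norm (K x y - K x' y) + norm (K y x - K y x')
       \<le> C * (dist x x' powr \<tau> / (dist x y powr \<tau> * lam x (dist x y)))"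
    using K0(3,4) by simp_all
  obtain B where B: "0 < B" "\<And>f. f \<in> Linf_b \<mu> \<Longrightarrow>
      Lp_norm \<mu> 2 (\<lambda>x. ennreal (norm (T f x))) \<le> ennreal B * Lp_norm \<mu> 2 (\<lambda>x. ennreal (norm (f x)))"
    using L2_bounded unfolding bounded_on_Lp_def by blast
  define Cl where "Cl = max 1 C1"
  \<comment> \<open>The threshold meets \<open>A_ge\<close> and \<open>N_A\<close> at once, so
    almost every point has doubling radii both above and below any given scale.\<close>
  define A where "A = max (2 * Cl ^ 4) (2 * real N ^ 4)"
  interpret cz_operator \<mu> lam Cl "max 1 C2" A K \<tau> C T "max 1 (B\<^sup>2)" N
  proof unfold_locales
    fix x y x' :: 'a and r s :: real
    show "lam x r \<le> lam x s" if "0 < r" "r \<le> s"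
      using monotone_onD[OF dom(2)[rule_format, of x], of r s] that by simp
    show "lam x r \<le> Cl * lam x (r / 2)" if "0 < r"
    proof -
      have "lam x r \<le> C1 * lam x (r / 2)" by (rule C1(2)[OF that])
      also have "\<dots> \<le> Cl * lam x (r / 2)"
        using lam_pos[of "r / 2" x] that by (intro mult_right_mono) (auto simp: Cl_def)
      finally show ?thesis .
    qed
    show "lam x r \<le> max 1 C2 * lam y r" if "0 < r" "dist x y \<le> r"
    proof -
      have "lam x r \<le> C2 * lam y r" by (rule C2[OF that])
      also have "\<dots> \<le> max 1 C2 * lam y r"
        using lam_pos[of r y] that by (intro mult_right_mono) auto
      finally show ?thesis .
    qed
    show "norm (K x y - K x' y) \<le> C * (dist x x' powr \<tau> / (dist x y powr \<tau> * lam x (dist x y)))"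
      if "x \<noteq> y" "2 * dist x x' \<le> dist x y"
      using K(2)[OF that] norm_ge_zero[of "K y x - K y x'"] by linarith
    show "norm (K y x - K y x') \<le> C * (dist x x' powr \<tau> / (dist x y powr \<tau> * lam x (dist x y)))"
      if "x \<noteq> y" "2 * dist x x' \<le> dist x y"
      using K(2)[OF that] norm_ge_zero[of "K x y - K x' y"] by linarith
  next
    fix f assume f: "f \<in> Linf_b \<mu>"
    have "(\<integral>\<^sup>+ x. ennreal ((norm (T f x))\<^sup>2) \<partial>\<mu>) \<le> ennreal (B\<^sup>2) * (\<integral>\<^sup>+ x. ennreal ((norm (f x))\<^sup>2) \<partial>\<mu>)"
      by (rule Lp_norm_2_le_imp[OF B(1) B(2)[OF f]])
    also have "\<dots> \<le> ennreal (max 1 (B\<^sup>2)) * (\<integral>\<^sup>+ x. ennreal ((norm (f x))\<^sup>2) \<partial>\<mu>)"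
      by (intro mult_right_mono ennreal_leI) auto
    finally show "(\<integral>\<^sup>+ x. ennreal ((norm (T f x))\<^sup>2) \<partial>\<mu>) \<le> ennreal (max 1 (B\<^sup>2)) * (\<integral>\<^sup>+ x. ennreal ((norm (f x))\<^sup>2) \<partial>\<mu>)" .
  qed (use borel lam_pos C1(1) K0(1,2) K(1) non_atomic N CZ in \<open>auto simp: Cl_def A_def\<close>)
  show ?thesis
  proof (rule conjI)
    show "\<forall>p>1. \<exists>c>0. \<forall>f\<in>Lp_space \<mu> p.
        Lp_norm \<mu> p (maximal_fun \<mu> K f) \<le> ennreal c * Lp_norm \<mu> p (\<lambda>x. ennreal (norm (f x)))"
      using maximal_fun_Lp by blast
    show "\<exists>c>0. (\<forall>\<nu>. complex_measure \<nu> \<longrightarrow>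
          weak_L1_norm \<mu> (maximal_meas K \<nu>) \<le> ennreal c * total_variation \<nu>) \<and>
        (\<forall>f\<in>Lp_space \<mu> 1.
          weak_L1_norm \<mu> (maximal_fun \<mu> K f) \<le> ennreal c * Lp_norm \<mu> 1 (\<lambda>x. ennreal (norm (f x))))"
      using maximal_meas_weak_11 maximal_fun_weak_11 C11_pos by (intro exI[of _ "16 * C11"]) simp
  qed
qed

end
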